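(* Let $G$ be a finite group which is non-perfect (i.e. its derived subgroup satisfies $G' \neq G$) and $\{1,2,3\}$-decomposable. Then $G$ is isomorphic to one of $Z_6$, $D_8$, $Q_8$, $S_4$, $\mathrm{SmallGroup}(20,3)$ or $\mathrm{SmallGroup}(24,3)$.
   Context: All groups are finite. For a normal subgroup $K$ of $G$, $ncc(K)$ denotes the number of conjugacy classes of $G$ whose union is $K$. Let $\mathcal{N}_G$ be the set of proper normal subgroups of $G$ (those normal subgroups different from $G$; the trivial subgroup is included when $G \neq 1$), and let $\mathcal{K}_G = \{ncc(A) \mid A \in \mathcal{N}_G\}$. For a non-empty set $X$ of positive integers, $G$ is called $X$-decomposable if $\mathcal{K}_G = X$. $Z_6$ is the cyclic group of order 6, $D_8$ the dihedral group of order 8, $Q_8$ the quaternion group of order 8, $S_4$ the symmetric group on four letters. $\mathrm{SmallGroup}(n,i)$ is the $i$th group of order $n$ in the GAP small group library; explicitly, $\mathrm{SmallGroup}(20,3) \cong \langle x,y \mid x^4 = y^5 = 1,\ x^{-1}yx = y^2\rangle$ (of order 20) and $\mathrm{SmallGroup}(24,3) \cong \langle x,y,z \mid x^3 = y^4 = 1,\ y^2 = z^2,\ z^{-1}yz = y^{-1},\ x^{-1}yx = y^{-1}z^{-1},\ x^{-1}zx = y^{-1}\rangle$ (of order 24). *)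

theory Defs
  imports "HOL-Algebra.Algebra"
begin

definition conjugacy_classes :: "('a, 'b) monoid_scheme \<Rightarrow> 'a set set" where
  "conjugacy_classes G =
     orbits G (carrier G) (\<lambda>g. \<lambda>x \<in> carrier G. g \<otimes>\<^bsub>G\<^esub> x \<otimes>\<^bsub>G\<^esub> inv\<^bsub>G\<^esub> g)"

text \<open>A normal subgroup is the union of exactly those conjugacy classes that it contains.\<close>

definition ncc :: "('a, 'b) monoid_scheme \<Rightarrow> 'a set \<Rightarrow> nat" where
  "ncc G K = card {C \<in> conjugacy_classes G. C \<subseteq> K}"

definition proper_normal_subgroups :: "('a, 'b) monoid_scheme \<Rightarrow> 'a set set" where
  "proper_normal_subgroups G = {N. N \<lhd> G \<and> N \<noteq> carrier G}"

definition decomposable :: "nat set \<Rightarrow> ('a, 'b) monoid_scheme \<Rightarrow> bool" where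
  "decomposable S G \<longleftrightarrow> ncc G ` proper_normal_subgroups G = S"

lemma (in group) Union_conjugacy_classes_normal:
  assumes "K \<lhd> G"
  shows "\<Union> {C \<in> conjugacy_classes G. C \<subseteq> K} = K"
proof
  show "K \<subseteq> \<Union> {C \<in> conjugacy_classes G. C \<subseteq> K}"
  proof
    fix x assume x: "x \<in> K"
    interpret K: normal K G by fact
    have xc: "x \<in> carrier G" using x K.subset by blast
    let ?C = "orbit G (\<lambda>g. \<lambda>x \<in> carrier G. g \<otimes> x \<otimes> inv g) x"
    have "?C \<subseteq> K" using x xc K.inv_op_closed2 by (auto simp: orbit_def)
    moreover have "x \<in> ?C" using xc by (auto simp: orbit_def intro!: exI[of _ \<one>])
    ultimately show "x \<in> \<Union> {C \<in> conjugacy_classes G. C \<subseteq> K}"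
      using xc by (auto simp: conjugacy_classes_def orbits_def)
  qed
qed auto

text \<open>The generators are all elements of the type \<open>'a\<close>; \<open>GInv a\<close> stands for the formal
  inverse of \<open>Gen a\<close>. A pair \<open>(u, v)\<close> of words stands for the relation \<open>u = v\<close>.\<close>

datatype 'a letter = Gen 'a | GInv 'a

inductive word_eq :: "('a letter list \<times> 'a letter list) set \<Rightarrow>
    'a letter list \<Rightarrow> 'a letter list \<Rightarrow> bool" for R where
  refl: "word_eq R u u"
| sym: "word_eq R u v \<Longrightarrow> word_eq R v u"
| trans: "word_eq R u v \<Longrightarrow> word_eq R v w \<Longrightarrow> word_eq R u w"
| cancel_right: "word_eq R (p @ [Gen a, GInv a] @ q) (p @ q)"
| cancel_left: "word_eq R (p @ [GInv a, Gen a] @ q) (p @ q)"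
| relation: "(u, v) \<in> R \<Longrightarrow> word_eq R (p @ u @ q) (p @ v @ q)"

definition word_rel :: "('a letter list \<times> 'a letter list) set \<Rightarrow>
    ('a letter list \<times> 'a letter list) set" where
  "word_rel R = {(u, v). word_eq R u v}"

definition presented_group :: "('a letter list \<times> 'a letter list) set \<Rightarrow>
    'a letter list set monoid" where
  "presented_group R =
     \<lparr> carrier = UNIV // word_rel R,
       monoid.mult = (\<lambda>A B. \<Union>u\<in>A. \<Union>v\<in>B. word_rel R `` {u @ v}),
       one = word_rel R `` {[]} \<rparr>"

lemma equiv_word_rel: "equiv UNIV (word_rel R)"
  by (rule equivI)
     (auto simp: word_rel_def refl_on_def sym_def trans_def
        intro: word_eq.refl word_eq.sym word_eq.trans)

lemma word_eq_context: "word_eq R u v \<Longrightarrow> word_eq R (p @ u @ q) (p @ v @ q)"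
proof (induction rule: word_eq.induct)
  case (cancel_right p' a q')
  then show ?case using word_eq.cancel_right[of R "p @ p'" a "q' @ q"] by simp
next
  case (cancel_left p' a q')
  then show ?case using word_eq.cancel_left[of R "p @ p'" a "q' @ q"] by simp
next
  case (relation u v p' q')
  then show ?case using word_eq.relation[of u v R "p @ p'" "q' @ q"] by simp
qed (auto intro: word_eq.refl word_eq.sym word_eq.trans)

lemma word_eq_append: "word_eq R u u' \<Longrightarrow> word_eq R v v' \<Longrightarrow> word_eq R (u @ v) (u' @ v')"
  using word_eq_context[of R u u' "[]" v] word_eq_context[of R v v' u' "[]"]
  by (auto intro: word_eq.trans)

lemma presented_group_mult:
  "word_rel R `` {u} \<otimes>\<^bsub>presented_group R\<^esub> word_rel R `` {v} = word_rel R `` {u @ v}"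
proof -
  have "congruent2 (word_rel R) (word_rel R) (\<lambda>u v. word_rel R `` {u @ v})"
    by (rule congruent2I', rule equiv_class_eq[OF equiv_word_rel])
       (auto simp: word_rel_def intro: word_eq_append)
  then show ?thesis
    using UN_equiv_class2[OF equiv_word_rel equiv_word_rel] by (simp add: presented_group_def)
qed

primrec letter_inverse :: "'a letter \<Rightarrow> 'a letter" where
  "letter_inverse (Gen a) = GInv a"
| "letter_inverse (GInv a) = Gen a"

lemma word_eq_inverse: "word_eq R (rev (map letter_inverse w) @ w) []"
proof (induction w)
  case (Cons l w)
  have "word_eq R (rev (map letter_inverse w) @ [letter_inverse l, l] @ w)
          (rev (map letter_inverse w) @ w)"
    by (cases l) (use word_eq.cancel_left word_eq.cancel_right in \<open>fastforce+\<close>)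
  then show ?case using Cons word_eq.trans by fastforce
qed (simp add: word_eq.refl)

lemma group_presented_group: "group (presented_group R)"
proof -
  have one: "\<one>\<^bsub>presented_group R\<^esub> = word_rel R `` {[]}"
    by (simp add: presented_group_def)
  have carr: "x \<in> carrier (presented_group R) \<longleftrightarrow> (\<exists>u. x = word_rel R `` {u})" for x
    by (auto simp: presented_group_def quotient_def)
  show ?thesis
  proof (rule groupI)
    fix x assume "x \<in> carrier (presented_group R)"
    then obtain u where u: "x = word_rel R `` {u}" by (auto simp: carr)
    have "word_rel R `` {rev (map letter_inverse u) @ u} = word_rel R `` {[]}"
      by (rule equiv_class_eq[OF equiv_word_rel]) (simp add: word_rel_def word_eq_inverse)
    then show "\<exists>y\<in>carrier (presented_group R).
        y \<otimes>\<^bsub>presented_group R\<^esub> x = \<one>\<^bsub>presented_group R\<^esub>"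
      by (intro bexI[of _ "word_rel R `` {rev (map letter_inverse u)}"])
         (auto simp: u one carr presented_group_mult)
  qed (auto simp: carr one presented_group_mult)
qed

datatype gens2 = X2 | Y2

datatype gens3 = X3 | Y3 | Z3

text \<open>The dihedral group of order \<open>2 * n\<close> (infinite dihedral for \<open>n = 0\<close>).\<close>

definition dihedral_group :: "nat \<Rightarrow> gens2 letter list set monoid" where
  "dihedral_group n = presented_group
     {(replicate n (Gen X2), []),
      ([Gen Y2, Gen Y2], []),
      ([GInv Y2, Gen X2, Gen Y2], [GInv X2])}"

definition quaternion_group :: "gens2 letter list set monoid" where
  "quaternion_group = presented_group
     {(replicate 4 (Gen X2), []),
      ([Gen X2, Gen X2], [Gen Y2, Gen Y2]),
      ([GInv Y2, Gen X2, Gen Y2], [GInv X2])}"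

text \<open>The indices are those of the GAP library of small groups. The first group is the Frobenius
  group of order 20, the second one is \<open>SL(2,3)\<close>.\<close>

definition SmallGroup_20_3 :: "gens2 letter list set monoid" where
  "SmallGroup_20_3 = presented_group
     {(replicate 4 (Gen X2), []),
      (replicate 5 (Gen Y2), []),
      ([GInv X2, Gen Y2, Gen X2], [Gen Y2, Gen Y2])}"

definition SmallGroup_24_3 :: "gens3 letter list set monoid" where
  "SmallGroup_24_3 = presented_group
     {(replicate 3 (Gen X3), []),
      (replicate 4 (Gen Y3), []),
      ([Gen Y3, Gen Y3], [Gen Z3, Gen Z3]),
      ([GInv Z3, Gen Y3, Gen Z3], [GInv Y3]),
      ([GInv X3, Gen Y3, Gen X3], [GInv Y3, GInv Z3]),
      ([GInv X3, Gen Z3, Gen X3], [GInv Y3])}"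

end

(* G has a normal subgroup M of prime index r, since G is not perfect. By hypothesis some normal
   subgroups A and B have ncc A = 2 and ncc B = 3. If M does not contain a suitable one of them,
   then G is the direct product of M with that subgroup, which is central of order r, and counting
   classes gives G = Z_6.

   Otherwise 1 < A < M < G, and A - 1 and M - A are single conjugacy classes. With |A| = al and
   |M| = al * be, the sizes of these classes divide |G| = al * be * r, so al - 1 divides be * r and
   be - 1 divides r, whence be = 2 or be = r + 1. Centralizers of elements of A and of M - A then
   have known orders, and comparing them leaves only |G| = 8, 20 or 24, with enough information
   about A and M to identify G. If be is even and al is odd, all elements of M - A are involutions
   inverting A, which excludes most cases. *)

theory Submission
  imports Defs
begin

text \<open>Class counts grow strictly along proper inclusions of normal subgroups, and a growth by
  one makes the set difference a single class; this is how the three admissible values become the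
  two classes A - 1 and M - A. The divisibilities are so restrictive because al - 1 is coprime to
  al, and because |M - A| = al * (be - 1) shares its factor al with |G|. Divisibility alone still
  leaves parameters without a group: with be = 2, al = 3 or al = 2 * r + 1 for odd r; with be = 3,
  al = 7. They fall either to a second normal subgroup above A, whose difference from A must again
  be a single class, or to commutativity of G/A, which confines a class to one coset of A. A
  presented group is a quotient of words with no size known in advance. Besides elements satisfying
  the relations, an isomorphism needs an upper bound for its order, taken from a finite set of
  normal forms closed under right multiplication by the generators. S_4 is recognised by a faithful
  action on four points instead.\<close>

hide_const (open) Divisibility.prime

section \<open>Conjugacy classes and subgroups of finite groups\<close>

context group
begin

lemma mult_inv_cancel_left [simp]: "x \<in> carrier G \<Longrightarrow> y \<in> carrier G \<Longrightarrow> x \<otimes> (inv x \<otimes> y) = y"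
  by (simp flip: m_assoc)

lemma inv_mult_cancel_left [simp]: "x \<in> carrier G \<Longrightarrow> y \<in> carrier G \<Longrightarrow> inv x \<otimes> (x \<otimes> y) = y"
  by (simp flip: m_assoc)

lemma conj_eq_iff_commute:
  "g \<in> carrier G \<Longrightarrow> x \<in> carrier G \<Longrightarrow> g \<otimes> x \<otimes> inv g = x \<longleftrightarrow> g \<otimes> x = x \<otimes> g"
  by (metis inv_closed inv_solve_right m_closed)

text \<open>The orbit of \<open>conjugacy_classes\<close> without its restricted function; the two
  agree on elements of the carrier.\<close>

definition conj_class :: "'a \<Rightarrow> 'a set" where
  "conj_class x = (\<lambda>g. g \<otimes> x \<otimes> inv g) ` carrier G"

definition centralizer :: "'a \<Rightarrow> 'a set" where
  "centralizer x = {g \<in> carrier G. g \<otimes> x = x \<otimes> g}"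

lemma centralizerI: "g \<in> carrier G \<Longrightarrow> g \<otimes> x = x \<otimes> g \<Longrightarrow> g \<in> centralizer x"
  by (simp add: centralizer_def)

lemma centralizer_sym:
  "x \<in> carrier G \<Longrightarrow> g \<in> centralizer x \<Longrightarrow> x \<in> centralizer g"
  by (simp add: centralizer_def)

lemma conj_class_self: "x \<in> carrier G \<Longrightarrow> x \<in> conj_class x"
  unfolding conj_class_def by (rule image_eqI[of _ _ \<one>]) auto

lemma conj_class_eq_orbit:
  "x \<in> carrier G \<Longrightarrow>
    orbit G (\<lambda>g. \<lambda>x\<in>carrier G. g \<otimes> x \<otimes> inv g) x = conj_class x"
  by (auto simp: orbit_def conj_class_def)

lemma subgroup_centralizer: "x \<in> carrier G \<Longrightarrow> subgroup (centralizer x) G"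
proof (rule subgroupI)
  fix a b assume x: "x \<in> carrier G" and ab: "a \<in> centralizer x" "b \<in> centralizer x"
  then show "a \<otimes> b \<in> centralizer x"
    by (auto simp: centralizer_def m_assoc) (metis m_assoc)
next
  fix a assume "x \<in> carrier G" "a \<in> centralizer x"
  then show "inv a \<in> centralizer x"
    by (auto simp: centralizer_def) (metis inv_closed inv_solve_left m_assoc m_closed inv_solve_right')
qed (auto simp: centralizer_def)

lemma card_conj_class:
  assumes "x \<in> carrier G"
  shows "card (conj_class x) * card (centralizer x) = order G"
proof -
  interpret c: group_action G "carrier G" "\<lambda>g. \<lambda>x\<in>carrier G. g \<otimes> x \<otimes> inv g"
    by (rule action_by_conjugation)
  have "stabilizer G (\<lambda>g. \<lambda>x\<in>carrier G. g \<otimes> x \<otimes> inv g) x = centralizer x"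
    using assms by (auto simp: stabilizer_def centralizer_def) (metis conj_eq_iff_commute)+
  with c.orbit_stabilizer_theorem[OF assms] show ?thesis
    by (simp add: conj_class_eq_orbit assms)
qed

lemma conj_class_eq:
  assumes "x \<in> carrier G" "y \<in> conj_class x"
  shows "conj_class y = conj_class x"
proof -
  obtain g where g: "g \<in> carrier G" "y = g \<otimes> x \<otimes> inv g"
    using assms by (auto simp: conj_class_def)
  show ?thesis
  proof (intro subset_antisym subsetI)
    fix z assume "z \<in> conj_class y"
    then obtain h where "h \<in> carrier G" "z = h \<otimes> y \<otimes> inv h" by (auto simp: conj_class_def)
    with g assms show "z \<in> conj_class x"
      unfolding conj_class_def
      by (intro image_eqI[of _ _ "h \<otimes> g"]) (auto simp: m_assoc inv_mult_group)
  next
    fix z assume "z \<in> conj_class x"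
    then obtain h where "h \<in> carrier G" "z = h \<otimes> x \<otimes> inv h" by (auto simp: conj_class_def)
    with g assms show "z \<in> conj_class y"
      unfolding conj_class_def
      by (intro image_eqI[of _ _ "h \<otimes> inv g"]) (auto simp: m_assoc inv_mult_group)
  qed
qed

lemma conj_class_subset_normal:
  assumes "N \<lhd> G" "x \<in> N"
  shows "conj_class x \<subseteq> N"
  using normal.inv_op_closed2[OF assms(1)] assms(2) by (auto simp: conj_class_def)

lemma ncc_eq_card_conj_class:
  assumes "N \<lhd> G"
  shows "ncc G N = card (conj_class ` N)"
proof -
  have sub: "N \<subseteq> carrier G" using assms normal_imp_subgroup subgroup.subset by blast
  have "conjugacy_classes G = conj_class ` carrier G"
    unfolding conjugacy_classes_def orbits_def Setcompr_eq_image by (intro image_cong) (auto simp: conj_class_eq_orbit)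
  moreover have "{C \<in> conj_class ` carrier G. C \<subseteq> N} = conj_class ` N"
    using sub conj_class_subset_normal[OF assms] conj_class_self by blast
  ultimately show ?thesis by (simp add: ncc_def)
qed

text \<open>Classes inside A stay inside N, while every element of N - A contributes a class that is
  not among them. If the count grows by one, all elements of N - A share that one new class, and it
  avoids A because A is a union of classes.\<close>

lemma ncc_less:
  assumes fin: "finite (carrier G)" and A: "A \<lhd> G" and N: "N \<lhd> G" and "A \<subset> N"
  shows "ncc G A < ncc G N"
    and "ncc G N = Suc (ncc G A) \<Longrightarrow> x \<in> N - A \<Longrightarrow> conj_class x = N - A"
proof -
  have sub: "N \<subseteq> carrier G" "A \<subseteq> carrier G" using A N normal_imp_subgroup subgroup.subset by blast+
  have finN: "finite N" using fin sub finite_subset by blast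
  have new: "conj_class y \<notin> conj_class ` A" if "y \<in> N - A" for y
    using that sub conj_class_self[of y] conj_class_subset_normal[OF A] by blast
  obtain y where y: "y \<in> N - A" using \<open>A \<subset> N\<close> by blast
  have "conj_class ` A \<subset> conj_class ` N"
    using \<open>A \<subset> N\<close> new[OF y] y by blast
  then show "ncc G A < ncc G N"
    using finN by (simp add: ncc_eq_card_conj_class A N psubset_card_mono)
  assume n: "ncc G N = Suc (ncc G A)" and x: "x \<in> N - A"
  have "conj_class ` N = insert (conj_class x) (conj_class ` A)"
  proof (rule card_subset_eq[symmetric])
    show "card (insert (conj_class x) (conj_class ` A)) = card (conj_class ` N)"
      using n new[OF x] finN \<open>A \<subset> N\<close> finite_subset[of A N]
      by (auto simp: ncc_eq_card_conj_class A N)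
  qed (use finN x \<open>A \<subset> N\<close> in auto)
  then have one: "conj_class y = conj_class x" if "y \<in> N - A" for y
    using new[OF that] that by blast
  show "conj_class x = N - A"
  proof
    have "y \<notin> A" if "y \<in> conj_class x" for y
      using that x conj_class_eq[of x y] sub new[OF x] by blast
    then show "conj_class x \<subseteq> N - A"
      using conj_class_subset_normal[OF N] x by blast
    show "N - A \<subseteq> conj_class x"
      using one sub conj_class_self by blast
  qed
qed

section \<open>Consequences of the theorems of Lagrange and Sylow\<close>

lemma card_subgroup_dvd:
  assumes "subgroup H G" "subgroup K G" "H \<subseteq> K"
  shows "card H dvd card K"
proof -
  interpret K: group "G\<lparr>carrier := K\<rparr>" by (rule subgroup_imp_group[OF assms(2)])
  have "subgroup H (G\<lparr>carrier := K\<rparr>)" using assms by (simp add: subgroup_incl)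
  from K.lagrange[OF this] show ?thesis by (metis (no_types, lifting) dvd_triv_right order_def partial_object.select_convs(1) partial_object.update_convs(1) partial_object.surjective)
qed

lemma card_subgroup_dvd_order: "subgroup H G \<Longrightarrow> card H dvd order G"
  by (metis dvd_triv_right lagrange)

text \<open>Sylow's theorem with exponent 1: the cofactor m may still be divisible by p, so the
  subgroup obtained has order exactly p and all its elements have trivial p-th power.\<close>

lemma cauchy:
  assumes "finite (carrier G)" "prime p" "p dvd order G"
  shows "\<exists>x\<in>carrier G. x \<noteq> \<one> \<and> x [^] p = \<one>"
proof -
  obtain m where "order G = p ^ 1 * m" using assms by auto
  from sylow_thm[OF assms(2) is_group this assms(1)]
  obtain H where H: "subgroup H G" "card H = p" by auto
  then obtain x where x: "x \<in> H" "x \<noteq> \<one>"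
    using prime_gt_1_nat[OF assms(2)] card_mono[of "{\<one>}" H] by fastforce
  interpret H: group "G\<lparr>carrier := H\<rparr>" by (rule subgroup_imp_group[OF H(1)])
  have "x [^]\<^bsub>G\<lparr>carrier := H\<rparr>\<^esub> p = \<one>"
    using H.pow_order_eq_1[of x] x H by (simp add: order_def)
  then have "x [^] p = \<one>" by (simp add: nat_pow_def)
  then show ?thesis using x H subgroup.subset by blast
qed

text \<open>Cauchy's theorem in G/N, lifted to a coset representative.\<close>

lemma cauchy_mod:
  assumes fin: "finite (carrier G)" and N: "N \<lhd> G" and p: "prime p" and "order G = card N * k" "p dvd k"
  shows "\<exists>x\<in>carrier G - N. x [^] p \<in> N"
proof -
  interpret N: normal N G by fact
  interpret Q: group "G Mod N" by (rule N.factorgroup_is_group)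
  have "order (G Mod N) * card N = order G"
    using lagrange[OF N.subgroup_axioms] by (simp add: FactGroup_def order_def)
  moreover have "card N > 0" using fin N.subset N.one_closed finite_subset card_gt_0_iff by blast
  ultimately have "order (G Mod N) = k" using assms(4) by (simp add: mult.commute)
  then have "p dvd order (G Mod N)" using assms by simp
  moreover have "finite (carrier (G Mod N))" using fin by (simp add: carrier_FactGroup)
  ultimately obtain cs where cs: "cs \<in> carrier (G Mod N)" "cs \<noteq> N" "cs [^]\<^bsub>G Mod N\<^esub> p = N"
    using Q.cauchy[OF _ p] by auto
  then obtain x where x: "x \<in> carrier G" "cs = N #> x" by (auto simp: carrier_FactGroup)
  then have "N #> (x [^] p) = N" using cs N.FactGroup_pow by simp
  then have "x [^] p \<in> N" using x
    using rcos_self[OF nat_pow_closed[OF x(1)] N.subgroup_axioms, of p] by simp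
  moreover have "x \<notin> N" using cs x N.rcos_const by auto
  ultimately show ?thesis using x by blast
qed

lemma pow_index_mem:
  assumes fin: "finite (carrier G)" and N: "N \<lhd> G" and "order G = card N * k" "g \<in> carrier G"
  shows "g [^] k \<in> N"
proof -
  interpret N: normal N G by fact
  interpret Q: group "G Mod N" by (rule N.factorgroup_is_group)
  have "order (G Mod N) * card N = order G"
    using lagrange[OF N.subgroup_axioms] by (simp add: FactGroup_def order_def)
  moreover have "card N > 0" using fin N.subset N.one_closed finite_subset card_gt_0_iff by blast
  ultimately have k: "order (G Mod N) = k" using assms(3) by (simp add: mult.commute)
  have "(N #> g) [^]\<^bsub>G Mod N\<^esub> k = N"
    using Q.pow_order_eq_1[of "N #> g"] assms k by (auto simp: carrier_FactGroup)
  then have "N #> (g [^] k) = N" using assms N.FactGroup_pow by simp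
  then show ?thesis using rcos_self[OF nat_pow_closed[OF assms(4)] N.subgroup_axioms, of k] by simp
qed

text \<open>By Bezout, g is a product of integer powers of g^m and g^n.\<close>

lemma pow_coprime_mem:
  assumes H: "subgroup H G" and g: "g \<in> carrier G" and "g [^] (m::nat) \<in> H" "g [^] (n::nat) \<in> H" "coprime m n"
  shows "g \<in> H"
proof -
  obtain u v where uv: "int m * u + int n * v = 1"
    using bezout_int[of "int m" "int n"] coprime_imp_gcd_eq_1[OF assms(5)]
    by (auto simp: gcd_int_int_eq mult.commute)
  have "g [^] (int m * u) = (g [^] m) [^] u" "g [^] (int n * v) = (g [^] n) [^] v"
    using g by (metis int_pow_int int_pow_pow)+
  then have "g [^] (int m * u) \<in> H" "g [^] (int n * v) \<in> H"
    using assms subgroup_int_pow_closed by auto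
  then have "g [^] (int m * u) \<otimes> g [^] (int n * v) \<in> H"
    by (rule subgroup.m_closed[OF H])
  then show ?thesis unfolding int_pow_mult[OF g, symmetric] uv using g by simp
qed

text \<open>For h in H both h^|H| = 1 and h^r lie in N, and these exponents are coprime.\<close>

lemma subgroup_le_normal_prime_index:
  assumes fin: "finite (carrier G)" and N: "N \<lhd> G" and "order G = card N * r" "prime r"
    and H: "subgroup H G" and "\<not> r dvd card H"
  shows "H \<subseteq> N"
proof
  fix h assume h: "h \<in> H"
  interpret H: group "G\<lparr>carrier := H\<rparr>" by (rule subgroup_imp_group[OF H])
  have hG: "h \<in> carrier G" using h H subgroup.subset by blast
  have "h [^]\<^bsub>G\<lparr>carrier := H\<rparr>\<^esub> card H = \<one>"
    using H.pow_order_eq_1[of h] h by (simp add: order_def)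
  then have "h [^] card H = \<one>" by (simp add: nat_pow_def)
  moreover have "\<one> \<in> N" using N normal_imp_subgroup subgroup.one_closed by blast
  ultimately show "h \<in> N"
    using pow_coprime_mem[OF normal_imp_subgroup[OF N] hG, of "card H" r] pow_index_mem[OF fin N assms(3) hG]
      prime_imp_coprime[OF assms(4,6)] by (simp add: coprime_commute)
qed

text \<open>Take M maximal among the proper subgroups containing G'. A subgroup of prime order in
  G/M pulls back to a subgroup strictly above M, hence to G; so G/M itself has that prime
  order.\<close>

lemma exists_normal_prime_index:
  assumes fin: "finite (carrier G)" and "derived G (carrier G) \<noteq> carrier G"
  shows "\<exists>N r. N \<lhd> G \<and> prime r \<and> order G = card N * r"
proof -
  let ?D = "derived G (carrier G)"
  have D: "?D \<lhd> G" by (simp add: derived_self_is_normal)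
  \<comment> \<open>A conjugate of h is a commutator times h, so every subgroup above G' is
    normal.\<close>
  have nor: "H \<lhd> G" if "subgroup H G" "?D \<subseteq> H" for H
  proof (rule normal_invI)
    fix x h assume xh: "x \<in> carrier G" "h \<in> H"
    then have hG: "h \<in> carrier G" using that subgroup.subset by blast
    have "x \<otimes> h \<otimes> inv x \<otimes> inv h \<in> ?D"
      unfolding derived_def by (rule generate.incl, rule UN_I[OF xh(1)], rule UN_I[OF hG]) simp
    then have "x \<otimes> h \<otimes> inv x \<otimes> inv h \<otimes> h \<in> H" using that(2) xh(2) by (auto intro: subgroup.m_closed[OF that(1)])
    then show "x \<otimes> h \<otimes> inv x \<in> H" using xh hG by (simp add: m_assoc)
  qed (use that in auto)
  define S where "S = {H. subgroup H G \<and> ?D \<subseteq> H \<and> H \<noteq> carrier G}"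
  have "finite S" using fin unfolding S_def by (auto intro!: finite_subset[of _ "Pow (carrier G)"] dest: subgroup.subset)
  moreover have "?D \<in> S" using assms D normal_imp_subgroup by (auto simp: S_def)
  ultimately obtain M where M: "M \<in> S" "\<And>H. H \<in> S \<Longrightarrow> M \<subseteq> H \<Longrightarrow> M = H"
    using finite_has_maximal[of S] by (metis empty_iff)
  then have MN: "M \<lhd> G" using nor by (auto simp: S_def)
  interpret M: normal M G by fact
  interpret Q: group "G Mod M" by (rule M.factorgroup_is_group)
  have o: "order (G Mod M) * card M = order G"
    using lagrange[OF M.subgroup_axioms] by (simp add: FactGroup_def order_def)
  have finQ: "finite (carrier (G Mod M))" using fin by (simp add: carrier_FactGroup)
  have "order (G Mod M) \<noteq> 1" using M(1) o fin M.subset card_subset_eq[of "carrier G" M]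
    by (auto simp: order_def S_def)
  then obtain p where p: "prime p" "p dvd order (G Mod M)" using prime_factor_nat by blast
  then obtain m where "order (G Mod M) = p ^ 1 * m" by auto
  from sylow_thm[OF p(1) Q.is_group this finQ]
  obtain H where H: "subgroup H (G Mod M)" "card H = p" by auto
  have sub: "subgroup (\<Union>H) G" by (rule M.factgroup_subgroup_union_subgroup[OF H(1)])
  have char: "\<Union>H = {x \<in> carrier G. M #> x \<in> H}" by (rule M.factgroup_subgroup_union_char[OF H(1)])
  have MH: "M \<in> H" using subgroup.one_closed[OF H(1)] by simp
  have "M \<noteq> \<Union>H"
  proof
    assume e: "M = \<Union>H"
    have "\<forall>cs\<in>H. cs = M"
    proof
      fix cs assume cs: "cs \<in> H"
      have "cs \<in> carrier (G Mod M)" using H(1) cs subgroup.subset by blast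
      then obtain x where x: "x \<in> carrier G" "cs = M #> x" by (auto simp: carrier_FactGroup)
      then have "x \<in> M" using e char cs by blast
      then show "cs = M" using x M.rcos_const by auto
    qed
    with MH have "H = {M}" by blast
    with H(2) prime_gt_1_nat[OF p(1)] show False by simp
  qed
  then have "\<Union>H \<notin> S" using M(2)[of "\<Union>H"] MH by blast
  then have "\<Union>H = carrier G" using sub MH M(1) by (auto simp: S_def)
  then have "carrier (G Mod M) \<subseteq> H" unfolding char carrier_FactGroup by blast
  then have "H = carrier (G Mod M)" using subgroup.subset[OF H(1)] by blast
  then have "order (G Mod M) = p" using H by (simp add: order_def)
  then show ?thesis using o p(1) MN by (metis mult.commute)
qed

end

section \<open>Groups given by generators and relations\<close>

primrec letter_eval :: "('g, 'b) monoid_scheme \<Rightarrow> ('a \<Rightarrow> 'g) \<Rightarrow> 'a letter \<Rightarrow> 'g" where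
  "letter_eval G f (Gen a) = f a"
| "letter_eval G f (GInv a) = inv\<^bsub>G\<^esub> (f a)"

primrec word_eval :: "('g, 'b) monoid_scheme \<Rightarrow> ('a \<Rightarrow> 'g) \<Rightarrow> 'a letter list \<Rightarrow> 'g" where
  "word_eval G f [] = \<one>\<^bsub>G\<^esub>"
| "word_eval G f (l # w) = letter_eval G f l \<otimes>\<^bsub>G\<^esub> word_eval G f w"

context group
begin

lemma letter_eval_closed [simp]: "range f \<subseteq> carrier G \<Longrightarrow> letter_eval G f l \<in> carrier G"
  by (cases l) auto

lemma word_eval_closed [simp]: "range f \<subseteq> carrier G \<Longrightarrow> word_eval G f w \<in> carrier G"
  by (induction w) auto

lemma word_eval_append:
  "range f \<subseteq> carrier G \<Longrightarrow> word_eval G f (u @ v) = word_eval G f u \<otimes> word_eval G f v"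
  by (induction u) (auto simp: m_assoc)

lemma word_eval_respects:
  assumes "range f \<subseteq> carrier G"
    and "\<And>u v. (u, v) \<in> R \<Longrightarrow> word_eval G f u = word_eval G f v"
    and "word_eq R u v"
  shows "word_eval G f u = word_eval G f v"
  using assms(3)
proof induction
  case (cancel_right p a q)
  have "f a \<in> carrier G" using assms(1) by auto
  then show ?case using assms(1) by (simp add: word_eval_append)
next
  case (cancel_left p a q)
  have "f a \<in> carrier G" using assms(1) by auto
  then show ?case using assms(1) by (simp add: word_eval_append)
next
  case (relation u v p q)
  then show ?case using assms(1,2) by (simp add: word_eval_append)
qed auto

end

definition presented_gen :: "('a letter list \<times> 'a letter list) set \<Rightarrow> 'a \<Rightarrow> 'a letter list set" where
  "presented_gen R a = word_rel R `` {[Gen a]}"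

lemma carrier_presented_group: "carrier (presented_group R) = range (\<lambda>u. word_rel R `` {u})"
  by (auto simp: presented_group_def quotient_def)

lemma one_presented_group: "\<one>\<^bsub>presented_group R\<^esub> = word_rel R `` {[]}"
  by (simp add: presented_group_def)

lemma range_presented_gen: "range (presented_gen R) \<subseteq> carrier (presented_group R)"
  by (auto simp: carrier_presented_group presented_gen_def)

lemma presented_gen_closed [simp]: "presented_gen R a \<in> carrier (presented_group R)"
  using range_presented_gen[of R] by auto

lemma word_class_eq: "word_eq R u v \<Longrightarrow> word_rel R `` {u} = word_rel R `` {v}"
  by (rule equiv_class_eq[OF equiv_word_rel]) (simp add: word_rel_def)

lemma word_eval_presented: "word_eval (presented_group R) (presented_gen R) w = word_rel R `` {w}"
proof (induction w)
  case (Cons l w)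
  interpret P: group "presented_group R" by (rule group_presented_group)
  have "letter_eval (presented_group R) (presented_gen R) l = word_rel R `` {[l]}"
  proof (cases l)
    case (GInv a)
    have "inv\<^bsub>presented_group R\<^esub> (presented_gen R a) = word_rel R `` {[GInv a]}"
    proof (rule P.inv_equality)
      show "word_rel R `` {[GInv a]} \<otimes>\<^bsub>presented_group R\<^esub> presented_gen R a
          = \<one>\<^bsub>presented_group R\<^esub>"
        using word_eq.cancel_left[of R "[]" a "[]"] word_class_eq
        by (fastforce simp: presented_gen_def presented_group_mult one_presented_group)
    qed (use presented_gen_closed in \<open>auto simp: carrier_presented_group\<close>)
    then show ?thesis using GInv by simp
  qed (simp add: presented_gen_def)
  with Cons show ?case by (simp add: presented_group_mult)
qed (simp add: one_presented_group)

lemma presented_relation: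
  "(u, v) \<in> R \<Longrightarrow> word_eval (presented_group R) (presented_gen R) u
    = word_eval (presented_group R) (presented_gen R) v"
  using word_eq.relation[of u v R "[]" "[]"] word_class_eq by (simp add: word_eval_presented)

text \<open>Right multiplication by g is injective, hence permutes the finite set S, and the inverse
  permutation is right multiplication by the inverse of g.\<close>

lemma (in group) finite_right_closed_inv:
  assumes "finite S" "S \<subseteq> carrier G" "g \<in> carrier G" "\<And>s. s \<in> S \<Longrightarrow> s \<otimes> g \<in> S" "s \<in> S"
  shows "s \<otimes> inv g \<in> S"
proof -
  have "inj_on (\<lambda>s. s \<otimes> g) S" using assms(2,3) by (auto intro!: inj_onI simp: subset_iff)
  then have "(\<lambda>s. s \<otimes> g) ` S = S"
    using assms(1,4) by (intro card_subset_eq) (auto simp: card_image)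
  then obtain t where "t \<in> S" "s = t \<otimes> g" using assms(5) by auto
  then show ?thesis using assms(2,3) by (auto simp: m_assoc)
qed

text \<open>The source of all upper bounds on presented groups. Closure under inverse letters comes
  for free from finiteness of S. Letters act on the right, so the induction peels words from the
  end.\<close>

lemma carrier_presented_group_eqI:
  assumes fin: "finite S" and S: "S \<subseteq> carrier (presented_group R)"
    and one: "\<one>\<^bsub>presented_group R\<^esub> \<in> S"
    and mult: "\<And>s a. s \<in> S \<Longrightarrow> s \<otimes>\<^bsub>presented_group R\<^esub> presented_gen R a \<in> S"
  shows "carrier (presented_group R) = S"
proof -
  interpret P: group "presented_group R" by (rule group_presented_group)
  have "word_rel R `` {w} \<in> S" for w
  proof (induction w rule: rev_induct)
    case (snoc l w)
    have "word_eval (presented_group R) (presented_gen R) (w @ [l])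
        = word_rel R `` {w} \<otimes>\<^bsub>presented_group R\<^esub> letter_eval (presented_group R) (presented_gen R) l"
      using P.letter_eval_closed[OF range_presented_gen]
      by (simp add: P.word_eval_append range_presented_gen word_eval_presented[symmetric])
    moreover have "word_rel R `` {w} \<otimes>\<^bsub>presented_group R\<^esub> letter_eval (presented_group R) (presented_gen R) l \<in> S"
      using snoc mult P.finite_right_closed_inv[OF fin S presented_gen_closed mult] by (cases l) auto
    ultimately show ?case by (simp add: word_eval_presented)
  qed (use one in \<open>simp add: one_presented_group\<close>)
  then show ?thesis using S by (auto simp: carrier_presented_group)
qed

text \<open>Von Dyck's theorem: evaluating words induces a homomorphism from the presented group to
  G, onto because the images of the generators generate G. The order bound then forces
  injectivity.\<close>

lemma (in group) iso_presented_group: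
  assumes fin: "finite (carrier G)" and f: "range f \<subseteq> carrier G"
    and rel: "\<And>u v. (u, v) \<in> R \<Longrightarrow> word_eval G f u = word_eval G f v"
    and gen: "\<And>H. subgroup H G \<Longrightarrow> range f \<subseteq> H \<Longrightarrow> H = carrier G"
    and finP: "finite (carrier (presented_group R))"
    and card: "card (carrier (presented_group R)) \<le> order G"
  shows "G \<cong> presented_group R"
proof -
  interpret P: group "presented_group R" by (rule group_presented_group)
  \<comment> \<open>Evaluation is constant on each class of words, so this image is a
    singleton.\<close>
  define h where "h A = the_elem (word_eval G f ` A)" for A
  have h: "h (word_rel R `` {w}) = word_eval G f w" for w
  proof -
    have eq: "word_eval G f v = word_eval G f w" if "word_eq R w v" for v
      by (rule word_eval_respects[OF f rel that, symmetric])
    have "word_eval G f ` (word_rel R `` {w}) = {word_eval G f w}"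
    proof
      show "word_eval G f ` (word_rel R `` {w}) \<subseteq> {word_eval G f w}"
        by (auto simp: word_rel_def dest: eq)
      show "{word_eval G f w} \<subseteq> word_eval G f ` (word_rel R `` {w})"
        using equiv_class_self[OF equiv_word_rel, of w R] by blast
    qed
    then show ?thesis by (simp add: h_def)
  qed
  have hom: "h \<in> hom (presented_group R) G"
    by (rule homI) (auto simp: carrier_presented_group h f presented_group_mult word_eval_append)
  interpret h: group_hom "presented_group R" G h
    by (intro group_hom.intro group_hom_axioms.intro group_presented_group is_group hom)
  have "range f \<subseteq> h ` carrier (presented_group R)"
  proof
    fix y assume "y \<in> range f"
    then obtain a where a: "y = f a" by auto
    have "f a \<in> carrier G" using f by blast
    then have "h (presented_gen R a) = y" unfolding presented_gen_def h a by simp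
    then show "y \<in> h ` carrier (presented_group R)"
      using presented_gen_closed[of R a] by blast
  qed
  then have surj: "h ` carrier (presented_group R) = carrier G"
    by (rule gen[OF h.img_is_subgroup])
  then have "inj_on h (carrier (presented_group R))"
    using card card_image_le[OF finP, of h] by (intro eq_card_imp_inj_on) (simp_all add: order_def finP)
  then have "h \<in> iso (presented_group R) G" by (simp add: iso_def bij_betw_def hom surj)
  then show ?thesis by (rule P.iso_sym[OF is_isoI])
qed

lemma (in group) nat_pow_mod: "x \<in> carrier G \<Longrightarrow> x [^] n = \<one> \<Longrightarrow> x [^] (i mod n) = x [^] (i::nat)"
  by (metis div_mult_mod_eq l_one mult.commute nat_pow_closed nat_pow_mult nat_pow_one nat_pow_pow)

lemma (in group) inv_eq_nat_pow: "x \<in> carrier G \<Longrightarrow> x [^] Suc n = \<one> \<Longrightarrow> inv x = x [^] n"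
  by (rule inv_equality) (simp_all add: nat_pow_Suc2)

section \<open>Products x^i y^j as normal forms\<close>

context group
begin

text \<open>The exponents are unbounded, so closure properties need no reduction of exponents;
  reduction happens only when the elements are counted.\<close>

definition metacyclic_set :: "'a \<Rightarrow> 'a \<Rightarrow> 'a set" where
  "metacyclic_set x y = {x [^] i \<otimes> y [^] j | (i::nat) (j::nat). True}"

lemma metacyclic_setI: "x [^] (i::nat) \<otimes> y [^] (j::nat) \<in> metacyclic_set x y"
  by (auto simp: metacyclic_set_def)

text \<open>Reducing i modulo m turns the surplus of x into a power of y^l, which y^j absorbs; then
  the exponent of y is reduced modulo n.\<close>

lemma metacyclic_set_finite:
  assumes "x \<in> carrier G" "y \<in> carrier G" "x [^] m = y [^] (l::nat)" "y [^] n = \<one>" "m > 0" "n > (0::nat)"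
  shows "finite (metacyclic_set x y)" "card (metacyclic_set x y) \<le> m * n"
    "metacyclic_set x y \<subseteq> carrier G" "\<one> \<in> metacyclic_set x y"
proof -
  have sub: "metacyclic_set x y \<subseteq> (\<lambda>(i, j). x [^] i \<otimes> y [^] j) ` ({..<m} \<times> {..<n})"
  proof
    fix s assume "s \<in> metacyclic_set x y"
    then obtain i j :: nat where "s = x [^] i \<otimes> y [^] j" by (auto simp: metacyclic_set_def)
    moreover have "x [^] i = x [^] (i mod m) \<otimes> (x [^] m) [^] (i div m)"
      using assms(1) by (simp add: nat_pow_pow nat_pow_mult)
    ultimately have "s = x [^] (i mod m) \<otimes> y [^] (l * (i div m) + j)"
      using assms by (simp add: nat_pow_pow nat_pow_mult m_assoc)
    then have "s = x [^] (i mod m) \<otimes> y [^] ((l * (i div m) + j) mod n)"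
      using assms nat_pow_mod by simp
    then show "s \<in> (\<lambda>(i, j). x [^] i \<otimes> y [^] j) ` ({..<m} \<times> {..<n})" using assms by auto
  qed
  then show "finite (metacyclic_set x y)" by (rule finite_subset) auto
  have "card (metacyclic_set x y) \<le> card ((\<lambda>(i, j). x [^] i \<otimes> y [^] j) ` ({..<m} \<times> {..<n}))"
    by (rule card_mono[OF _ sub]) auto
  also have "\<dots> \<le> m * n" using card_image_le[of "{..<m} \<times> {..<n}"] by fastforce
  finally show "card (metacyclic_set x y) \<le> m * n" .
  show "metacyclic_set x y \<subseteq> carrier G" using assms by (auto simp: metacyclic_set_def)
  show "\<one> \<in> metacyclic_set x y" using metacyclic_setI[of x 0 y 0] assms by simp
qed

lemma metacyclic_set_right_y:
  assumes "x \<in> carrier G" "y \<in> carrier G" "s \<in> metacyclic_set x y"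
  shows "s \<otimes> y \<in> metacyclic_set x y"
proof -
  obtain i j :: nat where "s = x [^] i \<otimes> y [^] j" using assms by (auto simp: metacyclic_set_def)
  then have "s \<otimes> y = x [^] i \<otimes> y [^] Suc j" using assms by (simp add: m_assoc)
  then show ?thesis by (simp only: metacyclic_setI)
qed

lemma pow_conj_commute:
  assumes "x \<in> carrier G" "y \<in> carrier G" "w \<in> carrier G" "y \<otimes> x = x \<otimes> w"
  shows "y [^] (j::nat) \<otimes> x = x \<otimes> w [^] j"
proof (induction j)
  case (Suc j)
  have "y [^] Suc j \<otimes> x = y [^] j \<otimes> x \<otimes> w" using assms by (simp add: m_assoc)
  then show ?case using assms Suc by (simp add: m_assoc)
qed (use assms in simp)

lemma metacyclic_set_right_x:
  assumes "x \<in> carrier G" "y \<in> carrier G" "y \<otimes> x = x \<otimes> y [^] (k::nat)" "s \<in> metacyclic_set x y"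
  shows "s \<otimes> x \<in> metacyclic_set x y"
proof -
  obtain i j :: nat where s: "s = x [^] i \<otimes> y [^] j" using assms by (auto simp: metacyclic_set_def)
  have "s \<otimes> x = x [^] i \<otimes> (y [^] j \<otimes> x)" using assms s by (simp add: m_assoc)
  also have "y [^] j \<otimes> x = x \<otimes> (y [^] k) [^] j"
    using assms by (intro pow_conj_commute) auto
  finally have "s \<otimes> x = x [^] Suc i \<otimes> y [^] (k * j)"
    using assms by (simp add: m_assoc nat_pow_pow)
  then show ?thesis by (simp only: metacyclic_setI)
qed

end

section \<open>The presented groups of the classification\<close>

lemma (in group) word_eval_replicate:
  "f a \<in> carrier G \<Longrightarrow> word_eval G f (replicate n (Gen a)) = f a [^] n"
  by (induction n) (simp_all, metis nat_pow_Suc nat_pow_Suc2)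

lemma (in group) inv_conj_eq_iff:
  assumes "x \<in> carrier G" "y \<in> carrier G" "w \<in> carrier G"
  shows "inv x \<otimes> (y \<otimes> x) = w \<longleftrightarrow> y \<otimes> x = x \<otimes> w"
  using assms by (metis inv_mult_cancel_left m_closed mult_inv_cancel_left)

text \<open>The last relation moves a to the left past powers of b, so the products a^i b^j exhaust
  the group. The exponent l is 0 if a^m = 1, and 2 for the quaternion group, where the squares of
  both generators agree.\<close>

lemma card_presented_metacyclic:
  fixes R :: "('a letter list \<times> 'a letter list) set"
  defines "P \<equiv> presented_group R"
  assumes gens: "UNIV = {a, b}" and "m > 0" "n > 0"
    and "presented_gen R a [^]\<^bsub>P\<^esub> m = presented_gen R b [^]\<^bsub>P\<^esub> (l::nat)"
    and "presented_gen R b [^]\<^bsub>P\<^esub> n = \<one>\<^bsub>P\<^esub>"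
    and "presented_gen R b \<otimes>\<^bsub>P\<^esub> presented_gen R a
      = presented_gen R a \<otimes>\<^bsub>P\<^esub> presented_gen R b [^]\<^bsub>P\<^esub> (k::nat)"
  shows "finite (carrier P)" "card (carrier P) \<le> m * n"
proof -
  interpret P: group P unfolding P_def by (rule group_presented_group)
  have mem: "presented_gen R c \<in> carrier P" for c unfolding P_def by (rule presented_gen_closed)
  note fin = P.metacyclic_set_finite[OF mem mem assms(5,6,3,4)]
  have "carrier P = P.metacyclic_set (presented_gen R a) (presented_gen R b)"
    unfolding P_def
  proof (rule carrier_presented_group_eqI, fold P_def)
    fix s c assume s: "s \<in> P.metacyclic_set (presented_gen R a) (presented_gen R b)"
    have "c = a \<or> c = b" using gens by auto
    then show "s \<otimes>\<^bsub>P\<^esub> presented_gen R c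
        \<in> P.metacyclic_set (presented_gen R a) (presented_gen R b)"
      using P.metacyclic_set_right_y[OF mem mem s] P.metacyclic_set_right_x[OF mem mem assms(7) s]
      by auto
  qed (rule fin)+
  then show "finite (carrier P)" "card (carrier P) \<le> m * n" using fin by auto
qed

text \<open>Both orders occur: the generator of the normal cyclic subgroup comes second, which is
  \<open>X2\<close> for the dihedral and the quaternion group but \<open>Y2\<close> for the group of
  order 20.\<close>

lemma UNIV_gens2: "(UNIV :: gens2 set) = {X2, Y2}" "(UNIV :: gens2 set) = {Y2, X2}"
  by (auto intro: gens2.exhaust)

lemma UNIV_gens3: "(UNIV :: gens3 set) = {X3, Y3, Z3}"
  by (auto intro: gens3.exhaust)

text \<open>Normal forms use natural exponents, so the inverse is rewritten as a third
  power.\<close>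

lemma (in group) commute_inv_of_conj_inv:
  assumes "x \<in> carrier G" "y \<in> carrier G" "x \<otimes> y = y \<otimes> inv x" "x [^] (4::nat) = \<one>"
  shows "x \<otimes> y = y \<otimes> x [^] (3::nat)"
  using assms inv_eq_nat_pow[of x 3] by (simp add: numeral_eq_Suc)

context group
begin

lemma iso_dihedral_group_4:
  assumes "finite (carrier G)" "order G = 8" "x \<in> carrier G" "y \<in> carrier G"
    and "x [^] (4::nat) = \<one>" "y \<otimes> y = \<one>" "x \<otimes> y = y \<otimes> inv x"
    and gen: "\<And>H. subgroup H G \<Longrightarrow> x \<in> H \<Longrightarrow> y \<in> H \<Longrightarrow> H = carrier G"
  shows "G \<cong> dihedral_group 4"
proof -
  define R where "R = {(replicate 4 (Gen X2), []), ([Gen Y2, Gen Y2], []),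
      ([GInv Y2, Gen X2, Gen Y2], [GInv X2])}"
  interpret P: group "presented_group R" by (rule group_presented_group)
  have x4: "presented_gen R X2 [^]\<^bsub>presented_group R\<^esub> (4::nat) = \<one>\<^bsub>presented_group R\<^esub>"
    using presented_relation[of "replicate 4 (Gen X2)" "[]" R]
    by (simp add: P.word_eval_replicate) (simp add: R_def)
  \<comment> \<open>The zeroth power writes Y2^2 = 1 in the shape a^m = b^l that the order bound
    expects.\<close>
  have y2: "presented_gen R Y2 [^]\<^bsub>presented_group R\<^esub> (2::nat)
      = presented_gen R X2 [^]\<^bsub>presented_group R\<^esub> (0::nat)"
    using presented_relation[of "[Gen Y2, Gen Y2]" "[]" R]
    by (simp add: numeral_2_eq_2) (simp add: R_def)
  have "presented_gen R X2 \<otimes>\<^bsub>presented_group R\<^esub> presented_gen R Y2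
      = presented_gen R Y2 \<otimes>\<^bsub>presented_group R\<^esub> inv\<^bsub>presented_group R\<^esub> presented_gen R X2"
    using presented_relation[of "[GInv Y2, Gen X2, Gen Y2]" "[GInv X2]" R]
    by (simp add: P.inv_conj_eq_iff) (simp add: R_def)
  then have "presented_gen R X2 \<otimes>\<^bsub>presented_group R\<^esub> presented_gen R Y2
      = presented_gen R Y2 \<otimes>\<^bsub>presented_group R\<^esub> presented_gen R X2 [^]\<^bsub>presented_group R\<^esub> (3::nat)"
    by (rule P.commute_inv_of_conj_inv[OF presented_gen_closed presented_gen_closed _ x4])
  note P = card_presented_metacyclic[OF UNIV_gens2(2) _ _ y2 x4 this]
  have "G \<cong> presented_group R"
  proof (rule iso_presented_group[where f = "case_gens2 x y"])
    show "range (case_gens2 x y) \<subseteq> carrier G" using assms by (simp add: UNIV_gens2)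
    show "H = carrier G" if "subgroup H G" "range (case_gens2 x y) \<subseteq> H" for H
      using gen[OF that(1)] that(2) by (simp add: UNIV_gens2)
    show "word_eval G (case_gens2 x y) u = word_eval G (case_gens2 x y) v" if "(u, v) \<in> R" for u v
      using that assms(2-7) unfolding R_def
      by (auto simp: word_eval_replicate inv_conj_eq_iff)
  qed (use P assms in auto)
  then show ?thesis by (simp add: dihedral_group_def R_def)
qed

lemma iso_quaternion_group:
  assumes "finite (carrier G)" "order G = 8" "x \<in> carrier G" "y \<in> carrier G"
    and "x [^] (4::nat) = \<one>" "x \<otimes> x = y \<otimes> y" "x \<otimes> y = y \<otimes> inv x"
    and gen: "\<And>H. subgroup H G \<Longrightarrow> x \<in> H \<Longrightarrow> y \<in> H \<Longrightarrow> H = carrier G"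
  shows "G \<cong> quaternion_group"
proof -
  define R where "R = {(replicate 4 (Gen X2), []), ([Gen X2, Gen X2], [Gen Y2, Gen Y2]),
      ([GInv Y2, Gen X2, Gen Y2], [GInv X2])}"
  interpret P: group "presented_group R" by (rule group_presented_group)
  have x4: "presented_gen R X2 [^]\<^bsub>presented_group R\<^esub> (4::nat) = \<one>\<^bsub>presented_group R\<^esub>"
    using presented_relation[of "replicate 4 (Gen X2)" "[]" R]
    by (simp add: P.word_eval_replicate) (simp add: R_def)
  have y2: "presented_gen R Y2 [^]\<^bsub>presented_group R\<^esub> (2::nat)
      = presented_gen R X2 [^]\<^bsub>presented_group R\<^esub> (2::nat)"
    using presented_relation[of "[Gen X2, Gen X2]" "[Gen Y2, Gen Y2]" R]
    by (simp add: numeral_2_eq_2) (simp add: R_def)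
  have "presented_gen R X2 \<otimes>\<^bsub>presented_group R\<^esub> presented_gen R Y2
      = presented_gen R Y2 \<otimes>\<^bsub>presented_group R\<^esub> inv\<^bsub>presented_group R\<^esub> presented_gen R X2"
    using presented_relation[of "[GInv Y2, Gen X2, Gen Y2]" "[GInv X2]" R]
    by (simp add: P.inv_conj_eq_iff) (simp add: R_def)
  then have "presented_gen R X2 \<otimes>\<^bsub>presented_group R\<^esub> presented_gen R Y2
      = presented_gen R Y2 \<otimes>\<^bsub>presented_group R\<^esub> presented_gen R X2 [^]\<^bsub>presented_group R\<^esub> (3::nat)"
    by (rule P.commute_inv_of_conj_inv[OF presented_gen_closed presented_gen_closed _ x4])
  note P = card_presented_metacyclic[OF UNIV_gens2(2) _ _ y2 x4 this]
  have "G \<cong> presented_group R"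
  proof (rule iso_presented_group[where f = "case_gens2 x y"])
    show "range (case_gens2 x y) \<subseteq> carrier G" using assms by (simp add: UNIV_gens2)
    show "H = carrier G" if "subgroup H G" "range (case_gens2 x y) \<subseteq> H" for H
      using gen[OF that(1)] that(2) by (simp add: UNIV_gens2)
    show "word_eval G (case_gens2 x y) u = word_eval G (case_gens2 x y) v" if "(u, v) \<in> R" for u v
      using that assms(2-7) unfolding R_def
      by (auto simp: word_eval_replicate inv_conj_eq_iff)
  qed (use P assms in auto)
  then show ?thesis by (simp add: quaternion_group_def R_def)
qed

lemma iso_SmallGroup_20_3:
  assumes "finite (carrier G)" "order G = 20" "x \<in> carrier G" "y \<in> carrier G"
    and "x [^] (4::nat) = \<one>" "y [^] (5::nat) = \<one>" "y \<otimes> x = x \<otimes> (y \<otimes> y)"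
    and gen: "\<And>H. subgroup H G \<Longrightarrow> x \<in> H \<Longrightarrow> y \<in> H \<Longrightarrow> H = carrier G"
  shows "G \<cong> SmallGroup_20_3"
proof -
  define R where "R = {(replicate 4 (Gen X2), []), (replicate 5 (Gen Y2), []),
      ([GInv X2, Gen Y2, Gen X2], [Gen Y2, Gen Y2])}"
  interpret P: group "presented_group R" by (rule group_presented_group)
  have x4: "presented_gen R X2 [^]\<^bsub>presented_group R\<^esub> (4::nat)
      = presented_gen R Y2 [^]\<^bsub>presented_group R\<^esub> (0::nat)"
    using presented_relation[of "replicate 4 (Gen X2)" "[]" R]
    by (simp add: P.word_eval_replicate) (simp add: R_def)
  have y5: "presented_gen R Y2 [^]\<^bsub>presented_group R\<^esub> (5::nat) = \<one>\<^bsub>presented_group R\<^esub>"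
    using presented_relation[of "replicate 5 (Gen Y2)" "[]" R]
    by (simp add: P.word_eval_replicate) (simp add: R_def)
  have "presented_gen R Y2 \<otimes>\<^bsub>presented_group R\<^esub> presented_gen R X2
      = presented_gen R X2 \<otimes>\<^bsub>presented_group R\<^esub> presented_gen R Y2 [^]\<^bsub>presented_group R\<^esub> (2::nat)"
    using presented_relation[of "[GInv X2, Gen Y2, Gen X2]" "[Gen Y2, Gen Y2]" R]
    by (simp add: P.inv_conj_eq_iff numeral_2_eq_2) (simp add: R_def)
  note P = card_presented_metacyclic[OF UNIV_gens2(1) _ _ x4 y5 this]
  have "G \<cong> presented_group R"
  proof (rule iso_presented_group[where f = "case_gens2 x y"])
    show "range (case_gens2 x y) \<subseteq> carrier G" using assms by (simp add: UNIV_gens2)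
    show "H = carrier G" if "subgroup H G" "range (case_gens2 x y) \<subseteq> H" for H
      using gen[OF that(1)] that(2) by (simp add: UNIV_gens2)
    show "word_eval G (case_gens2 x y) u = word_eval G (case_gens2 x y) v" if "(u, v) \<in> R" for u v
      using that assms(2-7) unfolding R_def
      by (auto simp: word_eval_replicate inv_conj_eq_iff)
  qed (use P assms in auto)
  then show ?thesis by (simp add: SmallGroup_20_3_def R_def)
qed

text \<open>Order bound for an extension of Q by a cyclic group: the relation q x = x q' carries
  every x to the front, and right multiplication by any other generator only touches the factor from
  Q.\<close>

lemma right_closed_cyclic_extension:
  assumes Q: "finite Q" "Q \<subseteq> carrier G" "\<one> \<in> Q" "\<forall>q\<in>Q. \<exists>q'\<in>Q. q \<otimes> x = x \<otimes> q'"
    and x: "x \<in> carrier G" "x [^] n = \<one>" "n > (0::nat)"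
  defines "S \<equiv> {x [^] i \<otimes> q | (i::nat) q. q \<in> Q}"
  shows "finite S" "card S \<le> n * card Q" "S \<subseteq> carrier G" "\<one> \<in> S"
    and "\<And>s. s \<in> S \<Longrightarrow> s \<otimes> x \<in> S"
    and "\<And>s y. y \<in> carrier G \<Longrightarrow> (\<And>q. q \<in> Q \<Longrightarrow> q \<otimes> y \<in> Q) \<Longrightarrow> s \<in> S \<Longrightarrow> s \<otimes> y \<in> S"
proof -
  have sub: "S \<subseteq> (\<lambda>(i, q). x [^] i \<otimes> q) ` ({..<n} \<times> Q)"
  proof
    fix s assume "s \<in> S"
    then obtain i q where "s = x [^] (i::nat) \<otimes> q" "q \<in> Q" unfolding S_def by blast
    then have "s = (\<lambda>(i, q). x [^] i \<otimes> q) (i mod n, q)" "(i mod n, q) \<in> {..<n} \<times> Q"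
      using x by (simp_all add: nat_pow_mod)
    then show "s \<in> (\<lambda>(i, q). x [^] i \<otimes> q) ` ({..<n} \<times> Q)" by (rule image_eqI)
  qed
  then show "finite S" by (rule finite_subset) (use Q in auto)
  have "card S \<le> card ((\<lambda>(i, q). x [^] i \<otimes> q) ` ({..<n} \<times> Q))"
    by (rule card_mono[OF _ sub]) (use Q in auto)
  also have "\<dots> \<le> n * card Q"
    using card_image_le[of "{..<n} \<times> Q" "\<lambda>(i, q). x [^] i \<otimes> q"] Q(1) by (simp add: card_cartesian_product)
  finally show "card S \<le> n * card Q" .
  show "S \<subseteq> carrier G" using Q x by (auto simp: S_def)
  have "x [^] (0::nat) \<otimes> \<one> \<in> S" unfolding S_def using Q(3) by blast
  then show "\<one> \<in> S" by simp
  fix s assume "s \<in> S"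
  then obtain i q where s: "s = x [^] (i::nat) \<otimes> q" "q \<in> Q" unfolding S_def by blast
  then have qc: "q \<in> carrier G" using Q by blast
  obtain q' where q': "q' \<in> Q" "q \<otimes> x = x \<otimes> q'" using Q(4) s by blast
  then have "q' \<in> carrier G" using Q by blast
  then have "s \<otimes> x = x [^] Suc i \<otimes> q'" using s q' qc x by (simp add: m_assoc)
  then show "s \<otimes> x \<in> S" unfolding S_def using q'(1) by blast
  fix y assume y: "y \<in> carrier G" "\<And>q. q \<in> Q \<Longrightarrow> q \<otimes> y \<in> Q"
  have "s \<otimes> y = x [^] i \<otimes> (q \<otimes> y)" using s qc x y(1) by (simp add: m_assoc)
  then show "s \<otimes> y \<in> S" unfolding S_def using y(2)[OF s(2)] by blast
qed

text \<open>The set is only known to be closed under right multiplication by y, z and their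
  inverses, so x is moved past z^i y^j one letter at a time: each new letter before x becomes a
  factor appended to the element q' found so far.\<close>

lemma metacyclic_set_conj:
  assumes "x \<in> carrier G" "y \<in> carrier G" "z \<in> carrier G"
    and fin: "finite (metacyclic_set z y)" and yz: "y \<otimes> z = z \<otimes> y [^] (3::nat)"
    and yx: "y \<otimes> x = x \<otimes> (inv y \<otimes> inv z)" and zx: "z \<otimes> x = x \<otimes> inv y"
    and q: "q \<in> metacyclic_set z y"
  shows "\<exists>q'\<in>metacyclic_set z y. q \<otimes> x = x \<otimes> q'"
proof -
  let ?Q = "metacyclic_set z y"
  have sub: "?Q \<subseteq> carrier G" using assms by (auto simp: metacyclic_set_def)
  have qy: "q \<otimes> inv y \<in> ?Q" if "q \<in> ?Q" for q
    by (rule finite_right_closed_inv[OF fin sub assms(2) metacyclic_set_right_y[OF assms(3,2)] that])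
  have qz: "q \<otimes> inv z \<in> ?Q" if "q \<in> ?Q" for q
    by (rule finite_right_closed_inv[OF fin sub assms(3) metacyclic_set_right_x[OF assms(3,2) yz] that])
  have step: "\<exists>q'\<in>?Q. q \<otimes> w \<otimes> x = x \<otimes> q'"
    if qc: "q \<in> carrier G" and ex: "\<exists>q'\<in>?Q. q \<otimes> x = x \<otimes> q'" and w: "w = y \<or> w = z" for q w
  proof -
    obtain q' where q': "q' \<in> ?Q" "q \<otimes> x = x \<otimes> q'" using ex by blast
    then have c: "q' \<in> carrier G" using sub by blast
    have eq: "q \<otimes> (x \<otimes> v) = x \<otimes> (q' \<otimes> v)" if "v \<in> carrier G" for v
      using q'(2) c that qc assms(1) by (metis m_assoc)
    show ?thesis
    proof (cases "w = y")
      case True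
      have "q \<otimes> y \<otimes> x = x \<otimes> (q' \<otimes> inv y \<otimes> inv z)"
        using qc assms(1-3) c eq[of "inv y \<otimes> inv z"] yx by (simp add: m_assoc)
      then show ?thesis using True qz[OF qy[OF q'(1)]] by blast
    next
      case False
      have "q \<otimes> z \<otimes> x = x \<otimes> (q' \<otimes> inv y)"
        using qc assms(1-3) c eq[of "inv y"] zx by (simp add: m_assoc)
      then show ?thesis using False w qy[OF q'(1)] by blast
    qed
  qed
  have z: "\<exists>q'\<in>?Q. z [^] (i::nat) \<otimes> x = x \<otimes> q'" for i
  proof (induction i)
    case 0
    show ?case using metacyclic_setI[of z 0 y 0] assms(1) by (intro bexI[of _ \<one>]) auto
  next
    case (Suc i)
    then show ?case using step[OF _ Suc, of z] assms(3) by simp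
  qed
  have "\<exists>q'\<in>?Q. z [^] i \<otimes> y [^] j \<otimes> x = x \<otimes> q'" for i j :: nat
  proof (induction j)
    case 0
    show ?case using z[of i] assms by simp
  next
    case (Suc j)
    then show ?case using step[OF _ Suc, of y] assms(2,3) by (simp add: m_assoc)
  qed
  then show ?thesis using q by (auto simp: metacyclic_set_def)
qed

text \<open>The bound 24 is 2 * 4 normal forms in z and y, from z^2 = y^2 and y^4 = 1, times three
  powers of x.\<close>

lemma iso_SmallGroup_24_3:
  assumes "finite (carrier G)" "order G = 24" "x \<in> carrier G" "y \<in> carrier G" "z \<in> carrier G"
    and "x [^] (3::nat) = \<one>" "y [^] (4::nat) = \<one>" "y \<otimes> y = z \<otimes> z" "y \<otimes> z = z \<otimes> inv y"
      "y \<otimes> x = x \<otimes> (inv y \<otimes> inv z)" "z \<otimes> x = x \<otimes> inv y"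
    and gen: "\<And>H. subgroup H G \<Longrightarrow> x \<in> H \<Longrightarrow> y \<in> H \<Longrightarrow> z \<in> H \<Longrightarrow> H = carrier G"
  shows "G \<cong> SmallGroup_24_3"
proof -
  define R where "R = {(replicate 3 (Gen X3), []), (replicate 4 (Gen Y3), []),
      ([Gen Y3, Gen Y3], [Gen Z3, Gen Z3]), ([GInv Z3, Gen Y3, Gen Z3], [GInv Y3]),
      ([GInv X3, Gen Y3, Gen X3], [GInv Y3, GInv Z3]), ([GInv X3, Gen Z3, Gen X3], [GInv Y3])}"
  define P where "P = presented_group R"
  interpret P: group P unfolding P_def by (rule group_presented_group)
  let ?x = "presented_gen R X3" and ?y = "presented_gen R Y3" and ?z = "presented_gen R Z3"
  have mem: "presented_gen R c \<in> carrier P" for c unfolding P_def by (rule presented_gen_closed)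
  note rel = presented_relation[of _ _ R, folded P_def]
  have x3: "?x [^]\<^bsub>P\<^esub> (3::nat) = \<one>\<^bsub>P\<^esub>"
    using rel[of "replicate 3 (Gen X3)" "[]"]
    by (simp add: P.word_eval_replicate mem) (simp add: R_def)
  have y4: "?y [^]\<^bsub>P\<^esub> (4::nat) = \<one>\<^bsub>P\<^esub>"
    using rel[of "replicate 4 (Gen Y3)" "[]"]
    by (simp add: P.word_eval_replicate mem) (simp add: R_def)
  have z2: "?z [^]\<^bsub>P\<^esub> (2::nat) = ?y [^]\<^bsub>P\<^esub> (2::nat)"
    using rel[of "[Gen Y3, Gen Y3]" "[Gen Z3, Gen Z3]"]
    by (simp add: numeral_2_eq_2 mem) (simp add: R_def)
  have "?y \<otimes>\<^bsub>P\<^esub> ?z = ?z \<otimes>\<^bsub>P\<^esub> inv\<^bsub>P\<^esub> ?y"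
    using rel[of "[GInv Z3, Gen Y3, Gen Z3]" "[GInv Y3]"]
    by (simp add: P.inv_conj_eq_iff mem) (simp add: R_def)
  then have yz: "?y \<otimes>\<^bsub>P\<^esub> ?z = ?z \<otimes>\<^bsub>P\<^esub> ?y [^]\<^bsub>P\<^esub> (3::nat)"
    by (rule P.commute_inv_of_conj_inv[OF mem mem _ y4])
  have yx: "?y \<otimes>\<^bsub>P\<^esub> ?x = ?x \<otimes>\<^bsub>P\<^esub> (inv\<^bsub>P\<^esub> ?y \<otimes>\<^bsub>P\<^esub> inv\<^bsub>P\<^esub> ?z)"
    using rel[of "[GInv X3, Gen Y3, Gen X3]" "[GInv Y3, GInv Z3]"]
    by (simp add: P.inv_conj_eq_iff mem) (simp add: R_def)
  have zx: "?z \<otimes>\<^bsub>P\<^esub> ?x = ?x \<otimes>\<^bsub>P\<^esub> inv\<^bsub>P\<^esub> ?y"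
    using rel[of "[GInv X3, Gen Z3, Gen X3]" "[GInv Y3]"]
    by (simp add: P.inv_conj_eq_iff mem) (simp add: R_def)
  let ?Q = "P.metacyclic_set ?z ?y"
  define S where "S = {?x [^]\<^bsub>P\<^esub> i \<otimes>\<^bsub>P\<^esub> q | (i::nat) q. q \<in> ?Q}"
  note Q = P.metacyclic_set_finite[OF mem mem z2 y4 zero_less_numeral zero_less_numeral]
  have "\<forall>q\<in>?Q. \<exists>q'\<in>?Q. q \<otimes>\<^bsub>P\<^esub> ?x = ?x \<otimes>\<^bsub>P\<^esub> q'"
    by (intro ballI P.metacyclic_set_conj[OF mem mem mem Q(1) yz yx zx])
  note ext = P.right_closed_cyclic_extension[OF Q(1,3,4) this mem x3 zero_less_numeral, folded S_def]
  have "carrier P = S"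
    unfolding P_def
  proof (rule carrier_presented_group_eqI, fold P_def)
    fix s c assume s: "s \<in> S"
    show "s \<otimes>\<^bsub>P\<^esub> presented_gen R c \<in> S"
    proof (cases c)
      case X3
      then show ?thesis using ext(5)[OF s] by simp
    next
      case Y3
      have "s \<otimes>\<^bsub>P\<^esub> ?y \<in> S" by (rule ext(6)[OF mem P.metacyclic_set_right_y[OF mem mem] s])
      then show ?thesis using Y3 by simp
    next
      case Z3
      have "s \<otimes>\<^bsub>P\<^esub> ?z \<in> S" by (rule ext(6)[OF mem P.metacyclic_set_right_x[OF mem mem yz] s])
      then show ?thesis using Z3 by simp
    qed
  qed (rule ext)+
  then have P: "finite (carrier P)" "card (carrier P) \<le> 24" using ext(1,2) Q(2) by auto
  have "G \<cong> P"
    unfolding P_def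
  proof (rule iso_presented_group[where f = "case_gens3 x y z"])
    show "range (case_gens3 x y z) \<subseteq> carrier G" using assms by (simp add: UNIV_gens3)
    show "H = carrier G" if "subgroup H G" "range (case_gens3 x y z) \<subseteq> H" for H
      using gen[OF that(1)] that(2) by (simp add: UNIV_gens3)
    show "word_eval G (case_gens3 x y z) u = word_eval G (case_gens3 x y z) v" if "(u, v) \<in> R" for u v
      using that assms(2-11) unfolding R_def
      by (auto simp: word_eval_replicate inv_conj_eq_iff)
  qed (use P assms in \<open>auto simp: P_def\<close>)
  then show ?thesis by (simp add: SmallGroup_24_3_def R_def P_def)
qed

end

section \<open>Recognising the six groups\<close>

context group
begin

lemma subgroup_eq_carrier:
  assumes "finite (carrier G)" "subgroup H G" "order G < 2 * card H"
  shows "H = carrier G"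
proof -
  obtain k where k: "order G = card H * k" using card_subgroup_dvd_order[OF assms(2)] by blast
  have "order G > 0" using assms(1) order_gt_0_iff_finite by blast
  then have "k < 2" "k > 0" using k assms(3) by auto
  then have "k = 1" by simp
  then show ?thesis
    using assms(1) k subgroup.subset[OF assms(2)] by (intro card_subset_eq) (auto simp: order_def)
qed

lemma ord_dvd_card_subgroup:
  assumes "subgroup H G" "x \<in> H"
  shows "ord x dvd card H"
proof -
  interpret H: group "G\<lparr>carrier := H\<rparr>" by (rule subgroup_imp_group[OF assms(1)])
  have "x [^]\<^bsub>G\<lparr>carrier := H\<rparr>\<^esub> card H = \<one>"
    using H.pow_order_eq_1[of x] assms(2) by (simp add: order_def)
  then have "x [^] card H = \<one>" by (simp add: nat_pow_def)
  then show ?thesis using assms subgroup.mem_carrier pow_eq_id by metis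
qed

lemma iso_integer_mod_group_6:
  assumes "finite (carrier G)" "order G = 6" "a \<in> carrier G" "b \<in> carrier G"
    and "a \<noteq> \<one>" "a \<otimes> a = \<one>" "b \<noteq> \<one>" "b [^] (3::nat) = \<one>" "a \<otimes> b = b \<otimes> a"
  shows "G \<cong> integer_mod_group 6"
proof -
  define c where "c = a \<otimes> b"
  have c: "c \<in> carrier G" using assms by (simp add: c_def)
  have pow: "c [^] n = a [^] n \<otimes> b [^] n" for n :: nat
    unfolding c_def using assms by (intro pow_mult_distrib) auto
  have a2: "a [^] (2::nat) = \<one>" using assms by (simp add: numeral_2_eq_2)
  have oa: "ord a = 2"
    using assms a2 pow_eq_id[of a 2] ord_eq_1[of a] prime_nat_iff[of 2] by auto
  have ob: "ord b = 3"
    using assms pow_eq_id[of b 3] ord_eq_1[of b] prime_nat_iff[of 3] by auto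
  \<comment> \<open>As a and b commute, c^3 = a^3 and c^2 = b^2, and neither is trivial. So the
    order of c is a divisor of 6 dividing neither 3 nor 2.\<close>
  have "c [^] (3::nat) \<noteq> \<one>" "c [^] (2::nat) \<noteq> \<one>"
    using pow[of 3] pow[of 2] assms a2 oa ob pow_eq_id[of a 3] pow_eq_id[of b 2] by auto
  then have n: "\<not> ord c dvd 3" "\<not> ord c dvd 2" using pow_eq_id[OF c] by auto
  have d6: "ord c dvd 6" using assms(2) ord_dvd_group_order[OF c] by simp
  then have "ord c \<le> 6" by (auto dest: dvd_imp_le)
  then have "ord c \<in> {0,1,2,3,4,5,6}" by auto
  then have o: "ord c = 6" using n d6 by auto
  let ?h = "\<lambda>i::int. c [^] i"
  have hom: "?h \<in> hom (integer_mod_group 6) G"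
  proof (rule homI)
    fix x y :: int
    have "c [^] ((x + y) mod 6) = c [^] (x + y)" using c o by (simp add: int_pow_eq mod_eq_dvd_iff[symmetric])
    then show "?h (x \<otimes>\<^bsub>integer_mod_group 6\<^esub> y) = ?h x \<otimes> ?h y" using c by (simp add: int_pow_mult)
  qed (use c in simp)
  have inj: "inj_on ?h (carrier (integer_mod_group 6))"
  proof (rule inj_onI)
    fix x y assume xy: "x \<in> carrier (integer_mod_group 6)" "y \<in> carrier (integer_mod_group 6)" "?h x = ?h y"
    then have "6 dvd y - x" using c o by (simp add: int_pow_eq)
    then have "y mod 6 = x mod 6" by (simp add: mod_eq_dvd_iff)
    then show "x = y" using xy by (simp add: carrier_integer_mod_group)
  qed
  have "?h ` carrier (integer_mod_group 6) = carrier G"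
  proof (rule card_subset_eq[OF assms(1)])
    show "?h ` carrier (integer_mod_group 6) \<subseteq> carrier G" using c by auto
    show "card (?h ` carrier (integer_mod_group 6)) = card (carrier G)"
      unfolding card_image[OF inj] using assms(2) by (simp add: order_def carrier_integer_mod_group)
  qed
  then have "?h \<in> iso (integer_mod_group 6) G" using hom inj by (simp add: iso_def bij_betw_def)
  then show ?thesis by (rule group.iso_sym[OF group_integer_mod_group is_isoI])
qed

text \<open>Faithfulness makes the permutation representation injective; comparing orders makes it
  surjective.\<close>

lemma iso_sym_group_of_faithful_action:
  assumes fin: "finite E" and n: "card E = n" and order: "order G = fact n"
    and closed: "\<And>g e. g \<in> carrier G \<Longrightarrow> e \<in> E \<Longrightarrow> act g e \<in> E"
    and one: "\<And>e. e \<in> E \<Longrightarrow> act \<one> e = e"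
    and mult: "\<And>g h e. g \<in> carrier G \<Longrightarrow> h \<in> carrier G \<Longrightarrow> e \<in> E \<Longrightarrow> act (g \<otimes> h) e = act g (act h e)"
    and faithful: "\<And>g. g \<in> carrier G \<Longrightarrow> (\<And>e. e \<in> E \<Longrightarrow> act g e = e) \<Longrightarrow> g = \<one>"
  shows "G \<cong> sym_group n"
proof -
  define I where "I = {1..n}"
  obtain f where f: "bij_betw f I E" using ex_bij_betw_nat_finite_1[OF fin] n by (auto simp: I_def)
  define k where "k = inv_into I f"
  have kf: "k (f i) = i" if "i \<in> I" for i
    using that f by (simp add: k_def bij_betw_def)
  have fE: "f i \<in> E" if "i \<in> I" for i using bij_betwE[OF f] that by blast
  have fk: "f (k e) = e" "k e \<in> I" if "e \<in> E" for e
    using that f by (auto simp: k_def bij_betw_def f_inv_into_f intro: inv_into_into)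
  \<comment> \<open>The action is transported along the enumeration f of E and extended by the
    identity, as \<open>permutes\<close> demands outside I.\<close>
  define p where "p g i = (if i \<in> I then k (act g (f i)) else i)" for g i
  have pin: "p g i \<in> I" if "g \<in> carrier G" "i \<in> I" for g i
    using that by (simp add: p_def fk(2)[OF closed[OF _ fE]])
  have comp: "p (g \<otimes> h) = p g \<circ> p h" if gh: "g \<in> carrier G" "h \<in> carrier G" for g h
  proof
    fix i show "p (g \<otimes> h) i = (p g \<circ> p h) i"
    proof (cases "i \<in> I")
      case True
      then show ?thesis
        using mult[OF gh fE[OF True]] fk(1)[OF closed[OF gh(2) fE[OF True]]]
          fk(2)[OF closed[OF gh(2) fE[OF True]]] by (simp add: p_def)
    qed (auto simp: p_def)
  qed
  have p1: "p \<one> = id" by (rule ext) (simp add: p_def one fE kf)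
  have perm: "p g permutes I" if g: "g \<in> carrier G" for g
  proof (rule bij_imp_permutes)
    have "p (inv g) (p g i) = i" "p g (p (inv g) i) = i" for i
      using comp[of "inv g" g] comp[of g "inv g"] g p1 by (simp_all add: fun_eq_iff)
    then show "bij_betw (p g) I I"
      using pin[OF g] pin[OF inv_closed[OF g]] by (intro bij_betw_byWitness[of _ "p (inv g)"]) auto
    show "p g i = i" if "i \<notin> I" for i unfolding p_def using that by (rule if_not_P)
  qed
  have hom: "p \<in> hom G (sym_group n)"
    by (rule homI) (use perm comp in \<open>auto simp: sym_group_def I_def\<close>)
  interpret p: group_hom G "sym_group n" p
    by (intro group_hom.intro group_hom_axioms.intro is_group sym_group_is_group hom)
  have inj: "inj_on p (carrier G)"
    unfolding p.inj_on_one_iff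
  proof (intro allI impI)
    fix g assume g: "g \<in> carrier G" and "p g = \<one>\<^bsub>sym_group n\<^esub>"
    then have id: "p g = id" by (simp add: sym_group_one)
    show "g = \<one>"
    proof (rule faithful[OF g])
      fix e assume e: "e \<in> E"
      have "k (act g (f (k e))) = k e" using fun_cong[OF id, of "k e"] fk(2)[OF e] by (simp add: p_def)
      then have "f (k (act g e)) = f (k e)" using fk(1)[OF e] by simp
      then show "act g e = e" using fk(1) e closed[OF g e] by simp
    qed
  qed
  have "p ` carrier G = carrier (sym_group n)"
  proof (rule card_subset_eq)
    have "card (carrier (sym_group n)) = fact n" by (rule sym_group_card_carrier)
    then show "card (p ` carrier G) = card (carrier (sym_group n))"
      using order by (simp add: card_image[OF inj] order_def)
    show "finite (carrier (sym_group n))" by (simp add: sym_group_def finite_permutations)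
    show "p ` carrier G \<subseteq> carrier (sym_group n)" using p.hom_closed by blast
  qed
  then have "p \<in> iso G (sym_group n)" using hom inj by (simp add: iso_def bij_betw_def)
  then show ?thesis by (rule is_isoI)
qed

lemma subgroup_nat_pow_closed: "subgroup H G \<Longrightarrow> x \<in> H \<Longrightarrow> x [^] (n::nat) \<in> H"
  by (induction n) (auto simp: subgroup.one_closed subgroup.m_closed)

text \<open>An element x of order 4 spans a subgroup of index two, and some y outside it conjugates
  x to its inverse. The square of y lies in that subgroup and commutes with y, hence is 1 (dihedral)
  or x^2 (quaternion).\<close>

lemma iso_order_8_noncommuting:
  assumes fin: "finite (carrier G)" and o: "order G = 8"
    and ab: "a \<in> carrier G" "b \<in> carrier G" "a \<otimes> b \<noteq> b \<otimes> a"
  shows "G \<cong> dihedral_group 4 \<or> G \<cong> quaternion_group"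
proof -
  have big: "H = carrier G" if "subgroup H G" "W \<subseteq> H" "card W > 4" for H W
    using subgroup_eq_carrier[OF fin that(1)] card_mono[OF _ that(2)] that(3) o
      finite_subset[OF subgroup.subset[OF that(1)] fin] by simp
  \<comment> \<open>If all squares were trivial, every element would be its own inverse and G would
    be commutative.\<close>
  have "\<exists>x\<in>carrier G. x \<otimes> x \<noteq> \<one>"
  proof (rule ccontr)
    assume "\<not> ?thesis"
    then have "inv x = x" if "x \<in> carrier G" for x using that by (auto intro: inv_equality)
    then show False using ab by (metis inv_mult_group m_closed)
  qed
  then obtain x where x: "x \<in> carrier G" "x \<otimes> x \<noteq> \<one>" by blast
  have d: "ord x dvd 8" using ord_dvd_group_order[OF x(1)] o by simp
  have x2: "\<not> ord x dvd 2" using x pow_eq_id[of x 2] by (simp add: numeral_2_eq_2)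
  let ?X = "(\<lambda>i::nat. x [^] i) ` {..<4}"
  have inj: "inj_on (\<lambda>i::nat. x [^] i) {..<ord x}" 
    by (rule inj_on_subset[OF ord_inj[OF x(1)]]) auto
  have "ord x \<le> 8" using d by (auto dest: dvd_imp_le)
  then have "ord x \<in> {0,1,2,3,4,5,6,7,8}" by auto
  then have "ord x = 4 \<or> ord x = 8" using d x2 by auto
  moreover have "ord x \<noteq> 8"
  proof
    assume "ord x = 8"
    then have "card ((\<lambda>i::nat. x [^] i) ` {..<8}) = 8" using card_image[OF inj] by simp
    then have "(\<lambda>i::nat. x [^] i) ` {..<8} = carrier G"
      using fin o x by (intro card_subset_eq) (auto simp: order_def)
    then obtain i j where "a = x [^] (i::nat)" "b = x [^] (j::nat)" using ab by blast
    then show False using ab(3) x(1) by (simp add: nat_pow_mult add.commute)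
  qed
  ultimately have o4: "ord x = 4" by blast
  then have x4: "x [^] (4::nat) = \<one>" using pow_ord_eq_1[OF x(1)] by simp
  have cX: "card ?X = 4" using card_image[OF inj] o4 by simp
  have sX: "x [^] (i::nat) \<in> ?X" for i
    using nat_pow_mod[OF x(1) x4, of i] by (metis image_eqI lessThan_iff mod_less_divisor zero_less_numeral)
  \<comment> \<open>If x were central, an element outside the powers of x would have a centralizer
    with more than four elements, hence be central as well. Then a and b would both be powers of
    x.\<close>
  have "\<exists>y\<in>carrier G. x \<otimes> y \<noteq> y \<otimes> x"
  proof (rule ccontr)
    assume c: "\<not> ?thesis"
    have "centralizer y = carrier G" if y: "y \<in> carrier G" "y \<notin> ?X" for y
    proof (rule big[OF subgroup_centralizer[OF y(1)]])
      show "insert y ?X \<subseteq> centralizer y"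
        using c x(1) y subgroup_nat_pow_closed[OF subgroup_centralizer[OF y(1)], of x]
        by (auto simp: centralizer_def)
      show "card (insert y ?X) > 4" using y cX by simp
    qed
    then have "a \<notin> ?X \<Longrightarrow> b \<in> centralizer a" "b \<notin> ?X \<Longrightarrow> a \<in> centralizer b"
      using ab(1,2) by simp_all
    then have "a \<in> ?X" "b \<in> ?X" using ab(3) by (auto simp: centralizer_def)
    then obtain i j where "a = x [^] (i::nat)" "b = x [^] (j::nat)" by blast
    then show False using ab(3) x(1) by (simp add: nat_pow_mult add.commute)
  qed
  then obtain y where y: "y \<in> carrier G" "x \<otimes> y \<noteq> y \<otimes> x" by blast
  have yX: "y \<notin> ?X" using y x(1) nat_pow_comm[of x 1] by auto
  have cyX: "card ((\<otimes>) y ` ?X) = 4"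
    using x y cX by (subst card_image) (auto intro!: inj_onI)
  have disj: "?X \<inter> (\<otimes>) y ` ?X = {}"
  proof -
    have False if "x [^] (i::nat) = y \<otimes> x [^] (j::nat)" "j < 4" for i j
    proof -
      have "y = x [^] i \<otimes> x [^] (4 - j)"
        using that x(1) y(1) x4 by (simp add: m_assoc nat_pow_mult)
      then show False using yX sX[of "i + (4 - j)"] x(1) by (simp add: nat_pow_mult)
    qed
    then show ?thesis by auto
  qed
  have un: "?X \<union> (\<otimes>) y ` ?X = carrier G"
    using fin o x(1) y(1) cX cyX disj
    by (intro card_subset_eq) (auto simp: order_def card_Un_disjoint)
  have cov: "(\<exists>i<4. g = x [^] (i::nat)) \<or> (\<exists>i<4. g = y \<otimes> x [^] (i::nat))" if "g \<in> carrier G" for g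
    using that unfolding un[symmetric] by (elim UnE imageE) auto
  \<comment> \<open>x^3 is the inverse of x, so commuting with it amounts to commuting with
    x.\<close>
  have comm: False if "y \<otimes> x [^] (i::nat) = x [^] i \<otimes> y" "i = 1 \<or> i = 3" for i
  proof -
    have "x \<otimes> y = y \<otimes> x" if "y \<otimes> inv x = inv x \<otimes> y"
    proof -
      have "x \<otimes> y \<otimes> inv x = y" using that x(1) y(1) by (simp add: m_assoc)
      then show ?thesis using x(1) y(1) by (metis inv_solve_right m_closed)
    qed
    then show False using that y x inv_eq_nat_pow[of x 3] x4 by (auto simp: numeral_eq_Suc)
  qed
  have conj: "x \<otimes> y = y \<otimes> inv x"
  proof -
    have g: "y \<otimes> x \<otimes> inv y \<in> carrier G" using x(1) y(1) by simp
    have "y \<otimes> x \<otimes> inv y \<noteq> y \<otimes> x [^] (i::nat)" for i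
    proof
      assume "y \<otimes> x \<otimes> inv y = y \<otimes> x [^] i"
      then have "x \<otimes> inv y = x [^] i" using x(1) y(1) by (simp add: m_assoc)
      then have "y = inv (x [^] i) \<otimes> x" using x(1) y(1)
        by (metis inv_closed inv_inv inv_mult_group inv_solve_left m_closed nat_pow_closed)
      also have "inv (x [^] i) = x [^] (3 * i)"
        using x(1) x4 by (intro inv_equality) (simp_all add: nat_pow_mult pow_eq_id o4)
      also have "x [^] (3 * i) \<otimes> x = x [^] Suc (3 * i)" by simp
      finally show False using yX sX[of "Suc (3 * i)"] by simp
    qed
    then obtain i :: nat where i: "i < 4" "y \<otimes> x \<otimes> inv y = x [^] i" using cov[OF g] by blast
    then have yx: "y \<otimes> x = x [^] i \<otimes> y" using x(1) y(1) by (metis inv_solve_right m_closed nat_pow_closed)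
    have "x \<noteq> \<one>" using x by auto
    then have "y \<otimes> x \<noteq> y" using x(1) y(1) by (metis inv_mult_cancel_left l_inv)
    then have "i \<noteq> 0" using yx y(1) by (cases "i = 0") simp_all
    moreover have "i \<noteq> 1" using yx x(1) y by (cases "i = 1") simp_all
    \<comment> \<open>y x = x^2 y would give y x^2 = x^4 y = y.\<close>
    moreover have "i \<noteq> 2"
    proof
      assume "i = 2"
      then have yx2: "y \<otimes> x = x \<otimes> (x \<otimes> y)" using yx x(1) y(1) by (simp add: numeral_2_eq_2 m_assoc)
      have "y \<otimes> (x \<otimes> x) = (y \<otimes> x) \<otimes> x" using x(1) y(1) by (simp add: m_assoc)
      also have "\<dots> = x \<otimes> (x \<otimes> (y \<otimes> x))" unfolding yx2 using x(1) y(1) by (simp add: m_assoc yx2)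
      also have "\<dots> = x [^] (4::nat) \<otimes> y" unfolding yx2 using x(1) y(1) by (simp add: m_assoc numeral_eq_Suc)
      finally have "y \<otimes> (x \<otimes> x) = y" using x4 y(1) by simp
      then show False using x y(1) by simp
    qed
    ultimately have "i = 3" using i(1) by linarith
    then have "y \<otimes> x = inv x \<otimes> y" using yx inv_eq_nat_pow[of x 3] x4 x(1) by (simp add: numeral_eq_Suc)
    then have "x \<otimes> (y \<otimes> x) = y" using x(1) y(1) by simp
    then show ?thesis using x(1) y(1) by (metis inv_solve_right m_assoc m_closed)
  qed
  have gen: "H = carrier G" if "subgroup H G" "x \<in> H" "y \<in> H" for H
  proof (rule big[OF that(1)])
    show "insert y ?X \<subseteq> H" using that subgroup_nat_pow_closed by auto
    show "card (insert y ?X) > 4" using yX cX by simp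
  qed
  have "y \<otimes> y = \<one> \<or> y \<otimes> y = x \<otimes> x"
  proof -
    have "y \<otimes> y \<noteq> y \<otimes> x [^] (i::nat)" for i using yX sX[of i] x(1) y(1) by auto
    then obtain i :: nat where i: "i < 4" "y \<otimes> y = x [^] i" using cov[of "y \<otimes> y"] y(1) by blast
    then have "y \<otimes> x [^] i = x [^] i \<otimes> y" using y(1) by (metis m_assoc)
    then have "i \<noteq> 1 \<and> i \<noteq> 3" using comm by blast
    then have "i = 0 \<or> i = 2" using i(1) by linarith
    then show ?thesis using i(2) x(1) by (auto simp: numeral_2_eq_2)
  qed
  then show ?thesis
    using iso_dihedral_group_4[OF fin o x(1) y(1) x4 _ conj gen]
      iso_quaternion_group[OF fin o x(1) y(1) x4 _ conj gen] by auto
qed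

text \<open>All nontrivial elements of A are conjugate, so some element of G conjugates y to y^2.
  That A is its own centralizer pins down the order of this element.\<close>

lemma iso_SmallGroup_20_3_of_frobenius:
  assumes fin: "finite (carrier G)" and o: "order G = 20" and A: "subgroup A G" "card A = 5"
    and cent: "\<And>u. u \<in> A - {\<one>} \<Longrightarrow> centralizer u = A"
    and cls: "\<And>u. u \<in> A - {\<one>} \<Longrightarrow> conj_class u = A - {\<one>}"
  shows "G \<cong> SmallGroup_20_3"
proof -
  have Ac: "a \<in> carrier G" if "a \<in> A" for a using that subgroup.mem_carrier[OF A(1)] by blast
  have "card (A - {\<one>}) > 0"
    using A finite_subset[OF subgroup.subset[OF A(1)] fin] subgroup.one_closed[OF A(1)] by simp
  then obtain y where y: "y \<in> A" "y \<noteq> \<one>" by (metis Diff_iff card_gt_0_iff ex_in_conv insertCI)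
  have yc: "y \<in> carrier G" using y Ac by blast
  have oy: "ord y = 5"
    using ord_dvd_card_subgroup[OF A(1) y(1)] A(2) y ord_eq_1[OF yc] prime_nat_iff[of 5] by auto
  have y5: "y [^] (5::nat) = \<one>" using pow_eq_id[OF yc, of 5] oy by simp
  have y2: "y \<otimes> y \<noteq> \<one>" 
  proof -
    have "y [^] (2::nat) \<noteq> \<one>" using pow_eq_id[OF yc, of 2] oy by simp
    then show ?thesis using yc by (simp add: numeral_2_eq_2)
  qed
  then have "y \<otimes> y \<in> conj_class y"
    using cls[of y] y subgroup.m_closed[OF A(1) y(1) y(1)] by simp
  then obtain g where g: "g \<in> carrier G" "y \<otimes> y = g \<otimes> y \<otimes> inv g" by (auto simp: conj_class_def)
  \<comment> \<open>g y g^-1 = y^2, whereas the presentation has x^-1 y x = y^2.\<close>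
  define x where "x = inv g"
  have xc: "x \<in> carrier G" using g by (simp add: x_def)
  have yx: "y \<otimes> x = x \<otimes> (y \<otimes> y)" unfolding g(2) using g(1) yc by (simp add: x_def m_assoc)
  have pow: "y [^] j \<otimes> x = x \<otimes> y [^] (2 * j)" for j :: nat
  proof -
    have "y [^] j \<otimes> x = x \<otimes> (y \<otimes> y) [^] j" by (rule pow_conj_commute[OF xc yc _ yx]) (use yc in simp)
    also have "(y \<otimes> y) [^] j = y [^] (2 * j)"
      unfolding nat_pow_pow[OF yc, of 2 j, symmetric] using yc by (simp add: numeral_2_eq_2)
    finally show ?thesis .
  qed
  have powx: "y \<otimes> x [^] j = x [^] j \<otimes> y [^] ((2::nat) ^ j)" for j :: nat
  proof (induction j)
    case (Suc j)
    have "y \<otimes> x [^] Suc j = x [^] j \<otimes> (y [^] ((2::nat) ^ j) \<otimes> x)"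
      using Suc xc yc by (simp add: m_assoc[symmetric])
    then show ?case unfolding pow using xc yc by (simp add: m_assoc)
  qed (use yc in simp)
  \<comment> \<open>x^4 raises y to the power 2^4 = 16, which is 1 modulo 5; so x^4 centralises
    y.\<close>
  have "y [^] (16::nat) = y" using nat_pow_mod[OF yc y5, of 16] yc by simp
  then have "y \<otimes> x [^] (4::nat) = x [^] (4::nat) \<otimes> y" using powx[of 4] by simp
  then have x4A: "x [^] (4::nat) \<in> A" using cent[of y] y xc by (auto intro!: centralizerI)
  have x4: "x [^] (4::nat) = \<one>"
  proof (rule ccontr)
    \<comment> \<open>x centralises its own power x^4. If that is a nontrivial element of A, then x
      lies in A and commutes with y, against y x = x y^2.\<close>
    assume ne: "x [^] (4::nat) \<noteq> \<one>"
    have "x \<in> centralizer (x [^] (4::nat))" using xc nat_pow_comm[of x 1 4] by (auto intro!: centralizerI)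
    then have "x \<in> centralizer y" using cent[of y] cent[of "x [^] (4::nat)"] ne x4A y by simp
    then have "x \<otimes> y = x \<otimes> (y \<otimes> y)" using yx by (simp add: centralizer_def)
    then show False using xc yc y by simp
  qed
  have "x [^] (2::nat) \<noteq> \<one>"
  proof
    assume "x [^] (2::nat) = \<one>"
    then have "y [^] (4::nat) = y [^] (1::nat)" using powx[of 2] yc by simp
    then have "y [^] (3::nat) = \<one>" using yc by (simp add: numeral_eq_Suc)
    then show False using pow_eq_id[OF yc, of 3] oy by simp
  qed
  then have "\<not> ord x dvd 2" "ord x dvd 4" using pow_eq_id[OF xc] x4 by auto
  moreover from this have "ord x \<le> 4" by (auto dest: dvd_imp_le)
  then have "ord x \<in> {0,1,2,3,4}" by auto
  ultimately have ox: "ord x = 4" by auto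
  show ?thesis
  proof (rule iso_SmallGroup_20_3[OF fin o xc yc x4 y5 yx])
    fix H assume H: "subgroup H G" "x \<in> H" "y \<in> H"
    have "4 dvd card H" "5 dvd card H"
      using ord_dvd_card_subgroup[OF H(1,2)] ord_dvd_card_subgroup[OF H(1,3)] ox oy by auto
    then have "4 * 5 dvd card H" by presburger
    moreover have "card H > 0" using H subgroup.one_closed[OF H(1)]
      finite_subset[OF subgroup.subset[OF H(1)] fin] card_gt_0_iff by blast
    ultimately show "H = carrier G" using o by (intro subgroup_eq_carrier[OF fin H(1)]) (auto dest: dvd_imp_le)
  qed
qed

text \<open>The hypotheses make M a quaternion group with centre {1, c}. An element x of order 3
  permutes its three cyclic subgroups of order 4 cyclically, which determines the action up to
  orientation.\<close>

lemma iso_SmallGroup_24_3_of_quaternion_normal: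
  assumes fin: "finite (carrier G)" and o: "order G = 24" and M: "M \<lhd> G" "card M = 8"
    and c: "c \<in> M" "c \<noteq> \<one>" "c \<otimes> c = \<one>" "\<And>g. g \<in> carrier G \<Longrightarrow> c \<otimes> g = g \<otimes> c"
    and sq: "\<And>g. g \<in> M - {\<one>, c} \<Longrightarrow> g \<otimes> g = c"
    and cent: "\<And>g. g \<in> M - {\<one>, c} \<Longrightarrow> card (centralizer g) = 4"
  shows "G \<cong> SmallGroup_24_3"
proof -
  interpret M: normal M G by fact
  have cc: "c \<in> carrier G" using c M.subset by blast
  have finM: "finite M" using fin M.subset finite_subset by blast
  have Mc: "g \<in> carrier G" if "g \<in> M - {\<one>, c}" for g using that M.subset by blast
  have comm: "c \<otimes> (g \<otimes> h) = g \<otimes> (c \<otimes> h)" if "g \<in> carrier G" "h \<in> carrier G" for g h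
    using that cc c(4)[OF that(1)] by (simp flip: m_assoc)
  have invc: "inv c = c" by (rule inv_equality) (simp_all add: cc c(3))
  have inv: "inv g = g \<otimes> c" if g: "g \<in> M - {\<one>, c}" for g
  proof (rule inv_equality)
    have "g \<otimes> c \<otimes> g = g \<otimes> g \<otimes> c" using Mc[OF g] cc c(4)[of g] by (simp add: m_assoc)
    then show "g \<otimes> c \<otimes> g = \<one>" using sq[OF g] c(3) by simp
  qed (use Mc[OF g] cc in auto)
  have mulc: "g \<otimes> c \<in> M - {\<one>, c}" if g: "g \<in> M - {\<one>, c}" for g
  proof -
    have "g = c" if "g \<otimes> c = \<one>" using inv_equality[OF that cc Mc[OF g]] invc by simp
    moreover have "g = \<one>" if "g \<otimes> c = c" using that Mc[OF g] cc by simp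
    ultimately show ?thesis using g c(1) by auto
  qed
  have invM: "inv g \<in> M - {\<one>, c}" if "g \<in> M - {\<one>, c}" for g
    using mulc[OF that] inv[OF that] by simp
  \<comment> \<open>The centralizer of y is {1, c, y, y c}, so any z outside it supplies the other
    coset in M. The relation y z = z y c holds because y z is again noncentral in M, with inverse y
    z c.\<close>
  have list: "M = {\<one>, c, y, y \<otimes> c} \<union> (\<otimes>) z ` {\<one>, c, y, y \<otimes> c}"
    and anti: "y \<otimes> z = z \<otimes> (y \<otimes> c)"
    if y: "y \<in> M - {\<one>, c}" and z: "z \<in> M - {\<one>, c}" and ne: "z \<noteq> y" "z \<noteq> y \<otimes> c" for y z
  proof -
    have yc: "y \<in> carrier G" and zc: "z \<in> carrier G" using Mc y z by blast+
    have "y \<otimes> z \<noteq> \<one>"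
    proof
      assume "y \<otimes> z = \<one>"
      then have "z = inv y" using yc zc by (metis inv_equality inv_inv)
      then show False using ne(2) inv[OF y] by simp
    qed
    moreover have "y \<otimes> z \<noteq> c"
    proof
      assume "y \<otimes> z = c"
      then have "z = inv y \<otimes> c" using yc zc by (metis inv_mult_cancel_left)
      then show False using ne(1) inv[OF y] yc cc c(3) by (simp add: m_assoc)
    qed
    ultimately have yzM: "y \<otimes> z \<in> M - {\<one>, c}" using y z by simp
    have "y \<otimes> z \<otimes> c = inv (y \<otimes> z)" by (rule inv[OF yzM, symmetric])
    also have "\<dots> = z \<otimes> c \<otimes> (y \<otimes> c)" using yc zc inv[OF y] inv[OF z] by (simp add: inv_mult_group)
    also have "\<dots> = z \<otimes> y" using yc zc cc c(3) comm[of y c] by (simp add: m_assoc)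
    finally have "y \<otimes> z \<otimes> c \<otimes> c = z \<otimes> y \<otimes> c" by simp
    then show "y \<otimes> z = z \<otimes> (y \<otimes> c)" using yc zc cc c(3) by (simp add: m_assoc)
    let ?C = "{\<one>, c, y, y \<otimes> c}"
    have sub: "?C \<subseteq> centralizer y"
      using yc cc c(4)[OF yc] by (auto simp: centralizer_def m_assoc)
    have "y \<otimes> c \<noteq> y" "y \<otimes> c \<noteq> \<one>" "y \<otimes> c \<noteq> c" using mulc[OF y] yc cc c(2) by auto
    then have cardC: "card ?C = 4" using y c(2) by auto
    then have C: "?C = centralizer y"
      using cent[OF y] sub finite_subset[OF subgroup.subset[OF subgroup_centralizer[OF yc]] fin]
      by (intro card_subset_eq) auto
    have zC: "z \<notin> ?C" using z ne by auto
    have sg: "subgroup ?C G" unfolding C by (rule subgroup_centralizer[OF yc])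
    have Cc: "g \<in> carrier G" if "g \<in> ?C" for g using subgroup.mem_carrier[OF sg that] .
    have cardzC: "card ((\<otimes>) z ` ?C) = 4"
      unfolding cardC[symmetric] by (rule card_image) (rule inj_onI, use zc Cc l_cancel in blast)
    have "z \<in> ?C" if gh: "g \<in> ?C" "h \<in> ?C" "g = z \<otimes> h" for g h
    proof -
      have "g \<otimes> inv h \<in> ?C" by (rule subgroup.m_closed[OF sg gh(1) subgroup.m_inv_closed[OF sg gh(2)]])
      moreover have "g \<otimes> inv h = z" using gh(3) Cc[OF gh(2)] zc by (simp add: m_assoc)
      ultimately show ?thesis by simp
    qed
    then have disj: "?C \<inter> (\<otimes>) z ` ?C = {}" using zC by blast
    have CM: "?C \<subseteq> M" using y mulc[OF y] c(1) by auto
    have "?C \<union> (\<otimes>) z ` ?C = M"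
    proof (rule card_subset_eq[OF finM])
      have "z \<otimes> h \<in> M" if "h \<in> ?C" for h using that CM z by (intro M.m_closed) auto
      then show "?C \<union> (\<otimes>) z ` ?C \<subseteq> M" using CM by blast
      show "card (?C \<union> (\<otimes>) z ` ?C) = card M"
        using cardC cardzC disj M(2) by (subst card_Un_disjoint) auto
    qed
    then show "M = ?C \<union> (\<otimes>) z ` ?C" by simp
  qed
  obtain x where x: "x \<in> carrier G" "x \<noteq> \<one>" "x [^] (3::nat) = \<one>"
    using cauchy[OF fin, of 3] o by auto
  have ox: "ord x = 3" using x pow_eq_id[of x 3] ord_eq_1[of x] prime_nat_iff[of 3] by auto
  define \<phi> where "\<phi> g = inv x \<otimes> g \<otimes> x" for g
  have \<phi>c: "\<phi> g \<in> carrier G" if "g \<in> carrier G" for g using that x by (simp add: \<phi>_def)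
  have \<phi>mult: "\<phi> (g \<otimes> h) = \<phi> g \<otimes> \<phi> h" if "g \<in> carrier G" "h \<in> carrier G" for g h
    using that x by (simp add: \<phi>_def m_assoc)
  have \<phi>inv: "\<phi> (inv g) = inv (\<phi> g)" if "g \<in> carrier G" for g
    using that x by (simp add: \<phi>_def m_assoc inv_mult_group)
  have \<phi>z: "\<phi> c = c" using c(4)[OF x(1)] x cc by (simp add: \<phi>_def m_assoc)
  have x\<phi>: "x \<otimes> \<phi> g = g \<otimes> x" if "g \<in> carrier G" for g
    using that x by (simp add: \<phi>_def m_assoc)
  have \<phi>M: "\<phi> g \<in> M - {\<one>, c}" if g: "g \<in> M - {\<one>, c}" for g
  proof -
    have "g = \<one>" if "\<phi> g = \<one>" using x\<phi>[OF Mc[OF g]] Mc[OF g] x that by simp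
    moreover have "g = c" if "\<phi> g = c"
      using x\<phi>[OF Mc[OF g]] c(4)[OF x(1)] Mc[OF g] x(1) cc that by (metis r_cancel)
    ultimately show ?thesis
      using M.inv_op_closed1[OF x(1), of g] g by (auto simp: \<phi>_def)
  qed
  have \<phi>3: "\<phi> (\<phi> (\<phi> g)) = g" if g: "g \<in> carrier G" for g
  proof -
    have x3: "x \<otimes> (x \<otimes> x) = \<one>" using x by (simp add: numeral_eq_Suc m_assoc)
    have "\<phi> (\<phi> (\<phi> g)) = inv (x \<otimes> (x \<otimes> x)) \<otimes> g \<otimes> (x \<otimes> (x \<otimes> x))"
      using g x(1) by (simp add: \<phi>_def m_assoc inv_mult_group)
    then show ?thesis using g x3 by simp
  qed
  \<comment> \<open>A centralizer of order 4 contains no element of order 3, so g is not fixed. If g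
    went to g c, then \<open>\<phi>\<close> applied twice would fix g, and as \<open>\<phi>\<close>
    has trivial third power it would fix g itself.\<close>
  have nofix: "\<phi> g \<noteq> g" "\<phi> g \<noteq> g \<otimes> c" if g: "g \<in> M - {\<one>, c}" for g
  proof -
    show 1: "\<phi> g \<noteq> g"
    proof
      assume "\<phi> g = g"
      then have "x \<in> centralizer g" using x\<phi>[OF Mc[OF g]] x(1) by (simp add: centralizer_def)
      from ord_dvd_card_subgroup[OF subgroup_centralizer[OF Mc[OF g]] this]
      show False using cent[OF g] ox by simp
    qed
    show "\<phi> g \<noteq> g \<otimes> c"
    proof
      assume e: "\<phi> g = g \<otimes> c"
      then have "\<phi> (\<phi> g) = g"
        using \<phi>mult[OF Mc[OF g] cc] \<phi>z Mc[OF g] cc c(3) by (simp add: m_assoc)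
      then have "\<phi> g = g" using \<phi>3[OF Mc[OF g]] by simp
      then show False using 1 by simp
    qed
  qed
  \<comment> \<open>y^-1 z^-1 = (y c) (z c) = y z, so the two conditions on \<open>\<phi>\<close>
    are the two relations of the presentation that describe conjugation by x.\<close>
  have fin': "G \<cong> SmallGroup_24_3"
    if y: "y \<in> M - {\<one>, c}" and z: "z \<in> M - {\<one>, c}" and ne: "z \<noteq> y" "z \<noteq> y \<otimes> c"
      and \<phi>: "\<phi> z = inv y" "\<phi> y = y \<otimes> z" for y z
  proof (rule iso_SmallGroup_24_3[OF fin o x(1) Mc[OF y] Mc[OF z] x(3)])
    have yc: "y \<in> carrier G" and zc: "z \<in> carrier G" using Mc y z by blast+
    have "y [^] (4::nat) = y \<otimes> y \<otimes> (y \<otimes> y)" using yc by (simp add: numeral_eq_Suc m_assoc)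
    then show "y [^] (4::nat) = \<one>" using sq[OF y] c(3) by simp
    show "y \<otimes> y = z \<otimes> z" using sq y z by simp
    show "y \<otimes> z = z \<otimes> inv y" using anti[OF y z ne] inv[OF y] by simp
    have "inv y \<otimes> inv z = y \<otimes> z"
      using inv[OF y] inv[OF z] yc zc cc c(3) comm[OF zc cc] by (simp add: m_assoc)
    then show "y \<otimes> x = x \<otimes> (inv y \<otimes> inv z)" using x\<phi>[OF yc] \<phi> by simp
    show "z \<otimes> x = x \<otimes> inv y" using x\<phi>[OF zc] \<phi> by simp
    fix H assume H: "subgroup H G" "x \<in> H" "y \<in> H" "z \<in> H"
    have cH: "c \<in> H" using subgroup.m_closed[OF H(1,3,3)] sq[OF y] by simp
    have "{\<one>, c, y, y \<otimes> c} \<subseteq> H"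
      using H cH subgroup.m_closed[OF H(1,3) cH] subgroup.one_closed[OF H(1)] by simp
    then have "M \<subseteq> H" unfolding list[OF y z ne]
      by (intro Un_least image_subsetI subgroup.m_closed[OF H(1,4)]) auto
    then have "8 dvd card H" using card_subgroup_dvd[OF M.subgroup_axioms H(1)] M(2) by simp
    moreover have "3 dvd card H" using ord_dvd_card_subgroup[OF H(1,2)] ox by simp
    ultimately have "24 dvd card H" by presburger
    moreover have "card H > 0" using subgroup.one_closed[OF H(1)]
      finite_subset[OF subgroup.subset[OF H(1)] fin] card_gt_0_iff by blast
    ultimately show "H = carrier G" using o by (intro subgroup_eq_carrier[OF fin H(1)]) (auto dest: dvd_imp_le)
  qed
  have "M \<noteq> {\<one>, c}" using M(2) card_insert_le_m1[of 2 "{c}" \<one>] by auto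
  then obtain z where z: "z \<in> M - {\<one>, c}" using c(1) M.one_closed by blast
  \<comment> \<open>One of the two conditions then holds by construction, and only the position of
    \<open>\<phi> y\<close> in M remains open.\<close>
  define y where "y = inv (\<phi> z)"
  have y: "y \<in> M - {\<one>, c}" unfolding y_def by (intro invM \<phi>M z)
  have yc: "y \<in> carrier G" and zc: "z \<in> carrier G" using Mc y z by blast+
  have \<phi>y: "\<phi> z = inv y" using \<phi>c[OF zc] by (simp add: y_def)
  have ne: "z \<noteq> y" "z \<noteq> y \<otimes> c"
    using nofix[OF z] \<phi>y inv[OF y] by auto
  have \<phi>\<phi>: "\<phi> (\<phi> z) = inv (\<phi> y)" using \<phi>y \<phi>inv[OF yc] by simp
  have wz: "\<phi> y \<noteq> z \<otimes> c"
  proof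
    assume "\<phi> y = z \<otimes> c"
    then have "\<phi> (\<phi> z) = z" using \<phi>\<phi> inv[OF z] zc by (metis inv_inv)
    then show False using \<phi>3[OF zc] nofix(1)[OF z] by simp
  qed
  have wz': "\<phi> y \<noteq> z"
  proof
    assume "\<phi> y = z"
    then have "\<phi> (\<phi> z) = z \<otimes> c" using \<phi>\<phi> inv[OF z] by simp
    then have "\<phi> z \<otimes> c = z" using \<phi>3[OF zc] \<phi>mult[OF zc cc] \<phi>z by simp
    then have "\<phi> z = z \<otimes> c" using \<phi>c[OF zc] cc c(3) by (metis m_assoc r_one)
    then show False using nofix(2)[OF z] by simp
  qed
  have "\<phi> y \<in> M - {\<one>, c}" by (rule \<phi>M[OF y])
  then have "\<phi> y \<in> {\<one>, c, y, y \<otimes> c} \<union> (\<otimes>) z ` {\<one>, c, y, y \<otimes> c}" "\<phi> y \<notin> {\<one>, c}"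
    using list[OF y z ne] by blast+
  then have "\<phi> y = z \<otimes> y \<or> \<phi> y = z \<otimes> (y \<otimes> c)"
    using nofix[OF y] wz wz' zc by auto
  then show ?thesis
  proof
    assume "\<phi> y = z \<otimes> (y \<otimes> c)"
    then show ?thesis using fin'[OF y z ne \<phi>y] anti[OF y z ne] by simp
  next
    (* Conjugation by x permutes the three cosets of {1, c} in M - {1, c} cyclically; multiplying
       both generators by c turns this orientation into the one of the presentation. *)
    assume w: "\<phi> y = z \<otimes> y"
    have "G \<cong> SmallGroup_24_3"
    proof (rule fin'[OF mulc[OF y] mulc[OF z]])
      show "z \<otimes> c \<noteq> y \<otimes> c" using ne zc yc cc by simp
      show "z \<otimes> c \<noteq> y \<otimes> c \<otimes> c" using ne zc yc cc c(3) by (metis m_assoc r_one)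
      have "\<phi> (z \<otimes> c) = inv y \<otimes> c" using \<phi>mult[OF zc cc] \<phi>z \<phi>y by simp
      also have "\<dots> = inv (y \<otimes> c)" using yc cc invc c(4)[of "inv y"] by (simp add: inv_mult_group)
      finally show "\<phi> (z \<otimes> c) = inv (y \<otimes> c)" .
      have "\<phi> (y \<otimes> c) = z \<otimes> (y \<otimes> c)" using \<phi>mult[OF yc cc] \<phi>z w yc zc cc by (simp add: m_assoc)
      also have "\<dots> = y \<otimes> z" using anti[OF y z ne] by simp
      also have "\<dots> = y \<otimes> c \<otimes> (z \<otimes> c)" using yc zc cc c(3) comm[OF zc cc] by (simp add: m_assoc)
      finally show "\<phi> (y \<otimes> c) = y \<otimes> c \<otimes> (z \<otimes> c)" .
    qed
    then show ?thesis .
  qed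
qed

text \<open>The eight elements of M - A have order 3 and form four pairs {x, x^-1}, the traces of
  the four subgroups of order 3. G acts on these pairs by conjugation, and faithfulness follows from
  C(x) = {1, x, x^-1}.\<close>

lemma iso_sym_group_4_of_chain:
  assumes fin: "finite (carrier G)" and o: "order G = 24" and A: "A \<lhd> G" and M: "M \<lhd> G"
    and "A \<subset> M" and card: "card A = 4" "card M = 12"
    and cent: "\<And>x. x \<in> M - A \<Longrightarrow> card (centralizer x) = 3"
  shows "G \<cong> sym_group 4"
proof -
  interpret A: normal A G by fact
  interpret M: normal M G by fact
  have xc: "x \<in> carrier G" if "x \<in> M - A" for x using that M.subset by blast
  have x1: "x \<noteq> \<one>" if "x \<in> M - A" for x using that by auto
  have inv: "inv x \<in> M - A" if x: "x \<in> M - A" for x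
    using x M.m_inv_closed[of x] A.m_inv_closed[of "inv x"] xc[OF x] by auto
  have ox: "ord x = 3" if x: "x \<in> M - A" for x
  proof -
    have "x \<in> centralizer x" using xc[OF x] by (simp add: centralizer_def)
    from ord_dvd_card_subgroup[OF subgroup_centralizer[OF xc[OF x]] this]
    show ?thesis using cent[OF x] ord_eq_1[OF xc[OF x]] x1[OF x] prime_nat_iff[of 3] by auto
  qed
  have xx: "x \<otimes> x = inv x" if x: "x \<in> M - A" for x
  proof (rule inv_equality[symmetric])
    have "x [^] (3::nat) = \<one>" using pow_eq_id[OF xc[OF x], of 3] ox[OF x] by simp
    then show "x \<otimes> x \<otimes> x = \<one>" using xc[OF x] by (simp add: numeral_eq_Suc)
  qed (use xc[OF x] in auto)
  have inv_ne: "inv x \<noteq> x" if x: "x \<in> M - A" for x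
    using xx[OF x] xc[OF x] x1[OF x] by auto
  have C: "centralizer x = {\<one>, x, inv x}" if x: "x \<in> M - A" for x
  proof (rule card_subset_eq[symmetric])
    show "{\<one>, x, inv x} \<subseteq> centralizer x" using xc[OF x] by (simp add: centralizer_def)
    have "card {\<one>, x, inv x} = 3"
      using inv_ne[OF x] x1[OF x] x1[OF inv[OF x]] by auto
    then show "card {\<one>, x, inv x} = card (centralizer x)" using cent[OF x] by simp
    show "finite (centralizer x)"
      using finite_subset[OF subgroup.subset[OF subgroup_centralizer[OF xc[OF x]]] fin] .
  qed
  define E where "E = (\<lambda>x. {x, inv x}) ` (M - A)"
  have finM: "finite M" using fin M.subset finite_subset by blast
  have "card (M - A) = 8"
    using card \<open>A \<subset> M\<close> finM finite_subset[of A M] by (subst card_Diff_subset) auto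
  moreover have "\<Union>E = M - A" using inv by (auto simp: E_def)
  moreover have "2 * card E = card (\<Union>E)"
  proof (rule card_partition)
    show "finite E" "finite (\<Union>E)" using finM \<open>\<Union>E = M - A\<close> by (auto simp: E_def)
    show "card e = 2" if e: "e \<in> E" for e
    proof -
      obtain x where x: "x \<in> M - A" "e = {x, inv x}" using e by (auto simp: E_def)
      then show ?thesis using inv_ne[OF x(1), symmetric] by simp
    qed
    show "c1 \<inter> c2 = {}" if c12: "c1 \<in> E" "c2 \<in> E" "c1 \<noteq> c2" for c1 c2
    proof -
      obtain x y where xy: "x \<in> M - A" "y \<in> M - A" and c: "c1 = {x, inv x}" "c2 = {y, inv y}"
        using c12(1,2) unfolding E_def by blast
      have "{x, inv x} = {y, inv y}" if h: "x = y \<or> x = inv y \<or> inv x = y \<or> inv x = inv y"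
      proof -
        have "x = y \<or> x = inv y" using h xc[OF xy(1)] xc[OF xy(2)] by (metis inv_inv)
        then show ?thesis using xc[OF xy(2)] by auto
      qed
      then have "x \<noteq> y" "x \<noteq> inv y" "inv x \<noteq> y" "inv x \<noteq> inv y" using c12(3) c by metis+
      then show ?thesis unfolding c by simp
    qed
  qed
  ultimately have cE: "card E = 4" by simp
  have finE: "finite E" using finM by (simp add: E_def)
  let ?act = "\<lambda>g. (`) (\<lambda>x. g \<otimes> x \<otimes> inv g)"
  have act: "?act g {x, inv x} = {g \<otimes> x \<otimes> inv g, inv (g \<otimes> x \<otimes> inv g)}"
    if "g \<in> carrier G" "x \<in> carrier G" for g x
    using that by (simp add: inv_mult_group m_assoc)
  have conj: "g \<otimes> x \<otimes> inv g \<in> M - A" if g: "g \<in> carrier G" and x: "x \<in> M - A" for g x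
  proof -
    have "inv g \<otimes> (g \<otimes> x \<otimes> inv g) \<otimes> g = x" using g xc[OF x] by (simp add: m_assoc)
    then show ?thesis
      using A.inv_op_closed1[OF g, of "g \<otimes> x \<otimes> inv g"] M.inv_op_closed2[OF g, of x] x by auto
  qed
  show ?thesis
  proof (rule iso_sym_group_of_faithful_action[of E 4 ?act, OF finE cE])
    show "order G = fact 4" using o by (simp add: fact_numeral)
    show "?act g e \<in> E" if g: "g \<in> carrier G" and e: "e \<in> E" for g e
    proof -
      obtain x where x: "x \<in> M - A" "e = {x, inv x}" using e by (auto simp: E_def)
      show ?thesis unfolding x(2) act[OF g xc[OF x(1)]] E_def
        by (rule imageI[OF conj[OF g x(1)]])
    qed
    show "?act \<one> e = e" if e: "e \<in> E" for e
    proof -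
      obtain x where x: "x \<in> M - A" "e = {x, inv x}" using e by (auto simp: E_def)
      show ?thesis using act[OF one_closed xc[OF x(1)]] x xc[OF x(1)] by simp
    qed
    show "?act (g \<otimes> h) e = ?act g (?act h e)" if gh: "g \<in> carrier G" "h \<in> carrier G" and e: "e \<in> E" for g h e
    proof -
      obtain x where x: "x \<in> M - A" "e = {x, inv x}" using e by (auto simp: E_def)
      show ?thesis using xc[OF x(1)] gh unfolding x(2) by (simp add: m_assoc inv_mult_group)
    qed
    fix g assume g: "g \<in> carrier G" and fix': "\<And>e. e \<in> E \<Longrightarrow> ?act g e = e"
    show "g = \<one>"
    proof (rule ccontr)
      assume g1: "g \<noteq> \<one>"
      \<comment> \<open>An element preserving the pair of x centralises x or inverts it; the former
        leaves only 1, x and x^-1.\<close>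
      have alt: "g \<otimes> x \<otimes> inv g = inv x" if x: "x \<in> M - A" and ne: "g \<noteq> x" "g \<noteq> inv x" for x
      proof -
        have "?act g {x, inv x} = {x, inv x}" by (rule fix') (use x in \<open>auto simp: E_def\<close>)
        then have "g \<otimes> x \<otimes> inv g \<in> {x, inv x}" using act[OF g xc[OF x]] by simp
        moreover have "g \<otimes> x \<otimes> inv g \<noteq> x"
        proof
          assume "g \<otimes> x \<otimes> inv g = x"
          then have "g \<in> centralizer x" using conj_eq_iff_commute[OF g xc[OF x]] g by (simp add: centralizer_def)
          then show False using C[OF x] g1 ne by simp
        qed
        ultimately show ?thesis by simp
      qed
      show False
      proof (cases "g \<in> M - A")
        case True
        have "card {g, inv g} \<le> 2" by (simp add: card_insert_if)
        then have "M - A \<noteq> {g, inv g}" using \<open>card (M - A) = 8\<close> by auto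
        then obtain x where x: "x \<in> M - A" "x \<notin> {g, inv g}" using True inv[OF True] by blast
        have xG: "x \<in> carrier G" by (rule xc[OF x(1)])
        have ne: "g \<noteq> x" "g \<noteq> inv x" using x(2) xG by auto
        have e: "g \<otimes> x \<otimes> inv g = inv x" by (rule alt[OF x(1) ne])
        \<comment> \<open>g inverts x, so g^2 = g^-1 centralises x, while C(x) contains only 1, x
          and x^-1.\<close>
        have "inv g \<otimes> x \<otimes> inv (inv g) = g \<otimes> g \<otimes> x \<otimes> inv (g \<otimes> g)"
          by (simp only: xx[OF True])
        also have "\<dots> = g \<otimes> (g \<otimes> x \<otimes> inv g) \<otimes> inv g"
          using g xG by (simp add: m_assoc inv_mult_group)
        also have "\<dots> = g \<otimes> inv x \<otimes> inv g" by (simp only: e)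
        also have "\<dots> = inv (g \<otimes> x \<otimes> inv g)" using g xG by (simp add: m_assoc inv_mult_group)
        also have "\<dots> = x" using e xG by simp
        finally have "inv g \<in> centralizer x"
          using conj_eq_iff_commute[OF _ xG, of "inv g"] g by (simp add: centralizer_def)
        then have "inv g \<in> {\<one>, x, inv x}" using C[OF x(1)] by simp
        then show False using x(2) g xG x1[OF inv[OF True]] by auto
      next
        case False
        have all: "g \<otimes> x \<otimes> inv g = inv x" if "x \<in> M - A" for x
          using alt[OF that] False that inv[OF that] by blast
        have "M - A \<noteq> {}" using \<open>A \<subset> M\<close> by blast
        then obtain x where x: "x \<in> M - A" by blast
        have "A \<noteq> {\<one>}" using card by auto
        then obtain a where a: "a \<in> A" "a \<noteq> \<one>" using A.one_closed by blast
        have aG: "a \<in> carrier G" and xG: "x \<in> carrier G" using a(1) xc[OF x] by auto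
        have mul: "y \<otimes> a \<in> M - A" if y: "y \<in> M - A" for y
        proof -
          have "y \<otimes> a \<otimes> inv a = y" using xc[OF y] aG by (simp add: m_assoc)
          then show ?thesis using y a(1) \<open>A \<subset> M\<close> A.m_closed[of "y \<otimes> a" "inv a"] by auto
        qed
        have "inv x \<otimes> a \<in> M - A" by (rule mul[OF inv[OF x]])
        then have "x \<otimes> (x \<otimes> a) \<in> M - A" using xx[OF x, symmetric] xG aG by (simp add: m_assoc)
        \<comment> \<open>x, x a and their product all lie in M - A and are inverted by g. Hence
          inversion preserves the product of x and x a, these two commute, and a would centralise
          x.\<close>
        from all[OF this] have "inv (x \<otimes> (x \<otimes> a)) = (g \<otimes> x \<otimes> inv g) \<otimes> (g \<otimes> (x \<otimes> a) \<otimes> inv g)"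
          using g xG aG by (simp add: m_assoc)
        also have "\<dots> = inv x \<otimes> inv (x \<otimes> a)" using all[OF x] all[OF mul[OF x]] by simp
        also have "\<dots> = inv (x \<otimes> a \<otimes> x)" using xG aG by (simp add: inv_mult_group)
        finally have "x \<otimes> (x \<otimes> a) = x \<otimes> a \<otimes> x" using xG aG by (metis inv_inv m_closed)
        then have "x \<otimes> a = a \<otimes> x" using xG aG by (simp add: m_assoc)
        then have "a \<in> centralizer x" using aG by (simp add: centralizer_def)
        then show False using C[OF x] a x inv[OF x] by auto
      qed
    qed
  qed
qed

end

section \<open>Chains of two normal subgroups\<close>

context group
begin

lemma cauchy_subgroup:
  assumes fin: "finite (carrier G)" and H: "subgroup H G" and p: "prime p" "p dvd card H"
  shows "\<exists>x\<in>H. x \<noteq> \<one> \<and> x [^] p = \<one>"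
proof -
  interpret H: group "G\<lparr>carrier := H\<rparr>" by (rule subgroup_imp_group[OF H])
  have "finite H" using fin subgroup.subset[OF H] finite_subset by blast
  then show ?thesis using H.cauchy[OF _ p(1)] p(2) by (simp add: order_def nat_pow_def)
qed

text \<open>Spreads a condition on powers from one element to its class, which in a chain is all of
  A - 1 or of M - A.\<close>

lemma conj_class_pow_mem:
  assumes "x \<in> carrier G" "y \<in> conj_class x" "x [^] (n::nat) \<in> N" "N \<lhd> G"
  shows "y [^] n \<in> N"
proof -
  obtain g where g: "g \<in> carrier G" "y = g \<otimes> x \<otimes> inv g" using assms(2) by (auto simp: conj_class_def)
  have "y [^] n = g \<otimes> x [^] n \<otimes> inv g"
  proof (induction n)
    case (Suc n)
    then show ?case using g assms(1) by (simp add: m_assoc)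
  qed (use g in simp)
  then show ?thesis using normal.inv_op_closed2[OF assms(4) g(1) assms(3)] by simp
qed

lemma subgroup_prime_index_eq:
  assumes fin: "finite (carrier G)" and r: "prime r"
    and "subgroup H G" "subgroup L G" "subgroup K G" "L \<subset> H" "H \<subseteq> K" "card K = card L * r"
  shows "H = K"
proof -
  have finK: "finite K" using fin subgroup.subset[OF assms(5)] finite_subset by blast
  then have fH: "finite H" using assms(7) finite_subset by blast
  obtain k where k: "card H = card L * k" using card_subgroup_dvd[OF assms(4,3)] assms(6) by blast
  have L0: "card L > 0" using subgroup.one_closed[OF assms(4)] assms(6) fH
    by (metis card_gt_0_iff empty_iff finite_subset psubset_imp_subset)
  have "card L * 1 < card L * k" using psubset_card_mono[OF fH assms(6)] k by simp
  then have "k \<noteq> 1" by simp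
  moreover have "card L * k dvd card L * r" using card_subgroup_dvd[OF assms(3,5,7)] k assms(8) by simp
  then have "k dvd r" using L0 by simp
  ultimately have "k = r" using r prime_nat_iff by blast
  then show ?thesis using finK assms(7,8) k by (intro card_subset_eq) auto
qed

end

text \<open>\<open>be\<close> is the index of A in M. \<open>class_above\<close> covers every proper
  normal subgroup above A because it is applied not only to M but also to the centralizer of an
  element of A and to the set of elements whose r-th power lies in A.\<close>

locale chief_chain = group G for G (structure) +
  fixes A M :: "'a set" and r al be :: nat
  assumes fin: "finite (carrier G)"
    and A: "A \<lhd> G" and M: "M \<lhd> G" and AM: "A \<subset> M" and A1: "A \<noteq> {\<one>}"
    and r: "prime r" and order: "order G = card M * r"
    and al: "card A = al" and be: "card M = al * be"
    and class_A: "\<And>u. u \<in> A - {\<one>} \<Longrightarrow> conj_class u = A - {\<one>}"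
    and class_above: "\<And>N x. N \<lhd> G \<Longrightarrow> A \<subset> N \<Longrightarrow> N \<noteq> carrier G \<Longrightarrow> x \<in> N - A \<Longrightarrow> conj_class x = N - A"
begin

sublocale A: normal A G by (rule A)
sublocale M: normal M G by (rule M)

lemma finM: "finite M" and finA: "finite A"
  using fin M.subset A.subset finite_subset by blast+

lemma r2: "r \<ge> 2" using r by (rule prime_ge_2_nat)

lemma M_proper: "M \<noteq> carrier G"
proof -
  have "card M > 0" using finM M.one_closed card_gt_0_iff by blast
  then show ?thesis using order r2 by (auto simp: order_def)
qed

lemma class_M: "x \<in> M - A \<Longrightarrow> conj_class x = M - A"
  by (rule class_above[OF M AM M_proper])

lemma M_carrier: "x \<in> M - A \<Longrightarrow> x \<in> carrier G"
  using M.subset by blast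

lemma al2: "al \<ge> 2"
proof -
  have "{\<one>} \<subset> A" using A1 A.one_closed by blast
  then have "card {\<one>} < card A" using finA psubset_card_mono by blast
  then show ?thesis using al by simp
qed

lemma be2: "be \<ge> 2"
proof -
  have "al * 1 < al * be" using psubset_card_mono[OF finM AM] al be by simp
  then show ?thesis by simp
qed

lemma order_eq: "order G = al * be * r"
  using order be by simp

lemma obtain_u: obtains u where "u \<in> A" "u \<noteq> \<one>" "u \<in> carrier G"
  using A1 A.one_closed A.subset by blast

lemma obtain_x: obtains x where "x \<in> M - A" "x \<in> carrier G"
  using AM M.subset by blast

lemma finite_centralizer: "x \<in> carrier G \<Longrightarrow> finite (centralizer x)"
  using subgroup.subset[OF subgroup_centralizer] fin finite_subset by blast

section \<open>Centralizer orders and the divisibility conditions they imply\<close>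

lemma card_centralizer_A:
  assumes "u \<in> A" "u \<noteq> \<one>" shows "(al - 1) * card (centralizer u) = al * be * r"
proof -
  have "card (conj_class u) = al - 1"
    using class_A[of u] assms al finA by simp
  then show ?thesis using card_conj_class[of u] assms order_eq by simp
qed

text \<open>The class M - A has al * (be - 1) elements, and the factor al cancels against
  |G|.\<close>

lemma card_centralizer_M:
  assumes "x \<in> M - A" shows "(be - 1) * card (centralizer x) = be * r"
proof -
  have "card (M - A) = al * (be - 1)"
    using AM al be finA by (simp add: card_Diff_subset diff_mult_distrib2 psubset_imp_subset)
  then have "al * ((be - 1) * card (centralizer x)) = al * (be * r)"
    using card_conj_class[OF M_carrier[OF assms]] class_M[OF assms] order_eq by (simp add: mult.assoc)
  then show ?thesis using al2 by simp
qed

lemma al_dvd: "al - 1 dvd be * r"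
proof -
  obtain u where "u \<in> A" "u \<noteq> \<one>" using obtain_u by blast
  from card_centralizer_A[OF this] have "al - 1 dvd al * (be * r)"
    by (metis dvd_triv_left mult.assoc)
  moreover have "coprime (al - 1) al" using coprime_diff_one_left_nat[of al] al2 by simp
  ultimately show ?thesis by (simp add: coprime_dvd_mult_right_iff)
qed

text \<open>be - 1 divides be * r and is coprime to be, so it divides the prime r.\<close>

lemma be_cases: "be = 2 \<or> be = Suc r"
proof -
  obtain x where "x \<in> M - A" using obtain_x by blast
  from card_centralizer_M[OF this] have "be - 1 dvd be * r" by (metis dvd_triv_left)
  moreover have "coprime (be - 1) be" using coprime_diff_one_left_nat[of be] be2 by simp
  ultimately have "be - 1 dvd r" by (simp add: coprime_dvd_mult_right_iff)
  then have "be - 1 = 1 \<or> be - 1 = r" using r prime_nat_iff by blast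
  then show ?thesis using be2 by auto
qed

lemma mult_A: "x \<in> M - A \<Longrightarrow> a \<in> A \<Longrightarrow> x \<otimes> a \<in> M - A"
  and inv_M: "x \<in> M - A \<Longrightarrow> inv x \<in> M - A"
proof -
  assume x: "x \<in> M - A"
  have xc: "x \<in> carrier G" by (rule M_carrier[OF x])
  show "inv x \<in> M - A" using x M.m_inv_closed[of x] A.m_inv_closed[of "inv x"] xc by auto
  assume a: "a \<in> A"
  then have ac: "a \<in> carrier G" by auto
  have "x \<otimes> a \<otimes> inv a = x" using xc ac by (simp add: m_assoc)
  then show "x \<otimes> a \<in> M - A" using x a AM A.m_closed[of "x \<otimes> a" "inv a"] by auto
qed

text \<open>M/A has even order, so some element of M outside A has its square in A, and all of M - A
  is conjugate to it.\<close>

lemma square_A: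
  assumes "even be" "x \<in> M - A" shows "x \<otimes> x \<in> A"
proof -
  interpret H: group "G\<lparr>carrier := M\<rparr>" by (rule subgroup_imp_group[OF M.subgroup_axioms])
  have "A \<lhd> G\<lparr>carrier := M\<rparr>"
    using normal_restrict_supergroup[OF M.subgroup_axioms A] AM by blast
  from H.cauchy_mod[OF _ this, of 2 be] obtain y where y: "y \<in> M - A" "y [^] (2::nat) \<in> A"
    using assms(1) finM al be by (auto simp: order_def nat_pow_def)
  have "x \<in> conj_class y" using class_M[OF y(1)] assms(2) by simp
  from conj_class_pow_mem[OF M_carrier[OF y(1)] this y(2) A]
  show ?thesis using M_carrier[OF assms(2)] by (simp add: numeral_2_eq_2)
qed

text \<open>M contains an involution, which cannot lie in A since al is odd; so its class M - A
  consists of involutions. Both x and x a are among them, whence x inverts a.\<close>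

lemma involutions:
  assumes "even be" "odd al" "x \<in> M - A"
  shows "x \<otimes> x = \<one>" and "a \<in> A \<Longrightarrow> x \<otimes> a = inv a \<otimes> x"
proof -
  have sq: "x \<otimes> x = \<one>" if x: "x \<in> M - A" for x
  proof -
    obtain y where y: "y \<in> M" "y \<noteq> \<one>" "y [^] (2::nat) = \<one>"
      using cauchy_subgroup[OF fin M.subgroup_axioms, of 2] assms(1) be by auto
    have yc: "y \<in> carrier G" using y(1) M.subset by blast
    have "ord y = 2" using y(2,3) pow_eq_id[OF yc, of 2] ord_eq_1[OF yc] prime_nat_iff[of 2] by auto
    then have "y \<notin> A" using ord_dvd_card_subgroup[OF A.subgroup_axioms, of y] al assms(2) by auto
    then have "x \<in> conj_class y" using class_M[of y] x y(1) by simp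
    from conj_class_pow_mem[OF yc this _ one_is_normal, of 2]
    show ?thesis using y(3) M_carrier[OF x] by (simp add: numeral_2_eq_2)
  qed
  show "x \<otimes> x = \<one>" by (rule sq[OF assms(3)])
  assume a: "a \<in> A"
  have c: "x \<in> carrier G" "a \<in> carrier G" using M_carrier[OF assms(3)] a by auto
  have "x \<otimes> a = inv (x \<otimes> a)"
    using sq[OF mult_A[OF assms(3) a]] c by (intro inv_equality[symmetric]) auto
  also have "\<dots> = inv a \<otimes> x"
    using inv_equality[OF sq[OF assms(3)] c(1) c(1)] c by (simp add: inv_mult_group)
  finally show "x \<otimes> a = inv a \<otimes> x" .
qed

text \<open>If x centralises A, then C(x) contains A properly and its order is a multiple of al.
  Against the known order of C(x) this shows that not all of A can be centralised.\<close>

lemma le_card_centralizer: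
  assumes x: "x \<in> M - A" and cent: "\<And>u. u \<in> A \<Longrightarrow> u \<noteq> \<one> \<Longrightarrow> x \<in> centralizer u"
  shows "2 * al \<le> card (centralizer x)"
proof -
  have xc: "x \<in> carrier G" by (rule M_carrier[OF x])
  have sub: "A \<subseteq> centralizer x"
  proof
    fix u assume u: "u \<in> A"
    then have "u \<in> carrier G" by auto
    then show "u \<in> centralizer x"
      using centralizer_sym[OF _ cent[OF u]] xc by (cases "u = \<one>") (auto simp: centralizer_def)
  qed
  have "x \<in> centralizer x" using xc by (simp add: centralizer_def)
  then have "A \<subset> centralizer x" using sub x by blast
  then have "al < card (centralizer x)"
    using psubset_card_mono[OF finite_centralizer[OF xc]] al by blast
  moreover obtain k where k: "card (centralizer x) = al * k"
    using card_subgroup_dvd[OF A.subgroup_axioms subgroup_centralizer[OF xc] sub] al by auto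
  ultimately have "al * 1 < al * k" by simp
  then have "2 \<le> k" by simp
  then have "al * 2 \<le> al * k" by (rule mult_le_mono2)
  then show ?thesis unfolding k by simp
qed

lemma centralizer_eq_M:
  assumes "u \<in> carrier G" "card (centralizer u) = card M" "\<not> r dvd card M"
  shows "centralizer u = M"
  using subgroup_le_normal_prime_index[OF fin M order r subgroup_centralizer[OF assms(1)]] assms finM
  by (intro card_subset_eq) auto

section \<open>The case be = 2, in which G/A is abelian\<close>

lemma commutator_mem:
  assumes "be = 2" "g \<in> carrier G" "h \<in> carrier G"
  shows "g \<otimes> h \<otimes> inv g \<otimes> inv h \<in> A"
proof -
  \<comment> \<open>For be = 2 the class M - A is a single coset of A, so M/A is central in
    G/A.\<close>
  have quot: "x \<otimes> inv y \<in> A" if x: "x \<in> M - A" and y: "y \<in> M - A" for x y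
  proof -
    have xc: "x \<in> carrier G" and yc: "y \<in> carrier G" using M_carrier x y by auto
    have "(\<lambda>a. a \<otimes> y) ` A = M - A"
    proof (rule card_subset_eq)
      show "(\<lambda>a. a \<otimes> y) ` A \<subseteq> M - A"
      proof
        fix z assume "z \<in> (\<lambda>a. a \<otimes> y) ` A"
        then obtain a where a: "a \<in> A" "z = a \<otimes> y" by blast
        then have "inv a \<otimes> z = y" using yc by auto
        then have "z \<notin> A" using y a(1) A.m_closed[of "inv a" z] by auto
        then show "z \<in> M - A" using a AM y by auto
      qed
      have "inj_on (\<lambda>a. a \<otimes> y) A" using yc by (auto intro!: inj_onI)
      then show "card ((\<lambda>a. a \<otimes> y) ` A) = card (M - A)"
        using al be assms(1) AM finA by (simp add: card_image card_Diff_subset psubset_imp_subset)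
    qed (use finM in auto)
    then obtain a where a: "a \<in> A" "x = a \<otimes> y" using x by blast
    then have "x \<otimes> inv y = a" using yc by (auto simp: m_assoc)
    then show ?thesis using a by simp
  qed
  have inM: "k \<otimes> m \<otimes> inv k \<otimes> inv m \<in> A" if k: "k \<in> carrier G" and m: "m \<in> M" for k m
  proof (cases "m \<in> A")
    case True
    show ?thesis using A.inv_op_closed2[OF k True] True by auto
  next
    case False
    have "k \<otimes> m \<otimes> inv k \<in> conj_class m" using k by (auto simp: conj_class_def)
    then show ?thesis using quot class_M[of m] False m by blast
  qed
  show ?thesis
  proof (cases "g \<in> M")
    case True
    have "inv (h \<otimes> g \<otimes> inv h \<otimes> inv g) \<in> A" using inM[OF assms(3) True] by auto
    then show ?thesis using assms(2,3) by (simp add: inv_mult_group m_assoc)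
  next
    case False
    \<comment> \<open>The preimage of the centralizer of g in G/A. It contains M and also g, so by
      the prime index of M it is all of G.\<close>
    let ?S = "{h \<in> carrier G. g \<otimes> h \<otimes> inv g \<otimes> inv h \<in> A}"
    have "subgroup ?S G"
    proof (rule subgroupI)
      show "?S \<noteq> {}" using assms(2) A.one_closed by auto
      fix a b assume a: "a \<in> ?S"
      then have ac: "a \<in> carrier G" by simp
      have "inv a \<otimes> inv (g \<otimes> a \<otimes> inv g \<otimes> inv a) \<otimes> a \<in> A"
        using a by (intro A.inv_op_closed1[OF ac]) auto
      then show "inv a \<in> ?S" using ac assms(2) by (simp add: inv_mult_group m_assoc)
      assume b: "b \<in> ?S"
      then have bc: "b \<in> carrier G" by simp
      have "g \<otimes> a \<otimes> inv g \<otimes> inv a \<otimes> (a \<otimes> (g \<otimes> b \<otimes> inv g \<otimes> inv b) \<otimes> inv a) \<in> A"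
        by (rule A.m_closed[OF _ A.inv_op_closed2[OF ac]]) (use a b in auto)
      then show "a \<otimes> b \<in> ?S" using ac bc assms(2) by (simp add: inv_mult_group m_assoc)
    qed auto
    moreover have "M \<subset> ?S"
    proof
      show "M \<subseteq> ?S" using inM[OF assms(2)] M.subset by blast
      have "g \<in> ?S" using assms(2) A.one_closed by (simp add: m_assoc)
      then show "M \<noteq> ?S" using False by blast
    qed
    ultimately have "?S = carrier G"
      using order subgroup_self M.subgroup_axioms
      by (intro subgroup_prime_index_eq[OF fin r, of ?S M]) (auto simp: order_def)
    then show ?thesis using assms(3) by blast
  qed
qed

lemma iso_if_al_even_be_2:
  assumes "be = 2" "even al"
  shows "G \<cong> dihedral_group 4 \<or> G \<cong> quaternion_group"
proof -
  obtain x where x: "x \<in> M - A" "x \<in> carrier G" by (rule obtain_x)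
  obtain u where u: "u \<in> A" "u \<noteq> \<one>" "u \<in> carrier G" by (rule obtain_u)
  have Cx: "card (centralizer x) = 2 * r" using card_centralizer_M[OF x(1)] assms by simp
  have "odd (al - 1)" using assms(2) al2 by simp
  then have "al - 1 dvd r" using al_dvd assms(1) by (simp add: coprime_dvd_mult_right_iff)
  then have "al - 1 = 1 \<or> al - 1 = r" using r prime_nat_iff by blast
  then have "al = 2 \<or> al = Suc r" using al2 by auto
  \<comment> \<open>Here every nontrivial element of A would have M as centralizer. Then x would
    centralise A, and |C(x)| would be at least 2 * r + 2 instead of 2 * r.\<close>
  moreover have "al = 2" if "al = Suc r"
  proof (rule ccontr)
    assume "al \<noteq> 2"
    have "r \<noteq> 2" using that assms(2) by auto
    then have "\<not> r dvd 2" using r by (metis One_nat_def Suc_1 prime_nat_iff two_is_prime_nat not_prime_1)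
    then have nd: "\<not> r dvd card M" using that be assms(1) dvd_add_right_iff[of r "r * 2" 2] by simp
    have "centralizer v = M" if v: "v \<in> A" "v \<noteq> \<one>" for v
    proof (rule centralizer_eq_M)
      have "r * card (centralizer v) = r * (al * 2)"
        using card_centralizer_A[OF v] \<open>al = Suc r\<close> assms(1) by simp
      then show "card (centralizer v) = card M" using r2 be assms(1) by simp
    qed (use v nd in auto)
    then have "2 * al \<le> card (centralizer x)" using x(1) by (intro le_card_centralizer) auto
    then show False using Cx that by simp
  qed
  ultimately have a2: "al = 2" by blast
  have cM: "card M = 4" using be assms a2 by simp
  have "card (centralizer u) = order G"
    using card_centralizer_A[OF u(1,2)] a2 order_eq by simp
  then have "centralizer u = carrier G"
    using fin subgroup.subset[OF subgroup_centralizer[OF u(3)]] by (intro card_subset_eq) (auto simp: order_def)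
  then have "u \<in> centralizer x" using centralizer_sym[OF u(3)] x(2) by blast
  \<comment> \<open>The intersection of C(x) with M has at least three elements and order dividing
    4, hence order 4. Then 4 divides |C(x)| = 2 * r, which forces r = 2.\<close>
  then have sub: "{\<one>, u, x} \<subseteq> centralizer x \<inter> M"
    using x u(1) AM by (auto simp: centralizer_def)
  have sg: "subgroup (centralizer x \<inter> M) G"
    by (rule subgroups_Inter_pair[OF subgroup_centralizer[OF x(2)] M.subgroup_axioms])
  have "x \<noteq> \<one>" "x \<noteq> u" using x(1) u(1) by auto
  then have "card {\<one>, u, x} = 3" using u(2) by auto
  then have "3 \<le> card (centralizer x \<inter> M)" using sub finM by (metis card_mono finite_Int)
  moreover have "card (centralizer x \<inter> M) dvd 4"
    using card_subgroup_dvd[OF sg M.subgroup_axioms] cM by simp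
  moreover from this have "card (centralizer x \<inter> M) \<le> 4" by (auto dest: dvd_imp_le)
  ultimately have "card (centralizer x \<inter> M) \<in> {3, 4}" "card (centralizer x \<inter> M) dvd 4" by auto
  then have "card (centralizer x \<inter> M) = 4" by auto
  then have "4 dvd 2 * r"
    using card_subgroup_dvd[OF sg subgroup_centralizer[OF x(2)]] Cx by simp
  then have "2 dvd r" by presburger
  then have r_eq: "r = 2" using primes_dvd_imp_eq[OF two_is_prime_nat r] by simp
  have o: "order G = 8" using order_eq a2 assms r_eq by simp
  have "centralizer x \<noteq> carrier G" using o Cx r_eq by (auto simp: order_def)
  then obtain g where "g \<in> carrier G" "g \<otimes> x \<noteq> x \<otimes> g"
    using subgroup.subset[OF subgroup_centralizer[OF x(2)]] by (auto simp: centralizer_def)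
  then show ?thesis using iso_order_8_noncommuting[OF fin o _ x(2)] by blast
qed

text \<open>The centralizer D of u has order 3 * r and is normal, as A has no nontrivial elements
  besides u and its inverse; it is proper because x inverts u. So D - A would be one class of 3 * r
  - 3 elements, whereas its elements have centralizers too large for that.\<close>

lemma al_ne_3_if_be_2:
  assumes "be = 2" shows "al \<noteq> 3"
proof
  assume a3: "al = 3"
  obtain x where x: "x \<in> M - A" "x \<in> carrier G" by (rule obtain_x)
  obtain u where u: "u \<in> A" "u \<noteq> \<one>" "u \<in> carrier G" by (rule obtain_u)
  have ou: "ord u = 3"
    using ord_dvd_card_subgroup[OF A.subgroup_axioms u(1)] al a3 ord_eq_1[OF u(3)] u(2) prime_nat_iff[of 3] by auto
  have uu: "inv u \<noteq> u" 
  proof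
    assume "inv u = u"
    then have "u [^] (2::nat) = \<one>" using u(3) by (metis numeral_2_eq_2 nat_pow_Suc nat_pow_0 l_one r_inv)
    then show False using pow_eq_id[OF u(3), of 2] ou by simp
  qed
  have "u \<noteq> inv u" "\<one> \<noteq> u" "\<one> \<noteq> inv u" using u(2,3) uu inv_inv[OF u(3)] inv_one by metis+
  then have "card {\<one>, u, inv u} = 3" by simp
  then have Aeq: "A = {\<one>, u, inv u}"
    using al a3 finA u(1) by (intro card_subset_eq[symmetric]) auto
  let ?D = "centralizer u"
  have sD: "subgroup ?D G" by (rule subgroup_centralizer[OF u(3)])
  have AD: "A \<subseteq> ?D" unfolding Aeq using u(3) by (auto simp: centralizer_def)
  have cD: "card ?D = card A * r" using card_centralizer_A[OF u(1,2)] a3 al assms by simp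
  have D_inv: "k \<in> centralizer (inv u)" if "k \<in> ?D" for k
  proof -
    have k: "k \<in> carrier G" "u \<in> centralizer k" using that u(3) by (auto simp: centralizer_def)
    have "inv u \<in> centralizer k" by (rule subgroup.m_inv_closed[OF subgroup_centralizer[OF k(1)] k(2)])
    then show ?thesis using k(1) by (simp add: centralizer_def)
  qed
  have D: "?D \<lhd> G"
  proof (rule normal_invI[OF sD])
    fix g h assume g: "g \<in> carrier G" and h: "h \<in> ?D"
    have hc: "h \<in> carrier G" using h by (simp add: centralizer_def)
    define v where "v = inv g \<otimes> u \<otimes> g"
    have "v \<in> A" unfolding v_def by (rule A.inv_op_closed1[OF g u(1)])
    moreover have gv: "g \<otimes> v = u \<otimes> g" using g u(3) by (simp add: v_def m_assoc)
    then have "v \<noteq> \<one>" using g u by auto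
    ultimately have "v = u \<or> v = inv u" using Aeq by blast
    then have "h \<otimes> v = v \<otimes> h" using h D_inv[OF h] by (auto simp: centralizer_def)
    have vc: "v \<in> carrier G" using \<open>v \<in> A\<close> by auto
    have ug: "u = g \<otimes> v \<otimes> inv g" using g u(3) gv by (simp add: m_assoc)
    have "g \<otimes> h \<otimes> inv g \<otimes> u = g \<otimes> (h \<otimes> v) \<otimes> inv g"
      unfolding ug using g hc vc by (simp add: m_assoc)
    also have "\<dots> = u \<otimes> (g \<otimes> h \<otimes> inv g)"
      unfolding \<open>h \<otimes> v = v \<otimes> h\<close> ug using g hc vc by (simp add: m_assoc)
    finally show "g \<otimes> h \<otimes> inv g \<in> ?D" using g hc by (simp add: centralizer_def)
  qed
  have "x \<otimes> u = inv u \<otimes> x" using involutions(2)[OF _ _ x(1) u(1)] assms a3 by simp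
  then have "x \<notin> ?D" using uu u(3) x(2) by (auto simp: centralizer_def)
  then have DG: "?D \<noteq> carrier G" using x(2) by blast
  have "card A \<noteq> card ?D" using cD r2 al a3 by simp
  then have AsD: "A \<subset> ?D" using AD by blast
  then obtain d where d: "d \<in> ?D - A" by blast
  then have dc: "d \<in> carrier G" by (simp add: centralizer_def)
  \<comment> \<open>d commutes with A and with itself, and A has prime index r in D, so no subgroup
    fits strictly between.\<close>
  have Dd: "?D \<subseteq> centralizer d"
  proof -
    have sI: "subgroup (centralizer d \<inter> ?D) G"
      by (rule subgroups_Inter_pair[OF subgroup_centralizer[OF dc] sD])
    have "u \<in> centralizer d" "inv u \<in> centralizer d" "\<one> \<in> centralizer d" "d \<in> centralizer d"
      using d D_inv[of d] u(3) dc by (auto simp: centralizer_def)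
    then have "A \<subset> centralizer d \<inter> ?D" using AD d Aeq by blast
    from subgroup_prime_index_eq[OF fin r sI A.subgroup_axioms sD this _ cD] show ?thesis by blast
  qed
  have "3 * r \<le> card (centralizer d)"
    using card_mono[OF finite_centralizer[OF dc] Dd] cD al a3 by simp
  then have "(3 * r - 3) * (3 * r) \<le> (3 * r - 3) * card (centralizer d)" by (rule mult_le_mono2)
  also have "3 * r - 3 = card (conj_class d)"
    using class_above[OF D AsD DG d] AD finA cD al a3 by (simp add: card_Diff_subset)
  also have "card (conj_class d) * card (centralizer d) = 6 * r"
    using card_conj_class[OF dc] order_eq a3 assms by simp
  finally have "card (conj_class d) * (3 * r) \<le> 6 * r" .
  then have "card (conj_class d) \<le> 2" using r2 by simp
  then show False using \<open>3 * r - 3 = card (conj_class d)\<close> r2 by simp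
qed

text \<open>Conjugation by x inverts every element of A, so inversion is multiplicative on A and A
  is commutative.\<close>

lemma A_subset_centralizer:
  assumes "be = 2" "odd al" "u \<in> A"
  shows "A \<subseteq> centralizer u"
proof
  fix a assume a: "a \<in> A"
  obtain x where x: "x \<in> M - A" "x \<in> carrier G" by (rule obtain_x)
  have c: "a \<in> carrier G" "u \<in> carrier G" using a assms(3) by auto
  have inv: "x \<otimes> b = inv b \<otimes> x" if "b \<in> A" for b
    using involutions(2)[OF _ assms(2) x(1) that] assms(1) by simp
  have "inv (a \<otimes> u) \<otimes> x = x \<otimes> a \<otimes> u" using inv[of "a \<otimes> u"] a assms(3) x(2) c by (simp add: m_assoc)
  also have "\<dots> = inv a \<otimes> (x \<otimes> u)" using inv[OF a] x(2) c by (simp add: m_assoc)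
  also have "\<dots> = inv a \<otimes> inv u \<otimes> x" using inv[OF assms(3)] x(2) c by (simp add: m_assoc)
  also have "\<dots> = inv (u \<otimes> a) \<otimes> x" using c by (simp add: inv_mult_group)
  finally have "inv (a \<otimes> u) = inv (u \<otimes> a)" using c x(2) by simp
  then have "a \<otimes> u = u \<otimes> a" using c by (metis inv_inv m_closed)
  then show "a \<in> centralizer u" using c by (simp add: centralizer_def)
qed

text \<open>al - 1 divides 2 * r, and with al = 3 excluded this leaves al = 2 * r + 1. Then A is the
  centralizer of each of its nontrivial elements, so r = 2 yields a Frobenius group of order
  20.\<close>

lemma iso_if_al_odd_be_2:
  assumes "be = 2" "odd al"
  shows "G \<cong> SmallGroup_20_3"
proof -
  obtain x where x: "x \<in> M - A" "x \<in> carrier G" by (rule obtain_x)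
  have "al \<ge> 3" using al2 assms(2) by (cases "al = 2") auto
  then obtain k where k: "al = 2 * k + 1" "k \<ge> 1" using assms(2) by (auto elim!: oddE)
  then have "k dvd r" using al_dvd assms(1) by simp
  then have "k = 1 \<or> k = r" using r prime_nat_iff by blast
  then have al_eq: "al = 2 * r + 1" using al_ne_3_if_be_2[OF assms(1)] k by auto
  have C: "centralizer u = A" if u: "u \<in> A" "u \<noteq> \<one>" for u
  proof (rule card_subset_eq[symmetric])
    show "A \<subseteq> centralizer u" by (rule A_subset_centralizer[OF assms u(1)])
    have "u \<in> carrier G" using u by auto
    then show "finite (centralizer u)" by (rule finite_centralizer)
    have "(2 * r) * card (centralizer u) = (2 * r) * al"
      using card_centralizer_A[OF u] assms al_eq by simp
    then show "card A = card (centralizer u)" using r2 al by simp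
  qed
  show ?thesis
  proof (cases "r = 2")
    case True
    show ?thesis
      by (rule iso_SmallGroup_20_3_of_frobenius[OF fin _ A.subgroup_axioms])
        (use order_eq al_eq True assms al C class_A in auto)
  next
    case False
    then have odd_r: "odd r" using r prime_odd_nat r2 by auto
    (* R is a proper normal subgroup above A, so R - A is a single class; as G/A is abelian, this
       class lies in one coset of A, but it contains both d and d * d for some d outside M. *)
    let ?R = "{g \<in> carrier G. g [^] r \<in> A}"
    interpret Q: group "G Mod A" by (rule A.factorgroup_is_group)
    have coset: "A #> h = A \<longleftrightarrow> h \<in> A" if "h \<in> carrier G" for h
      using coset_join1[OF _ that A.subgroup_axioms] coset_join2[OF that A.subgroup_axioms] by blast
    have mem: "g [^] r \<in> A \<longleftrightarrow> (A #> g) [^]\<^bsub>G Mod A\<^esub> r = A" if "g \<in> carrier G" for g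
      unfolding A.FactGroup_pow[OF that] coset[OF nat_pow_closed[OF that]] by simp
    have mulR: "g \<otimes> h \<in> ?R" if gh: "g \<in> ?R" "h \<in> ?R" for g h
    proof -
      have gc: "g \<in> carrier G" and hc: "h \<in> carrier G" using gh by auto
      have "(A #> g) <#> (A #> h) = A #> (g \<otimes> h)" by (rule A.rcos_sum[OF gc hc])
      also have "g \<otimes> h = g \<otimes> h \<otimes> inv g \<otimes> inv h \<otimes> (h \<otimes> g)" using gc hc by (simp add: m_assoc)
      also have "A #> \<dots> = A #> (h \<otimes> g)"
        using coset_mult_assoc[OF A.subset, of "g \<otimes> h \<otimes> inv g \<otimes> inv h" "h \<otimes> g"]
          coset_join2[OF _ A.subgroup_axioms commutator_mem[OF assms(1) gc hc]] gc hc by simp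
      also have "\<dots> = (A #> h) <#> (A #> g)" by (rule A.rcos_sum[OF hc gc, symmetric])
      finally have comm: "(A #> g) <#> (A #> h) = (A #> h) <#> (A #> g)" .
      have "(A #> (g \<otimes> h)) [^]\<^bsub>G Mod A\<^esub> r = ((A #> g) <#> (A #> h)) [^]\<^bsub>G Mod A\<^esub> r"
        by (simp add: A.rcos_sum[OF gc hc])
      also have "\<dots> = (A #> g) [^]\<^bsub>G Mod A\<^esub> r \<otimes>\<^bsub>G Mod A\<^esub> (A #> h) [^]\<^bsub>G Mod A\<^esub> r"
        using Q.pow_mult_distrib[of "A #> g" "A #> h" r] comm gc hc by (simp add: carrier_FactGroup)
      also have "\<dots> = A" using gh mem[OF gc] mem[OF hc] Q.l_one[OF Q.one_closed] by simp
      finally show ?thesis using mem[of "g \<otimes> h"] gc hc by simp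
    qed
    have sR: "subgroup ?R G"
    proof (rule subgroupI)
      show "?R \<noteq> {}" using A.one_closed by (auto intro!: exI[of _ \<one>])
      fix a assume a: "a \<in> ?R"
      then show "inv a \<in> ?R" using nat_pow_inv[of a r] by auto
      show "a \<otimes> b \<in> ?R" if "b \<in> ?R" for b by (rule mulR[OF a that])
    qed auto
    have R: "?R \<lhd> G"
    proof (rule normal_invI[OF sR])
      fix g h assume g: "g \<in> carrier G" and h: "h \<in> ?R"
      have "(g \<otimes> h \<otimes> inv g) \<in> conj_class h" using g by (auto simp: conj_class_def)
      from conj_class_pow_mem[OF _ this _ A, of r] show "g \<otimes> h \<otimes> inv g \<in> ?R" using g h by auto
    qed
    have pow_odd: "y [^] r = y" if y: "y \<in> M - A" for y
    proof -
      have yc: "y \<in> carrier G" by (rule M_carrier[OF y])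
      have "y [^] (2::nat) = \<one>" using involutions(1)[OF _ assms(2) y] assms(1) yc by (simp add: numeral_2_eq_2)
      from nat_pow_mod[OF yc this, of r] show ?thesis using odd_r yc by (simp add: odd_iff_mod_2_eq_one)
    qed
    have "x \<notin> ?R" using pow_odd[OF x(1)] x(1) by auto
    then have RG: "?R \<noteq> carrier G" using x(2) by blast
    \<comment> \<open>M has odd index r, so an element whose square lies in M lies in M.\<close>
    have gM: "g \<in> M" if "g \<in> carrier G" "g [^] (2::nat) \<in> M" for g
      by (rule pow_coprime_mem[OF M.subgroup_axioms that(1) that(2) pow_index_mem[OF fin M order that(1)]])
        (use odd_r in simp)
    obtain g where g: "g \<in> carrier G" "g \<notin> M" using M_proper M.subset by blast
    \<comment> \<open>If the r-th power of g is not in A, it is an involution in M - A; then the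
      square of g has trivial r-th power and still lies outside M.\<close>
    have "\<exists>d\<in>?R. d \<notin> M"
    proof (cases "g [^] r \<in> A")
      case True
      then show ?thesis using g by blast
    next
      case False
      have gr: "g [^] r \<in> M - A" using pow_index_mem[OF fin M order g(1)] False by blast
      have "(g [^] (2::nat)) [^] r = (g [^] r) [^] (2::nat)" using g(1) by (simp add: nat_pow_pow mult.commute)
      also have "\<dots> = \<one>" using involutions(1)[OF _ assms(2) gr] assms(1) g(1) by (simp add: numeral_2_eq_2)
      finally have "g [^] (2::nat) \<in> ?R" using g(1) A.one_closed by simp
      moreover have "g [^] (2::nat) \<notin> M" using gM g by blast
      ultimately show ?thesis by blast
    qed
    then obtain d where d: "d \<in> ?R" "d \<notin> M" by blast
    have dc: "d \<in> carrier G" using d by simp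
    have "A \<subseteq> ?R" using subgroup_nat_pow_closed[OF A.subgroup_axioms] A.subset by auto
    then have AR: "A \<subset> ?R" using d AM by blast
    have "d \<otimes> d \<notin> M" using gM[OF dc] d(2) dc by (auto simp: numeral_2_eq_2)
    then have "d \<otimes> d \<in> ?R - A" using mulR[OF d(1) d(1)] AM by blast
    also have "\<dots> = conj_class d" using class_above[OF R AR RG, of d] d AM by blast
    finally obtain h where h: "h \<in> carrier G" "d \<otimes> d = h \<otimes> d \<otimes> inv h" by (auto simp: conj_class_def)
    have "d = h \<otimes> d \<otimes> inv h \<otimes> inv d" unfolding h(2)[symmetric] using dc by (simp add: m_assoc)
    then have "d \<in> A" using commutator_mem[OF assms(1) h(1) dc] by simp
    then show ?thesis using d(2) AM by blast
  qed
qed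

section \<open>The case be = r + 1\<close>

lemma card_centralizer_Suc:
  assumes "be = Suc r" "x \<in> M - A" shows "card (centralizer x) = be"
proof -
  have "r * card (centralizer x) = r * be" using card_centralizer_M[OF assms(2)] assms(1) by simp
  then show ?thesis using r2 by simp
qed

text \<open>Otherwise x in M - A would centralise A, so 2 * al would be at most |C(x)| = be.\<close>

lemma not_all_centralizers_eq_M:
  assumes "be = Suc r" "be < 2 * al"
  shows "\<exists>u\<in>A - {\<one>}. centralizer u \<noteq> M"
proof (rule ccontr)
  assume all: "\<not> ?thesis"
  obtain x where x: "x \<in> M - A" "x \<in> carrier G" by (rule obtain_x)
  have "x \<in> centralizer u" if "u \<in> A" "u \<noteq> \<one>" for u using all that x(1) by blast
  from le_card_centralizer[OF x(1) this] show False
    using card_centralizer_Suc[OF assms(1) x(1)] assms(2) by simp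
qed

text \<open>A would be cyclic and its own centralizer, so G/A would embed into the abelian
  automorphism group of A. Then the class of x stays in one coset of A, although M - A consists of
  two.\<close>

lemma al_ne_7:
  assumes "be = 3" "r = 2" shows "al \<noteq> 7"
proof
  assume a7: "al = 7"
  obtain x where x: "x \<in> M - A" "x \<in> carrier G" by (rule obtain_x)
  obtain u where u: "u \<in> A" "u \<noteq> \<one>" "u \<in> carrier G" by (rule obtain_u)
  have ou: "ord u = 7"
    using ord_dvd_card_subgroup[OF A.subgroup_axioms u(1)] al a7 ord_eq_1[OF u(3)] u(2) prime_nat_iff[of 7] by auto
  have "inj_on (\<lambda>i::nat. u [^] i) {..<7}"
    by (rule inj_on_subset[OF ord_inj[OF u(3)]]) (use ou in auto)
  then have "card ((\<lambda>i::nat. u [^] i) ` {..<7}) = 7" by (simp add: card_image)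
  then have Aeq: "(\<lambda>i::nat. u [^] i) ` {..<7} = A"
    using al a7 finA subgroup_nat_pow_closed[OF A.subgroup_axioms u(1)] by (intro card_subset_eq) auto
  have pow: "\<exists>i::nat. a = u [^] i" if "a \<in> A" for a using that unfolding Aeq[symmetric] by blast
  have "card (centralizer u) = 7" using card_centralizer_A[OF u(1,2)] a7 assms by simp
  moreover have "A \<subseteq> centralizer u"
  proof
    fix a assume "a \<in> A"
    then obtain i :: nat where "a = u [^] i" using pow by blast
    then show "a \<in> centralizer u"
      using subgroup_nat_pow_closed[OF subgroup_centralizer[OF u(3)], of u i] u(3) by (simp add: centralizer_def)
  qed
  ultimately have C: "centralizer u = A"
    using al a7 finite_centralizer[OF u(3)] by (intro card_subset_eq[symmetric]) auto
  have conj: "\<exists>i::nat. u \<otimes> g = g \<otimes> u [^] i" if g: "g \<in> carrier G" for g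
  proof -
    obtain i :: nat where "inv g \<otimes> u \<otimes> g = u [^] i"
      using pow[OF A.inv_op_closed1[OF g u(1)]] by blast
    then have "u \<otimes> g = g \<otimes> u [^] i" using g u(3) by (metis inv_conj_eq_iff m_assoc inv_closed nat_pow_closed)
    then show ?thesis by blast
  qed
  \<comment> \<open>Conjugation raises u to powers, and the exponents multiply in either order. So g
    h and h g act alike on u and differ by an element of C(u) = A.\<close>
  have comm: "g \<otimes> h \<in> A #> (h \<otimes> g)" if g: "g \<in> carrier G" and h: "h \<in> carrier G" for g h
  proof -
    obtain i where i: "u \<otimes> g = g \<otimes> u [^] (i::nat)" using conj[OF g] by blast
    obtain j where j: "u \<otimes> h = h \<otimes> u [^] (j::nat)" using conj[OF h] by blast
    have *: "u \<otimes> (k \<otimes> l) = k \<otimes> l \<otimes> u [^] (m * n)"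
      if "k \<in> carrier G" "l \<in> carrier G" "u \<otimes> k = k \<otimes> u [^] m" "u \<otimes> l = l \<otimes> u [^] n" for k l and m n :: nat
    proof -
      have "u \<otimes> (k \<otimes> l) = k \<otimes> (u [^] m \<otimes> l)" using that u(3) by (simp flip: m_assoc)
      also have "u [^] m \<otimes> l = l \<otimes> (u [^] n) [^] m"
        using that u(3) by (intro pow_conj_commute) auto
      finally show ?thesis using that u(3) by (simp add: m_assoc nat_pow_pow mult.commute)
    qed
    have gh: "u \<otimes> (g \<otimes> h) = g \<otimes> h \<otimes> u [^] (i * j)" by (rule *[OF g h i j])
    have "u \<otimes> (h \<otimes> g) = h \<otimes> g \<otimes> u [^] (i * j)" using *[OF h g j i] by (simp add: mult.commute)
    then have hg: "inv (h \<otimes> g) \<otimes> u = u [^] (i * j) \<otimes> inv (h \<otimes> g)"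
      using g h u(3) by (metis inv_closed inv_solve_left inv_solve_right m_assoc m_closed nat_pow_closed)
    have "u \<otimes> (g \<otimes> h \<otimes> inv (h \<otimes> g)) = g \<otimes> h \<otimes> (u [^] (i * j) \<otimes> inv (h \<otimes> g))"
      using gh g h u(3) by (simp flip: m_assoc)
    also have "\<dots> = g \<otimes> h \<otimes> inv (h \<otimes> g) \<otimes> u"
      unfolding hg[symmetric] using g h u(3) by (simp add: m_assoc)
    finally have "g \<otimes> h \<otimes> inv (h \<otimes> g) \<in> A"
      unfolding C[symmetric] using g h by (simp add: centralizer_def)
    moreover have "g \<otimes> h = g \<otimes> h \<otimes> inv (h \<otimes> g) \<otimes> (h \<otimes> g)" using g h by (simp add: m_assoc)
    ultimately show ?thesis unfolding r_coset_def by blast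
  qed
  have "conj_class x \<subseteq> A #> x"
  proof
    fix y assume "y \<in> conj_class x"
    then obtain g where g: "g \<in> carrier G" "y = g \<otimes> x \<otimes> inv g" by (auto simp: conj_class_def)
    obtain a where a: "a \<in> A" "g \<otimes> x = a \<otimes> (x \<otimes> g)"
      using comm[OF g(1) x(2)] by (auto simp: r_coset_def)
    then have "y = a \<otimes> x" using g x(2) by (simp add: m_assoc)
    then show "y \<in> A #> x" using a(1) by (auto simp: r_coset_def)
  qed
  moreover have "A #> x = (\<lambda>a. a \<otimes> x) ` A" by (auto simp: r_coset_def)
  ultimately have "card (M - A) \<le> al"
    using class_M[OF x(1)] finA al by (metis card_image_le card_mono finite_imageI le_trans)
  then show False using AM finA al be a7 assms by (simp add: card_Diff_subset psubset_imp_subset)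
qed

text \<open>al - 1 divides 6. For al = 2 and al = 3 the whole of A would be centralised by x, which
  needs 2 * al elements in a centralizer of order 3; al = 7 is excluded separately.\<close>

lemma iso_if_be_3:
  assumes "be = 3" "r = 2"
  shows "G \<cong> sym_group 4"
proof -
  have C: "(al - 1) * card (centralizer u) = al * 6" if "u \<in> A" "u \<noteq> \<one>" for u
    using card_centralizer_A[OF that] assms by simp
  have "al - 1 dvd 6" using al_dvd assms by simp
  moreover from this have "al - 1 \<le> 6" by (auto dest: dvd_imp_le)
  then have "al - 1 \<in> {0,1,2,3,4,5,6}" by auto
  ultimately have "al - 1 \<in> {1,2,3,6}" using al2 by auto
  then consider "al = 2" | "al = 3" | "al = 4" | "al = 7" using al2 by force
  then have a4: "al = 4"
  proof cases
    case 1
    obtain x where x: "x \<in> M - A" "x \<in> carrier G" by (rule obtain_x)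
    have "x \<in> centralizer u" if u: "u \<in> A" "u \<noteq> \<one>" for u
    proof -
      have uc: "u \<in> carrier G" using u by auto
      have "card (centralizer u) = order G" using C[OF u] order_eq 1 assms by simp
      then have "centralizer u = carrier G"
        using fin subgroup.subset[OF subgroup_centralizer[OF uc]] by (intro card_subset_eq) (auto simp: order_def)
      then show ?thesis using x by simp
    qed
    from le_card_centralizer[OF x(1) this] show ?thesis
      using card_centralizer_Suc[OF _ x(1)] 1 assms by simp
  next
    case 2
    have "centralizer u = M" if u: "u \<in> A" "u \<noteq> \<one>" for u
      by (rule centralizer_eq_M) (use u C[OF u] 2 be assms in auto)
    then show ?thesis using not_all_centralizers_eq_M 2 assms by auto
  next
    case 4
    then show ?thesis using al_ne_7 assms by blast
  qed
  show ?thesis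
    by (rule iso_sym_group_4_of_chain[OF fin _ A M AM])
      (use order_eq a4 al be assms card_centralizer_Suc in auto)
qed

text \<open>For odd al every element of M - A would invert A. With more than one coset of A in M -
  A, there are x and y in M - A with x y also in M - A; the product of two inverting elements
  centralises A, so a would equal its inverse.\<close>

lemma al_even_if_be_Suc_odd:
  assumes "be = Suc r" "odd r"
  shows "even al"
proof (rule ccontr)
  assume odd: "odd al"
  have ev: "even be" using assms by simp
  obtain x where x: "x \<in> M - A" "x \<in> carrier G" by (rule obtain_x)
  obtain a where a: "a \<in> A" "a \<noteq> \<one>" "a \<in> carrier G" by (rule obtain_u)
  have r3: "r \<ge> 3" using r2 assms(2) by (cases "r = 2") auto
  have "\<not> M - A \<subseteq> (\<lambda>b. x \<otimes> b) ` A"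
  proof
    assume "M - A \<subseteq> (\<lambda>b. x \<otimes> b) ` A"
    then have "card (M - A) \<le> al" using card_mono[of "(\<lambda>b. x \<otimes> b) ` A"] card_image_le[OF finA] finA al
      by (metis finite_imageI le_trans)
    moreover have "card (M - A) = al * r"
      using AM finA al be assms by (simp add: card_Diff_subset psubset_imp_subset)
    ultimately have "al * r \<le> al * 1" by simp
    then show False using r3 al2 by simp
  qed
  then obtain y where y: "y \<in> M - A" "y \<notin> (\<lambda>b. x \<otimes> b) ` A" by blast
  have yc: "y \<in> carrier G" by (rule M_carrier[OF y(1)])
  have "x \<otimes> y \<notin> A"
  proof
    assume "x \<otimes> y \<in> A"
    moreover have "y = x \<otimes> (x \<otimes> y)"
      using involutions(1)[OF ev odd x(1)] x(2) yc by (simp flip: m_assoc)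
    ultimately show False using y(2) by blast
  qed
  then have xy: "x \<otimes> y \<in> M - A" using x(1) y(1) by auto
  have "inv a \<otimes> (x \<otimes> y) = x \<otimes> (y \<otimes> a)"
    using involutions(2)[OF ev odd xy a(1)] x(2) yc a(3) by (simp add: m_assoc)
  also have "\<dots> = x \<otimes> (inv a \<otimes> y)" using involutions(2)[OF ev odd y(1) a(1)] by simp
  also have "\<dots> = a \<otimes> (x \<otimes> y)"
    using involutions(2)[OF ev odd x(1), of "inv a"] a x(2) yc by (simp flip: m_assoc)
  finally have "inv a = a" using a(3) x(2) yc by simp
  then have "a [^] (2::nat) = \<one>" using a(3) by (metis numeral_2_eq_2 nat_pow_Suc nat_pow_0 l_one r_inv)
  then have "ord a dvd 2" using pow_eq_id[OF a(3)] by simp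
  moreover have "ord a dvd al" using ord_dvd_card_subgroup[OF A.subgroup_axioms a(1)] al by simp
  moreover have "coprime 2 al" using odd by simp
  ultimately have "ord a = 1" using coprime_common_divisor_nat by (metis One_nat_def)
  then show False using ord_eq_1[OF a(3)] a(2) by simp
qed

lemma iso_if_be_Suc_odd:
  assumes "be = Suc r" "odd r"
  shows "G \<cong> SmallGroup_24_3"
proof -
  have ev: "even be" using assms by simp
  have eva: "even al" by (rule al_even_if_be_Suc_odd[OF assms])
  have sqA: "a \<otimes> a = \<one>" if a: "a \<in> A" for a
  proof -
    obtain b where b: "b \<in> A" "b \<noteq> \<one>" "b [^] (2::nat) = \<one>"
      using cauchy_subgroup[OF fin A.subgroup_axioms, of 2] eva al by auto
    have ac: "a \<in> carrier G" and bc: "b \<in> carrier G" using a b by auto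
    show ?thesis
    proof (cases "a = \<one>")
      case False
      then have "a \<in> conj_class b" using class_A[of b] a b by simp
      from conj_class_pow_mem[OF bc this _ one_is_normal, of 2]
      show ?thesis using b(3) ac by (simp add: numeral_2_eq_2)
    qed simp
  qed
  have sqM: "m \<otimes> m \<in> A" if "m \<in> M" for m
    using square_A[OF ev, of m] that by (cases "m \<in> A") auto
  \<comment> \<open>Squares of M lie in A and squares of A are trivial, so every fourth power in M
    is trivial. A common prime factor would be odd and give an element of that order in M.\<close>
  have "coprime (al - 1) be"
  proof (rule ccontr)
    assume "\<not> ?thesis"
    then obtain p where "prime p" "p dvd gcd (al - 1) be"
      using prime_factor_nat coprime_iff_gcd_eq_1 by blast
    then have p: "prime p" "p dvd al - 1" "p dvd be" by auto
    have "odd (al - 1)" using eva al2 by simp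
    then have "p \<noteq> 2" using p by blast
    obtain m where m: "m \<in> M" "m \<noteq> \<one>" "m [^] p = \<one>"
      using cauchy_subgroup[OF fin M.subgroup_axioms p(1)] p(3) be by auto
    have mc: "m \<in> carrier G" using m(1) M.subset by blast
    have "m \<otimes> m \<otimes> (m \<otimes> m) = \<one>" by (rule sqA[OF sqM[OF m(1)]])
    then have "m [^] (4::nat) = \<one>" using mc by (simp add: numeral_eq_Suc m_assoc)
    then have "ord m dvd 4" "ord m dvd p" using pow_eq_id[OF mc] m(3) by auto
    moreover have "ord m \<noteq> 1" using ord_eq_1[OF mc] m(2) by blast
    ultimately have "p dvd 2 ^ 2" using p(1) prime_nat_iff by auto
    then have "p dvd 2" using p(1) prime_dvd_power by blast
    then show False using p(1) \<open>p \<noteq> 2\<close> primes_dvd_imp_eq two_is_prime_nat by blast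
  qed
  then have "al - 1 dvd r" using al_dvd by (simp add: coprime_dvd_mult_right_iff)
  then have "al - 1 = 1 \<or> al - 1 = r" using r prime_nat_iff by blast
  then have "al = 2 \<or> al = Suc r" using al2 by auto
  \<comment> \<open>Then every nontrivial element of A has a centralizer of order |M|, which is
    prime to r, so it equals M.\<close>
  moreover have "al \<noteq> Suc r"
  proof
    assume a: "al = Suc r"
    have "centralizer u = M" if u: "u \<in> A" "u \<noteq> \<one>" for u
    proof (rule centralizer_eq_M)
      have "r * card (centralizer u) = r * (al * be)" using card_centralizer_A[OF u] a by (simp add: mult.commute)
      then show "card (centralizer u) = card M" using r2 be by simp
      have "\<not> r dvd Suc r" using r2 dvd_add_right_iff[of r r 1] by auto
      then show "\<not> r dvd card M" by (simp only: be a assms(1) prime_dvd_mult_iff[OF r]) simp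
    qed (use u in auto)
    then show False using not_all_centralizers_eq_M[OF assms(1)] a assms by auto
  qed
  ultimately have a2: "al = 2" by blast
  obtain z where z: "z \<in> A" "z \<noteq> \<one>" "z \<in> carrier G" by (rule obtain_u)
  have Aeq: "A = {\<one>, z}"
    using al a2 finA z by (intro card_subset_eq[symmetric]) auto
  have "card (centralizer z) = order G" using card_centralizer_A[OF z(1,2)] a2 order_eq by simp
  then have Cz: "centralizer z = carrier G"
    using fin subgroup.subset[OF subgroup_centralizer[OF z(3)]] by (intro card_subset_eq) (auto simp: order_def)
  have zcomm: "z \<otimes> g = g \<otimes> z" if "g \<in> carrier G" for g
    using that unfolding Cz[symmetric] by (simp add: centralizer_def)
  have zz: "z \<otimes> z = \<one>" by (rule sqA[OF z(1)])
  \<comment> \<open>Otherwise all of M squares to one, M is commutative, and C(x) contains M, which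
    has 2 * be elements instead of be.\<close>
  have sq: "x \<otimes> x = z" if x: "x \<in> M - A" for x
  proof (rule ccontr)
    assume "x \<otimes> x \<noteq> z"
    then have xx: "x \<otimes> x = \<one>" using sqM[of x] x Aeq by auto
    have xc: "x \<in> carrier G" by (rule M_carrier[OF x])
    have inv: "inv m = m" if m: "m \<in> M" for m
    proof (rule inv_equality)
      show mc: "m \<in> carrier G" using m M.subset by blast
      show "m \<otimes> m = \<one>"
      proof (cases "m \<in> A")
        case False
        have "x [^] (2::nat) \<in> {\<one>}" using xx xc by (simp add: numeral_2_eq_2)
        moreover have "m \<in> conj_class x" using class_M[OF x] m False by simp
        ultimately have "m [^] (2::nat) \<in> {\<one>}" using conj_class_pow_mem[OF xc _ _ one_is_normal] by blast
        then show ?thesis using mc by (simp add: numeral_2_eq_2)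
      qed (rule sqA)
    qed (use m M.subset in auto)
    have "M \<subseteq> centralizer x"
    proof
      fix m assume m: "m \<in> M"
      have mc: "m \<in> carrier G" using m M.subset by blast
      have "inv (m \<otimes> x) = m \<otimes> x" using x m by (intro inv) auto
      then have "m \<otimes> x = x \<otimes> m" using inv[OF m] inv[of x] x mc xc by (simp add: inv_mult_group)
      then show "m \<in> centralizer x" using mc by (simp add: centralizer_def)
    qed
    then have "card M \<le> be"
      using card_mono[OF finite_centralizer[OF xc]] card_centralizer_Suc[OF assms(1) x] by metis
    then show False using be a2 be2 by simp
  qed
  \<comment> \<open>For y in C(x) outside A, (x y)^2 = x^2 y^2 = z^2 = 1, so x y lies in A. This
    bounds |C(x)| = be by 4, while r is at least 3.\<close>
  have be4: "be = 4"
  proof -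
    obtain x where x: "x \<in> M - A" "x \<in> carrier G" by (rule obtain_x)
    have cC: "card (centralizer x) = be" by (rule card_centralizer_Suc[OF assms(1) x(1)])
    have "\<not> r dvd be" using r2 dvd_add_right_iff[of r r 1] assms(1) by auto
    then have CM: "centralizer x \<subseteq> M"
      using subgroup_le_normal_prime_index[OF fin M order r subgroup_centralizer[OF x(2)]] cC by simp
    have "centralizer x \<subseteq> {\<one>, z, inv x, inv x \<otimes> z}"
    proof
      fix y assume y: "y \<in> centralizer x"
      then have yc: "y \<in> carrier G" and comm: "y \<otimes> x = x \<otimes> y" by (auto simp: centralizer_def)
      show "y \<in> {\<one>, z, inv x, inv x \<otimes> z}"
      proof (cases "y \<in> A")
        case False
        then have yM: "y \<in> M - A" using CM y by blast
        have "x \<otimes> y \<otimes> (x \<otimes> y) = x \<otimes> (y \<otimes> x) \<otimes> y" using x(2) yc by (simp add: m_assoc)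
        also have "\<dots> = x \<otimes> x \<otimes> (y \<otimes> y)" unfolding comm using x(2) yc by (simp add: m_assoc)
        also have "\<dots> = \<one>" using sq[OF x(1)] sq[OF yM] zz by simp
        finally have "x \<otimes> y \<in> A" using sq[of "x \<otimes> y"] z(2) x(1) yM by auto
        moreover have "y = inv x \<otimes> (x \<otimes> y)" using x(2) yc by simp
        ultimately show ?thesis using Aeq x(2) by auto
      qed (use Aeq in auto)
    qed
    then have "card (centralizer x) \<le> card {\<one>, z, inv x, inv x \<otimes> z}" by (intro card_mono) auto
    also have "\<dots> \<le> 4" by (simp add: card_insert_if)
    finally have "be \<le> 4" using cC by simp
    moreover have "r \<ge> 3" using r2 assms(2) by (cases "r = 2") auto
    ultimately show ?thesis using assms(1) by simp
  qed
  show ?thesis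
  proof (rule iso_SmallGroup_24_3_of_quaternion_normal[OF fin _ M])
    show "order G = 24" "card M = 8" using order_eq be a2 be4 assms by auto
    show "z \<in> M" using z(1) AM by blast
    show "z \<otimes> g = g \<otimes> z" if "g \<in> carrier G" for g by (rule zcomm[OF that])
    show "g \<otimes> g = z" "card (centralizer g) = 4" if "g \<in> M - {\<one>, z}" for g
      using sq[of g] card_centralizer_Suc[OF assms(1), of g] that be4 unfolding Aeq by auto
  qed (fact z(2) zz)+
qed

theorem chief_chain_cases:
  "G \<cong> dihedral_group 4 \<or> G \<cong> quaternion_group \<or> G \<cong> sym_group 4
    \<or> G \<cong> SmallGroup_20_3 \<or> G \<cong> SmallGroup_24_3"
proof (cases "be = 2")
  case True
  then show ?thesis using iso_if_al_even_be_2 iso_if_al_odd_be_2 by (cases "even al") auto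
next
  case False
  then have be: "be = Suc r" using be_cases by simp
  show ?thesis
  proof (cases "r = 2")
    case True
    then show ?thesis using iso_if_be_3 be by simp
  next
    case False
    then have "odd r" using r prime_odd_nat r2 by auto
    then show ?thesis using iso_if_be_Suc_odd be by simp
  qed
qed

end

section \<open>Direct factors and the main theorem\<close>

context group
begin

lemma ncc_one:
  assumes "finite (carrier G)" "N \<lhd> G" "ncc G N = 1"
  shows "N = {\<one>}"
proof (rule ccontr)
  assume "N \<noteq> {\<one>}"
  moreover have "\<one> \<in> N" using assms(2) normal_imp_subgroup subgroup.one_closed by blast
  ultimately have "{\<one>} \<subset> N" by blast
  from ncc_less(1)[OF assms(1) one_is_normal assms(2) this] assms(3)
  have "ncc G {\<one>} = 0" by simp
  then show False by (simp add: ncc_eq_card_conj_class[OF one_is_normal])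
qed

lemma ncc_trivial: "ncc G {\<one>} = 1"
  by (simp add: ncc_eq_card_conj_class[OF one_is_normal])

lemma ncc_central:
  assumes "N \<lhd> G" "\<And>x g. x \<in> N \<Longrightarrow> g \<in> carrier G \<Longrightarrow> g \<otimes> x = x \<otimes> g"
  shows "ncc G N = card N"
proof -
  have sub: "N \<subseteq> carrier G" using assms(1) normal_imp_subgroup subgroup.subset by blast
  have "conj_class x = {x}" if x: "x \<in> N" for x
  proof -
    have "g \<otimes> x \<otimes> inv g = x" if "g \<in> carrier G" for g
      using conj_eq_iff_commute[OF that] x sub assms(2)[OF x that] by blast
    then show ?thesis using one_closed by (auto simp: conj_class_def image_iff intro: bexI[of _ \<one>])
  qed
  then have "inj_on conj_class N" by (auto intro!: inj_onI)
  then show ?thesis by (simp add: ncc_eq_card_conj_class[OF assms(1)] card_image)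
qed

text \<open>The commutator of x and y lies in both normal subgroups.\<close>

lemma normal_disjoint_commute:
  assumes "N \<lhd> G" "K \<lhd> G" "N \<inter> K = {\<one>}" "x \<in> N" "y \<in> K"
  shows "x \<otimes> y = y \<otimes> x"
proof -
  interpret N: normal N G by fact
  interpret K: normal K G by fact
  have c: "x \<in> carrier G" "y \<in> carrier G" using assms by auto
  have "x \<otimes> y \<otimes> inv x \<otimes> inv y \<in> K"
    using K.inv_op_closed2[OF c(1) assms(5)] assms(5) by auto
  moreover have "x \<otimes> y \<otimes> inv x \<otimes> inv y = x \<otimes> (y \<otimes> inv x \<otimes> inv y)" using c by (simp add: m_assoc)
  then have "x \<otimes> y \<otimes> inv x \<otimes> inv y \<in> N"
    using N.inv_op_closed2[OF c(2), of "inv x"] assms(4) by auto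
  ultimately have "x \<otimes> y \<otimes> inv x \<otimes> inv y = \<one>" using assms(3) by blast
  then have "x \<otimes> y \<otimes> inv (y \<otimes> x) = \<one>" using c by (simp add: inv_mult_group m_assoc)
  then show ?thesis using c by (metis inv_closed inv_equality inv_inv m_closed)
qed

text \<open>N and M commute elementwise and N M is a subgroup with |N| * |M| elements, so |N|
  divides the prime r. Thus N has order r and complements M.\<close>

lemma normal_complement:
  assumes fin: "finite (carrier G)" and M: "M \<lhd> G" and r: "prime r" and o: "order G = card M * r"
    and N: "N \<lhd> G" "N \<inter> M = {\<one>}" "N \<noteq> {\<one>}"
  shows "card N = r" and "carrier G = N <#> M"
    and "\<And>x g. x \<in> N \<Longrightarrow> g \<in> carrier G \<Longrightarrow> g \<otimes> x = x \<otimes> g"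
proof -
  interpret M: normal M G by fact
  interpret N: normal N G by fact
  have finN: "finite N" and finM: "finite M" using fin N.subset M.subset finite_subset by blast+
  have inj: "inj_on (\<lambda>(n, m). n \<otimes> m) (N \<times> M)"
  proof (rule inj_onI, clarify)
    fix n m n' m' assume h: "n \<in> N" "m \<in> M" "n' \<in> N" "m' \<in> M" "n \<otimes> m = n' \<otimes> m'"
    then have c: "n \<in> carrier G" "m \<in> carrier G" "n' \<in> carrier G" "m' \<in> carrier G" by auto
    have "inv n' \<otimes> (n \<otimes> m) = m'" unfolding h(5) using c by simp
    then have "inv n' \<otimes> n = m' \<otimes> inv m" using c by (metis inv_closed inv_solve_right m_assoc m_closed)
    moreover have "inv n' \<otimes> n \<in> N" "m' \<otimes> inv m \<in> M" using h by auto
    ultimately have "inv n' \<otimes> n \<in> N \<inter> M" "m' \<otimes> inv m = inv n' \<otimes> n" by auto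
    then have "inv n' \<otimes> n = \<one>" "m' \<otimes> inv m = \<one>" using N(2) by auto
    then show "n = n' \<and> m = m'" using c by (metis inv_equality inv_inv inv_closed)
  qed
  have prod: "N <#> M = (\<lambda>(n, m). n \<otimes> m) ` (N \<times> M)" by (auto simp: set_mult_def)
  have cNM: "card (N <#> M) = card N * card M"
    unfolding prod card_image[OF inj] by (rule card_cartesian_product)
  have sNM: "subgroup (N <#> M) G"
  proof (rule subgroupI)
    show "N <#> M \<subseteq> carrier G" by (rule set_mult_closed[OF N.subset M.subset])
    have "\<one> \<otimes> \<one> \<in> N <#> M" unfolding set_mult_def using N.one_closed M.one_closed by blast
    then show "N <#> M \<noteq> {}" by blast
    note comm = normal_disjoint_commute[OF N(1) M N(2)]
    fix a assume "a \<in> N <#> M"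
    then obtain n m where a: "n \<in> N" "m \<in> M" "a = n \<otimes> m" by (auto simp: set_mult_def)
    have "inv a = inv n \<otimes> inv m" using a comm[of "inv n" "inv m"] by (simp add: inv_mult_group)
    then show "inv a \<in> N <#> M" using a unfolding set_mult_def by auto
    fix b assume "b \<in> N <#> M"
    then obtain n' m' where b: "n' \<in> N" "m' \<in> M" "b = n' \<otimes> m'" by (auto simp: set_mult_def)
    have c: "n \<in> carrier G" "m \<in> carrier G" "n' \<in> carrier G" "m' \<in> carrier G" using a b by auto
    have "a \<otimes> b = n \<otimes> (m \<otimes> n') \<otimes> m'" using a(3) b(3) c by (simp add: m_assoc)
    also have "\<dots> = (n \<otimes> n') \<otimes> (m \<otimes> m')" unfolding comm[OF b(1) a(2), symmetric] using c by (simp add: m_assoc)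
    finally show "a \<otimes> b \<in> N <#> M" unfolding set_mult_def using a b by auto
  qed
  have M0: "card M > 0" using finM M.one_closed card_gt_0_iff by blast
  have "card N * card M dvd r * card M" using card_subgroup_dvd_order[OF sNM] cNM o by (simp add: mult.commute)
  then have "card N dvd r" using M0 by simp
  moreover have "card N \<noteq> 1" using N(3) N.one_closed by (metis card_1_singletonE singletonD)
  ultimately show cN: "card N = r" using r prime_nat_iff by blast
  show G: "carrier G = N <#> M"
    using fin cNM cN o subgroup.subset[OF sNM] by (intro card_subset_eq[symmetric]) (auto simp: order_def mult.commute)
  fix x g assume x: "x \<in> N" and g: "g \<in> carrier G"
  have xc: "x \<in> carrier G" using x by auto
  \<comment> \<open>N has prime order, so the elements of N commuting with a nontrivial x form all
    of N.\<close>
  have Nx: "N \<subseteq> centralizer x"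
  proof (cases "x = \<one>")
    case True
    then show ?thesis using N.subset by (auto simp: centralizer_def)
  next
    case False
    have "x \<in> centralizer x \<inter> N" using x xc by (simp add: centralizer_def)
    have sg: "subgroup (centralizer x \<inter> N) G"
      by (rule subgroups_Inter_pair[OF subgroup_centralizer[OF xc] N.subgroup_axioms])
    then have "card (centralizer x \<inter> N) dvd r"
      using card_subgroup_dvd[OF sg N.subgroup_axioms] cN by simp
    moreover have "card (centralizer x \<inter> N) \<noteq> 1"
      using \<open>x \<in> centralizer x \<inter> N\<close> subgroup.one_closed[OF sg] False by (metis card_1_singletonE singletonD)
    ultimately have "card (centralizer x \<inter> N) = card N" using r prime_nat_iff cN by metis
    then have "centralizer x \<inter> N = N" using finN by (intro card_subset_eq) auto
    then show ?thesis by blast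
  qed
  obtain n m where nm: "n \<in> N" "m \<in> M" "g = n \<otimes> m" using g unfolding G by (auto simp: set_mult_def)
  have "x \<otimes> m = m \<otimes> x" by (rule normal_disjoint_commute[OF N(1) M N(2) x nm(2)])
  moreover have "n \<otimes> x = x \<otimes> n" using Nx nm(1) by (auto simp: centralizer_def)
  moreover have "n \<in> carrier G" "m \<in> carrier G" using nm by auto
  ultimately show "g \<otimes> x = x \<otimes> g" unfolding nm(3) using xc by (metis m_assoc)
qed

text \<open>The elements outside H form one coset, so the product of any two of them is in H. If g h
  g^-1 were outside H, then so would be g; their product g h lies in H, and hence g does
  too.\<close>

lemma subgroup_index_2_normal:
  assumes fin: "finite (carrier G)" and H: "subgroup H G" and o: "order G = 2 * card H"
  shows "H \<lhd> G"
proof -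
  have Hc: "h \<in> carrier G" if "h \<in> H" for h using subgroup.mem_carrier[OF H that] .
  have finH: "finite H" using fin subgroup.subset[OF H] finite_subset by blast
  have mul: "a \<otimes> b \<in> H" if a: "a \<in> carrier G" "a \<notin> H" and b: "b \<in> carrier G" "b \<notin> H" for a b
  proof -
    have "(\<lambda>h. h \<otimes> inv b) ` H = carrier G - H"
    proof (rule card_subset_eq)
      show "(\<lambda>h. h \<otimes> inv b) ` H \<subseteq> carrier G - H"
      proof
        fix y assume "y \<in> (\<lambda>h. h \<otimes> inv b) ` H"
        then obtain h where h: "h \<in> H" "y = h \<otimes> inv b" by blast
        have "y \<notin> H"
        proof
          assume y: "y \<in> H"
          have "inv y \<otimes> h = b" using h(2) Hc[OF h(1)] b(1) by (simp add: inv_mult_group m_assoc)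
          then show False using subgroup.m_closed[OF H subgroup.m_inv_closed[OF H y] h(1)] b(2) by simp
        qed
        then show "y \<in> carrier G - H" using h Hc[OF h(1)] b(1) by simp
      qed
      have "inj_on (\<lambda>h. h \<otimes> inv b) H" using b(1) Hc by (auto intro!: inj_onI)
      then show "card ((\<lambda>h. h \<otimes> inv b) ` H) = card (carrier G - H)"
        using o finH subgroup.subset[OF H] by (simp add: card_image card_Diff_subset order_def)
    qed (use fin in auto)
    then obtain h where h: "h \<in> H" "a = h \<otimes> inv b" using a by blast
    then have "a \<otimes> b = h" using b(1) Hc[OF h(1)] by (simp add: m_assoc)
    then show ?thesis using h(1) by simp
  qed
  show ?thesis
  proof (rule normal_invI[OF H], rule ccontr)
    fix g h assume g: "g \<in> carrier G" and h: "h \<in> H" and n: "g \<otimes> h \<otimes> inv g \<notin> H"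
    have "g \<notin> H"
    proof
      assume "g \<in> H"
      from subgroup.m_closed[OF H subgroup.m_closed[OF H this h] subgroup.m_inv_closed[OF H this]]
      show False using n by simp
    qed
    then have "g \<otimes> h \<otimes> inv g \<otimes> g \<in> H" using mul[of "g \<otimes> h \<otimes> inv g" g] n g Hc[OF h] by simp
    then have gh: "g \<otimes> h \<in> H" using g Hc[OF h] by (simp add: m_assoc)
    from subgroup.m_closed[OF H gh subgroup.m_inv_closed[OF H h]]
    have "g \<in> H" using g Hc[OF h] by (simp add: m_assoc)
    then show False using \<open>g \<notin> H\<close> by simp
  qed
qed

text \<open>A normal subgroup with two classes is minimal: an intermediate one would need a count
  strictly between 1 and 2.\<close>

lemma ncc_intersection:
  assumes fin: "finite (carrier G)" and "N \<lhd> G" "K \<lhd> G" "ncc G N = 2"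
  shows "N \<subseteq> K \<or> N \<inter> K = {\<one>}"
proof (rule ccontr)
  assume n: "\<not> ?thesis"
  have NK: "N \<inter> K \<lhd> G" by (rule normal_subgroup_intersect[OF assms(2,3)])
  then have "\<one> \<in> N \<inter> K" using normal_imp_subgroup subgroup.one_closed by blast
  then have "{\<one>} \<subset> N \<inter> K" "N \<inter> K \<subset> N" using n by blast+
  then have "ncc G {\<one>} < ncc G (N \<inter> K)" "ncc G (N \<inter> K) < ncc G N"
    using ncc_less(1)[OF fin] one_is_normal NK assms(2) by blast+
  then show False using assms(4) ncc_trivial by simp
qed

lemma iso_integer_mod_group_6_of_central:
  assumes fin: "finite (carrier G)" and o: "order G = 6"
    and N: "subgroup N G" "card N = 2" and K: "subgroup K G" "card K = 3"
    and comm: "\<And>x y. x \<in> N \<Longrightarrow> y \<in> K \<Longrightarrow> x \<otimes> y = y \<otimes> x"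
  shows "G \<cong> integer_mod_group 6"
proof -
  have nontriv: "\<exists>x\<in>H. x \<noteq> \<one>" if "subgroup H G" "card H \<noteq> 1" for H
    using that subgroup.one_closed[OF that(1)] by (metis is_singletonI' is_singleton_altdef empty_iff)
  obtain a where a: "a \<in> N" "a \<noteq> \<one>" using nontriv[OF N(1)] N(2) by auto
  obtain b where b: "b \<in> K" "b \<noteq> \<one>" using nontriv[OF K(1)] K(2) by auto
  have ac: "a \<in> carrier G" and bc: "b \<in> carrier G"
    using subgroup.mem_carrier[OF N(1) a(1)] subgroup.mem_carrier[OF K(1) b(1)] .
  have "a [^] (2::nat) = \<one>" using ord_dvd_card_subgroup[OF N(1) a(1)] N(2) pow_eq_id[OF ac] by simp
  then have "a \<otimes> a = \<one>" using ac by (simp add: numeral_2_eq_2)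
  moreover have "b [^] (3::nat) = \<one>" using ord_dvd_card_subgroup[OF K(1) b(1)] K(2) pow_eq_id[OF bc] by simp
  ultimately show ?thesis
    using iso_integer_mod_group_6[OF fin o ac bc a(2) _ b(2)] comm[OF a(1) b(1)] by blast
qed

text \<open>Applied to the sizes c and d of the two nontrivial classes in a normal subgroup of order
  1 + c + d. For c at most d, either d = c + 1 and c divides 2, or d is at most 1.\<close>

lemma dvd_Suc_cases:
  fixes c d :: nat
  assumes "c dvd Suc d" "d dvd Suc c"
  shows "c = 2 \<or> d = 2 \<or> (c = 1 \<and> d = 1)"
proof -
  have aux: "c = 2 \<or> d = 2 \<or> (c = 1 \<and> d = 1)" if cd: "c dvd Suc d" "d dvd Suc c" "c \<le> d" for c d :: nat
  proof -
    obtain k where k: "Suc c = d * k" using cd(2) by blast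
    have "k \<noteq> 0" using k by (metis mult_0_right nat.distinct(1))
    then consider "k = 1" | "k \<ge> 2" by linarith
    then show ?thesis
    proof cases
      case 1
      then have "d = Suc c" using k by simp
      then have "c dvd c + 2" using cd(1) by simp
      then have "c dvd 2" using dvd_add_right_iff[of c c 2] by simp
      then have "c \<le> 2" "c \<noteq> 0" by (auto dest: dvd_imp_le intro: gr0I)
      then show ?thesis using \<open>d = Suc c\<close> by auto
    next
      case 2
      then have "d * 2 \<le> Suc c" using k by simp
      then have "d \<le> 1" using cd(3) by simp
      then show ?thesis using cd k by (cases "d = 0"; cases "c = 0") auto
    qed
  qed
  show ?thesis
  proof (cases "c \<le> d")
    case True
    then show ?thesis using aux[of c d] assms by blast
  next
    case False
    then show ?thesis using aux[of d c] assms by auto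
  qed
qed

text \<open>G is the direct product of M with a central group of order 2, so class sizes in M divide
  |M| = 1 + c + d. With size 2 excluded, both sizes are 1 and |M| = 3.\<close>

lemma iso_Z6_of_direct_factor_2:
  assumes fin: "finite (carrier G)" and M: "M \<lhd> G" and A: "A \<lhd> G" and AM: "A \<inter> M = {\<one>}"
    and cA: "card A = 2" and central: "\<And>x g. x \<in> A \<Longrightarrow> g \<in> carrier G \<Longrightarrow> g \<otimes> x = x \<otimes> g"
    and o: "order G = 2 * card M" and nM: "ncc G M = 3"
    and small: "\<And>N. N \<lhd> G \<Longrightarrow> N \<noteq> carrier G \<Longrightarrow> ncc G N \<le> 3"
  shows "G \<cong> integer_mod_group 6"
proof -
  interpret M: normal M G by fact
  interpret A: normal A G by fact
  have finM: "finite M" using fin M.subset finite_subset by blast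
  have "A \<noteq> {\<one>}" using cA by auto
  then obtain n where n: "n \<in> A" "n \<noteq> \<one>" using A.one_closed by blast
  have nc: "n \<in> carrier G" using n by auto
  have nM': "n \<notin> M" using n AM by blast
  have cl1: "conj_class \<one> = {\<one>}" using one_closed by (auto simp: conj_class_def image_iff)
  have cln: "conj_class n = {n}"
  proof -
    have "g \<otimes> n \<otimes> inv g = n" if "g \<in> carrier G" for g
      using conj_eq_iff_commute[OF that nc] central[OF n(1) that] by blast
    then show ?thesis using one_closed by (auto simp: conj_class_def image_iff intro: bexI[of _ \<one>])
  qed
  (* Otherwise the centralizer of s has index 2, and 1, n, s, s * n lie in four of its classes. *)
  have no2: "card (conj_class s) \<noteq> 2" if s: "s \<in> M" for s
  proof
    assume c2: "card (conj_class s) = 2"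
    have sc: "s \<in> carrier G" using s by auto
    have s1: "s \<noteq> \<one>" using c2 cl1 by auto
    have cC: "card (centralizer s) = card M" using card_conj_class[OF sc] c2 o by simp
    let ?H = "centralizer s"
    have sH: "subgroup ?H G" by (rule subgroup_centralizer[OF sc])
    have H: "?H \<lhd> G" by (rule subgroup_index_2_normal[OF fin sH]) (use o cC in simp)
    have "card M > 0" using finM M.one_closed card_gt_0_iff by blast
    then have HG: "?H \<noteq> carrier G" using cC o by (auto simp: order_def)
    have nH: "n \<in> ?H" and sH': "s \<in> ?H" using central[OF n(1) sc] nc sc by (auto simp: centralizer_def)
    have snM: "s \<otimes> n \<notin> M"
    proof
      assume "s \<otimes> n \<in> M"
      then have "inv s \<otimes> (s \<otimes> n) \<in> M" using s by blast
      then show False using nM' sc nc by simp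
    qed
    have sub: "conj_class s \<subseteq> M" by (rule conj_class_subset_normal[OF M s])
    have self: "s \<in> conj_class s" "s \<otimes> n \<in> conj_class (s \<otimes> n)" using conj_class_self sc nc by auto
    have "s \<otimes> n \<noteq> n" using s1 sc nc by simp
    then have "{n} \<noteq> conj_class (s \<otimes> n)" using self(2) by (metis singletonD)
    moreover have "{\<one>} \<noteq> {n}" using n(2) by simp
    moreover have "{\<one>} \<noteq> conj_class s" using self(1) s1 by (metis singletonD)
    moreover have "{\<one>} \<noteq> conj_class (s \<otimes> n)" using self(2) snM M.one_closed by (metis singletonD)
    moreover have "{n} \<noteq> conj_class s" using sub nM' by (metis insert_subset)
    moreover have "conj_class s \<noteq> conj_class (s \<otimes> n)" using sub self(2) snM by (metis subsetD)
    ultimately have "{\<one>} \<noteq> {n}" "{\<one>} \<noteq> conj_class s" "{\<one>} \<noteq> conj_class (s \<otimes> n)"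
      "{n} \<noteq> conj_class s" "{n} \<noteq> conj_class (s \<otimes> n)" "conj_class s \<noteq> conj_class (s \<otimes> n)"
      by simp_all
    then have "card {{\<one>}, {n}, conj_class s, conj_class (s \<otimes> n)} = 4" by simp
    moreover have "{{\<one>}, {n}, conj_class s, conj_class (s \<otimes> n)} \<subseteq> conj_class ` ?H"
      unfolding cl1[symmetric] cln[symmetric]
      using nH sH' subgroup.one_closed[OF sH] subgroup.m_closed[OF sH sH' nH] by auto
    ultimately have "4 \<le> card (conj_class ` ?H)"
      using card_mono[OF finite_imageI[OF finite_subset[OF subgroup.subset[OF sH] fin], of conj_class]] by metis
    then show False using small[OF H HG] ncc_eq_card_conj_class[OF H] by simp
  qed
  \<comment> \<open>The central subgroup A puts the factor 2 of |G| = 2 * |M| into the centralizer,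
    so the class size divides |M|.\<close>
  have dvdM: "card (conj_class s) dvd card M" if s: "s \<in> M" for s
  proof -
    have sc: "s \<in> carrier G" using s by auto
    have "A \<subseteq> centralizer s" using central[OF _ sc] by (auto simp: centralizer_def)
    then have "2 dvd card (centralizer s)"
      using card_subgroup_dvd[OF A.subgroup_axioms subgroup_centralizer[OF sc]] cA by simp
    then obtain k where "card (centralizer s) = 2 * k" by blast
    then have "card (conj_class s) * k = card M" using card_conj_class[OF sc] o by simp
    then show ?thesis by (metis dvd_triv_left)
  qed
  have "card (conj_class ` M) = 3" using nM ncc_eq_card_conj_class[OF M] by simp
  moreover have "conj_class \<one> \<in> conj_class ` M" using M.one_closed by blast
  ultimately have "card (conj_class ` M - {conj_class \<one>}) = 2" by simp
  then obtain C D where CD: "conj_class ` M - {conj_class \<one>} = {C, D}" "C \<noteq> D" unfolding card_2_iff by blast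
  then obtain s t where st: "s \<in> M" "C = conj_class s" "t \<in> M" "D = conj_class t" by (metis Diff_iff imageE insertCI)
  have sc: "s \<in> carrier G" and tc: "t \<in> carrier G" using st by auto
  have "M = \<Union> (conj_class ` M)"
    using conj_class_self conj_class_subset_normal[OF M] M.subset by blast
  also have "conj_class ` M = insert (conj_class \<one>) (conj_class ` M - {conj_class \<one>})"
    using M.one_closed by (simp add: insert_absorb)
  also have "\<dots> = {{\<one>}, C, D}" unfolding CD(1) unfolding cl1 by simp
  finally have Meq: "M = {\<one>} \<union> C \<union> D" by simp
  have ne1: "C \<noteq> conj_class \<one>" "D \<noteq> conj_class \<one>"
    using CD(1) by (metis Diff_iff insertCI)+
  have "\<one> \<notin> C" using conj_class_eq[OF sc, of \<one>] ne1(1) st(2) by metis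
  moreover have "\<one> \<notin> D" using conj_class_eq[OF tc, of \<one>] ne1(2) st(4) by metis
  moreover have "z \<notin> D" if "z \<in> C" for z
    using conj_class_eq[OF sc, of z] conj_class_eq[OF tc, of z] that CD(2) st(2,4) by metis
  then have "C \<inter> D = {}" by blast
  moreover have "finite C" "finite D" using Meq finM finite_subset[of C M] finite_subset[of D M] by blast+
  ultimately have cM: "card M = Suc (card C + card D)" unfolding Meq by (simp add: card_Un_disjoint)
  have dv: "card C dvd card C + Suc (card D)" "card D dvd card D + Suc (card C)"
    using dvdM[OF st(1)] dvdM[OF st(3)] cM st by (simp_all add: add.commute)
  then have "card C dvd Suc (card D)" "card D dvd Suc (card C)"
    unfolding dvd_add_right_iff[OF dvd_refl] .
  from dvd_Suc_cases[OF this] have "card C = 1 \<and> card D = 1"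
    using no2[OF st(1)] no2[OF st(3)] st by auto
  then have "card M = 3" using cM by simp
  then have "order G = 6" using o by simp
  then show ?thesis
  proof (rule iso_integer_mod_group_6_of_central[OF fin _ A.subgroup_axioms cA M.subgroup_axioms \<open>card M = 3\<close>])
    show "x \<otimes> y = y \<otimes> x" if "x \<in> A" "y \<in> M" for x y
      using central[OF that(1), of y] that(2) M.subset by auto
  qed
qed

theorem decomposable_1_2_3:
  assumes fin: "finite (carrier G)" and der: "derived G (carrier G) \<noteq> carrier G"
    and dec: "decomposable {1, 2, 3} G"
  shows "G \<cong> integer_mod_group 6 \<or> G \<cong> dihedral_group 4 \<or> G \<cong> quaternion_group \<or>
    G \<cong> sym_group 4 \<or> G \<cong> SmallGroup_20_3 \<or> G \<cong> SmallGroup_24_3"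
proof -
  have img: "ncc G ` {N. N \<lhd> G \<and> N \<noteq> carrier G} = {1, 2, 3}"
    using dec by (simp add: decomposable_def proper_normal_subgroups_def)
  then have ncc3: "ncc G N \<in> {1, 2, 3}" if "N \<lhd> G" "N \<noteq> carrier G" for N using that by blast
  have "2 \<in> ncc G ` {N. N \<lhd> G \<and> N \<noteq> carrier G}" "3 \<in> ncc G ` {N. N \<lhd> G \<and> N \<noteq> carrier G}"
    unfolding img by auto
  then obtain A B where A: "A \<lhd> G" "A \<noteq> carrier G" "ncc G A = 2"
    and B: "B \<lhd> G" "B \<noteq> carrier G" "ncc G B = 3" by force
  obtain M r where M: "M \<lhd> G" and r: "prime r" and o: "order G = card M * r"
    using exists_normal_prime_index[OF fin der] by blast
  interpret M: normal M G by fact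
  interpret A: normal A G by fact
  interpret B: normal B G by fact
  have finM: "finite M" using fin M.subset finite_subset by blast
  have M0: "card M > 0" using finM M.one_closed card_gt_0_iff by blast
  have MG: "M \<noteq> carrier G" using M0 o prime_gt_1_nat[OF r] by (auto simp: order_def)
  have A1: "A \<noteq> {\<one>}" and B1: "B \<noteq> {\<one>}" using A(3) B(3) ncc_trivial by auto
  have maximal: "N = carrier G" if N: "N \<lhd> G" "M \<subset> N" for N
  proof -
    have sN: "subgroup N G" using N(1) normal_imp_subgroup by blast
    have finN: "finite N" using fin subgroup.subset[OF sN] finite_subset by blast
    obtain k where k: "card N = card M * k" using card_subgroup_dvd[OF M.subgroup_axioms sN] N(2) by blast
    have "card M * 1 < card M * k" using psubset_card_mono[OF finN N(2)] k by simp
    then have "k \<noteq> 1" by simp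
    moreover have "k dvd r" using card_subgroup_dvd_order[OF sN] k o M0 by simp
    ultimately have "k = r" using r prime_nat_iff by blast
    then show ?thesis using k o fin subgroup.subset[OF sN] by (intro card_subset_eq) (auto simp: order_def)
  qed
  consider "ncc G M = 1" | "ncc G M = 2" | "ncc G M = 3" using ncc3[OF M MG] by blast
  then show ?thesis
  proof cases
    case 1
    \<comment> \<open>A trivial M would be a maximal normal subgroup, but B lies properly between it
      and G.\<close>
    then have "M = {\<one>}" by (rule ncc_one[OF fin M])
    then have "M \<subset> B" using B1 B.one_closed by blast
    then show ?thesis using maximal B by blast
  next
    case 2
    \<comment> \<open>M is maximal, so containment would mean B = M or B = G; the former contradicts
      the class counts 2 and 3.\<close>
    have "\<not> M \<subseteq> B" using maximal[OF B(1)] B(2,3) 2 by (cases "M = B") auto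
    then have BM: "B \<inter> M = {\<one>}" using ncc_intersection[OF fin M B(1) 2] by blast
    note comp = normal_complement[OF fin M r o B(1) BM B1]
    have "r = 3" using ncc_central[OF B(1) comp(3)] comp(1) B(3) by simp
    have "M \<noteq> {\<one>}" using 2 ncc_trivial by auto
    then obtain u where u: "u \<in> M" "u \<noteq> \<one>" using M.one_closed by blast
    have uc: "u \<in> carrier G" using u by auto
    have "{\<one>} \<subset> M" using u M.one_closed by blast
    then have "conj_class u = M - {\<one>}"
      using ncc_less(2)[OF fin one_is_normal M] ncc_trivial 2 u by simp
    then have cu: "card (conj_class u) = card M - 1" using finM M.one_closed by simp
    have "B \<subseteq> centralizer u" using comp(3)[OF _ uc] by (auto simp: centralizer_def)
    then have "3 dvd card (centralizer u)"
      using card_subgroup_dvd[OF B.subgroup_axioms subgroup_centralizer[OF uc]] comp(1) \<open>r = 3\<close> by simp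
    then obtain k where "card (centralizer u) = 3 * k" by blast
    \<comment> \<open>M - 1 is a single class, and the central factor B of order 3 lies in C(u). So
      |M| - 1 divides |M|, which gives |M| = 2.\<close>
    then have "(card M - 1) * k = card M" using card_conj_class[OF uc] cu o \<open>r = 3\<close> by simp
    then have "card M - 1 dvd card M" by (metis dvd_triv_left)
    moreover have "coprime (card M - 1) (card M)" using coprime_diff_one_left_nat[OF M0] .
    ultimately have "card M - 1 = 1" using coprime_absorb_left[of "card M - 1" "card M"] by simp
    then have cM: "card M = 2" by simp
    have "G \<cong> integer_mod_group 6"
      by (rule iso_integer_mod_group_6_of_central[OF fin _ M.subgroup_axioms cM B.subgroup_axioms])
        (use o cM \<open>r = 3\<close> comp M.subset in auto)
    then show ?thesis by blast
  next
    case 3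
    show ?thesis
    proof (cases "A \<subseteq> M")
      case False
      then have AM: "A \<inter> M = {\<one>}" using ncc_intersection[OF fin A(1) M A(3)] by blast
      note comp = normal_complement[OF fin M r o A(1) AM A1]
      have "r = 2" using ncc_central[OF A(1) comp(3)] comp(1) A(3) by simp
      have "G \<cong> integer_mod_group 6"
      proof (rule iso_Z6_of_direct_factor_2[OF fin M A(1) AM _ comp(3) _ 3])
        show "ncc G N \<le> 3" if "N \<lhd> G" "N \<noteq> carrier G" for N using ncc3[OF that] by auto
      qed (use comp(1) \<open>r = 2\<close> o in auto)
      then show ?thesis by blast
    next
      case True
      then have AM: "A \<subset> M" using A(3) 3 by auto
      obtain k where k: "card M = card A * k"
        using card_subgroup_dvd[OF A.subgroup_axioms M.subgroup_axioms True] by blast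
      have A1': "{\<one>} \<subset> A" using A1 A.one_closed by blast
      interpret chief_chain G A M r "card A" k
      proof
        show "conj_class u = A - {\<one>}" if "u \<in> A - {\<one>}" for u
          using ncc_less(2)[OF fin one_is_normal A(1) A1' _ that] A(3) ncc_trivial by simp
        \<comment> \<open>A proper normal subgroup strictly above A has more than two classes, hence
          exactly three.\<close>
        show "conj_class x = N - A"
          if N: "N \<lhd> G" "A \<subset> N" "N \<noteq> carrier G" "x \<in> N - A" for N x
          using ncc_less[OF fin A(1) N(1,2)] N(4) ncc3[OF N(1,3)] A(3) by auto
      qed (fact fin A(1) M AM A1 r o k | simp)+
      show ?thesis using chief_chain_cases by blast
    qed
  qed
qed

end

theorem mainTheorem1:
  fixes G :: "('a, 'b) monoid_scheme"
  assumes "group G"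
    and "finite (carrier G)"
    and "derived G (carrier G) \<noteq> carrier G"
    and "decomposable {1, 2, 3} G"
  shows "G \<cong> integer_mod_group 6 \<or>
         G \<cong> dihedral_group 4 \<or>
         G \<cong> quaternion_group \<or>
         G \<cong> sym_group 4 \<or>
         G \<cong> SmallGroup_20_3 \<or>
         G \<cong> SmallGroup_24_3"
  by (rule group.decomposable_1_2_3[OF assms])

end
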